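(* Let $T>0$, $b\in(0,1]$, $\alpha\in(0,1]$, $\lambda>(\alpha-1)/T$, $c\in(0,2^{\alpha-1})$, $a_T=cb\,e^{-\lambda T}T^{\alpha-1}$, $\nu=c\,\Gamma(\alpha)$, and let $\{X_t\}_{0\le t\le T}$ be the process with parameters $(c,\alpha,\lambda,b,T)$ defined in the context. (i) For $0<t\le T$, $\mathrm E(X_t)=t a_T$, and for $k\ge2$, $$\mathrm E(X_t^k)=t^{\alpha(k-1)+1}\frac{a_Tk!\,\nu^{k-1}}{\Gamma((k-1)\alpha)}\int_0^1\int_0^x e^{-\lambda ty}y^{\alpha(k-1)-1}\,dy\,dx .$$ (ii) For $0<t<s\le T$, $$\mathrm E(X_tX_s)=s^{\alpha+1}c\,a_T\int_{t/s}^1\int_0^{t/s}(x_2-x_1)^{\alpha-1}e^{-\lambda s(x_2-x_1)}dx_1dx_2+t^{\alpha+1}2c\,a_T\int_0^1\int_0^xe^{-\lambda ty}y^{\alpha-1}dy\,dx,$$ and $\mathrm{cov}(X_t,X_s)$ equals the right-hand side above minus $ts\,a_T^2$. (iii) Let $\nabla X_t=X_t-X_{t-d}$. For any $s,t>0$ with $s+t\le T$, as $d=\Delta\to0$, $$\mathrm E(\nabla X_s\nabla X_{s+t})\sim c'\Delta^2e^{-\lambda t}t^{\alpha-1},\qquad \mathrm{cov}(\nabla X_s,\nabla X_{s+t})\sim c'\Delta^2\big(e^{-\lambda t}t^{\alpha-1}-be^{-\lambda T}T^{\alpha-1}\big),$$ where $c'=a_Tc$, and $$\mathrm{corr}(\nabla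 X_s,\nabla X_{s+t})\sim\frac{e^{-\lambda t}t^{\alpha-1}-be^{-\lambda T}T^{\alpha-1}}{c''\Delta^{\alpha-1}-be^{-\lambda T}T^{\alpha-1}},\qquad c''=\frac{2}{\alpha(\alpha+1)} .$$ (iv) For any $m\in\mathbb N$, $0<t_1<\cdots<t_m\le T$ and $k_1,\dots,k_m\in\mathbb N$, $$\lim_{d\to0}\frac{\mathrm E\big(\prod_{i=1}^m(\nabla X_{t_i})^{k_i}\big)}{\prod_{i=1}^m\mathrm E\big((\nabla X_{t_i})^{k_i}\big)}=e^{-\lambda(t_m-t_1)}(c/a_T)^{m-1}\prod_{i=2}^m(t_i-t_{i-1})^{\alpha-1}.$$
   Context: $\mathbb N=\{1,2,\dots\}$; $u\sim v$ means $u/v\to1$ in the indicated limit; $d>0$ is small enough that all increments are over intervals contained in $[0,T]$. The process $X$: $X_0=0$, and its finite-dimensional distributions are determined as follows. For $m\in\mathbb N$, $0=t_0<t_1<\cdots<t_m\le T$, $s_1,\dots,s_m\in\mathbb R$, $S_i=\sum_{j=i}^ms_j$, $$\mathrm E\big(e^{s_1X_{t_1}+\cdots+s_mX_{t_m}}\big)=1+a_T\sum_{\emptyset\ne C\subset\{1,\dots,m\}}\ \sum_{k_1,\dots,k_{|C|}\in\mathbb N} t_{C(|C|)}^{\alpha(\sum_{i}k_i-1)+1}\Big(\prod_{i=1}^{|C|}S_{C(i)}^{k_i}\Big)A(C,\{k_i\}),$$ where $C(i)$ is the $i$-th smallest element of $C$ and, with $q=|C|$, $\tau=t_{C(q)}$,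 $C_1=\{i\le q:k_i=1\}$, $C_2=\{i\le q:k_i\ge2\}$, $$A(C,\{k_i\})=\int_{Q_C}\Big\{\tfrac{\nu^{k_1-1}(x_1-x_1')^{\alpha(k_1-1)-1}}{\Gamma((k_1-1)\alpha)}e^{-\lambda\tau(x_1-x_1')}\Big\}^{I(k_1>1)}\prod_{i\in C_2,i\ge2}\Big\{c(x_i'-x_{i-1})^{\alpha-1}\tfrac{\nu^{k_i-1}(x_i-x_i')^{\alpha(k_i-1)-1}}{\Gamma((k_i-1)\alpha)}\Big\}\prod_{j\in C_1,j\ge2}\{c(x_j-x_{j-1})^{\alpha-1}\}\,e^{-\lambda\tau(x_q-x_1)}\,dx'\,dx,$$ integrating over $Q_C$: $t_{C(i)-1}/\tau<x_i'<x_i<t_{C(i)}/\tau$ for $i\in C_2$ and $t_{C(j)-1}/\tau<x_j<t_{C(j)}/\tau$ for $j\in C_1$ (here $t_{C(i)-1}$ is $t_r$ with $r=C(i)-1$). In particular $$\mathrm E(e^{sX_t})=1+ta_Ts+a_T\sum_{k\ge1}s^{k+1}\nu^k\int_0^t\int_0^x\frac{e^{-\lambda y}y^{k\alpha-1}}{\Gamma(k\alpha)}dy\,dx .$$ (This $X$ is the weak limit in $D[0,T]$ of $n^{-\alpha}\sum_{i\le\lfloor nt\rfloor}\xi_i^{(n)}$, where the binary variables $\xi_i^{(n)}$, $i\le\lfloor nT\rfloor$, satisfy $P(\xi_{i_1}^{(n)}=\cdots=\xi_{i_k}^{(n)}=1)=bf_n(\lfloor nT\rfloor)\prod_{j=1}^{k-1}f_n(i_{j+1}-i_j)$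 for $i_1<\cdots<i_k$, with $f_n(x)=ce^{-\lambda x/n}x^{\alpha-1}$; it has stationary increments.) *)

theory Defs
  imports "HOL-Probability.Probability"
begin

(* The i-th smallest element, counted from 1, of a finite set with at least i elements. *)
definition nth_smallest :: "nat set \<Rightarrow> nat \<Rightarrow> nat" where
  "nth_smallest C i = sorted_list_of_set C ! (i - 1)"

definition block_one :: "nat set \<Rightarrow> (nat \<Rightarrow> nat) \<Rightarrow> nat set" where
  "block_one C k = {i \<in> {1..card C}. k i = 1}"

definition block_many :: "nat set \<Rightarrow> (nat \<Rightarrow> nat) \<Rightarrow> nat set" where
  "block_many C k = {i \<in> {1..card C}. k i \<ge> 2}"

(* The region Q_C. A point is a pair (x', x), where x' has its coordinates indexed by
   block_many C k and x has its coordinates indexed by {1..card C}. *)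
definition mgf_region ::
  "(nat \<Rightarrow> real) \<Rightarrow> nat set \<Rightarrow> (nat \<Rightarrow> nat) \<Rightarrow> ((nat \<Rightarrow> real) \<times> (nat \<Rightarrow> real)) set" where
  "mgf_region t C k =
     (let \<tau> = t (nth_smallest C (card C)) in
      {(x', x).
        (\<forall>i \<in> block_many C k.
            t (nth_smallest C i - 1) / \<tau> < x' i \<and> x' i < x i \<and> x i < t (nth_smallest C i) / \<tau>) \<and>
        (\<forall>j \<in> block_one C k.
            t (nth_smallest C j - 1) / \<tau> < x j \<and> x j < t (nth_smallest C j) / \<tau>)})"

(* The integral A(C, {k_i}); here nu = c Gamma(alpha). *)
definition mgf_coeff ::
  "real \<Rightarrow> real \<Rightarrow> real \<Rightarrow> (nat \<Rightarrow> real) \<Rightarrow> nat set \<Rightarrow> (nat \<Rightarrow> nat) \<Rightarrow> real" where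
  "mgf_coeff c \<alpha> lam t C k =
     (let q = card C; \<tau> = t (nth_smallest C q); \<nu> = c * Gamma \<alpha>;
          w = (\<lambda>n u. \<nu> ^ (n - 1) * u powr (\<alpha> * real (n - 1) - 1) / Gamma (real (n - 1) * \<alpha>))
      in LINT p : mgf_region t C k
            | (PiM (block_many C k) (\<lambda>_. lborel) \<Otimes>\<^sub>M PiM {1..q} (\<lambda>_. lborel)).
          (let x' = fst p; x = snd p in
            (if k 1 > 1 then w (k 1) (x 1 - x' 1) * exp (- lam * \<tau> * (x 1 - x' 1)) else 1) *
            (\<Prod>i \<in> {i \<in> block_many C k. i \<ge> 2}.
                c * (x' i - x (i - 1)) powr (\<alpha> - 1) * w (k i) (x i - x' i)) *
            (\<Prod>j \<in> {j \<in> block_one C k. j \<ge> 2}. c * (x j - x (j - 1)) powr (\<alpha> - 1)) *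
            exp (- lam * \<tau> * (x q - x 1))))"

(* The summand indexed by (C, {k_i}) of the joint moment generating function of
   X (t 1), ..., X (t m) at (s 1, ..., s m), without the factor a_T. *)
definition mgf_summand ::
  "real \<Rightarrow> real \<Rightarrow> real \<Rightarrow> nat \<Rightarrow> (nat \<Rightarrow> real) \<Rightarrow> (nat \<Rightarrow> real) \<Rightarrow> nat set \<Rightarrow> (nat \<Rightarrow> nat) \<Rightarrow> real" where
  "mgf_summand c \<alpha> lam m t s C k =
     t (nth_smallest C (card C)) powr (\<alpha> * (real (\<Sum>i=1..card C. k i) - 1) + 1) *
     (\<Prod>i=1..card C. (\<Sum>j=nth_smallest C i..m. s j) ^ k i) *
     mgf_coeff c \<alpha> lam t C k"

definition rate_const :: "real \<Rightarrow> real \<Rightarrow> real \<Rightarrow> real \<Rightarrow> real \<Rightarrow> real" where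
  "rate_const c \<alpha> lam b T = c * b * exp (- lam * T) * T powr (\<alpha> - 1)"

(* X is a process on [0,T], given through its finite-dimensional distributions: the joint moment
   generating functions are finite everywhere and equal to the (convergent) expansion below.
   The multi-indices k range over all functions {1..card C} -> {1,2,...}. *)
definition is_limit_process ::
  "real \<Rightarrow> real \<Rightarrow> real \<Rightarrow> real \<Rightarrow> real \<Rightarrow> 'a measure \<Rightarrow> (real \<Rightarrow> 'a \<Rightarrow> real) \<Rightarrow> bool" where
  "is_limit_process c \<alpha> lam b T M X \<longleftrightarrow>
     prob_space M \<and>
     (\<forall>u \<in> {0..T}. X u \<in> borel_measurable M) \<and>
     (AE \<omega> in M. X 0 \<omega> = 0) \<and>
     (\<forall>m t s. m \<ge> 1 \<and> t 0 = 0 \<and> (\<forall>i \<in> {1..m}. t (i - 1) < t i) \<and> t m \<le> T \<longrightarrow>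
        integrable M (\<lambda>\<omega>. exp (\<Sum>i=1..m. s i * X (t i) \<omega>)) \<and>
        (\<forall>C. C \<noteq> {} \<and> C \<subseteq> {1..m} \<longrightarrow>
           mgf_summand c \<alpha> lam m t s C summable_on ({1..card C} \<rightarrow>\<^sub>E {1..})) \<and>
        (\<integral>\<omega>. exp (\<Sum>i=1..m. s i * X (t i) \<omega>) \<partial>M) =
          1 + rate_const c \<alpha> lam b T *
            (\<Sum>C \<in> {C. C \<noteq> {} \<and> C \<subseteq> {1..m}}.
               \<Sum>\<^sub>\<infinity>k \<in> {1..card C} \<rightarrow>\<^sub>E {1..}. mgf_summand c \<alpha> lam m t s C k))"

definition cov :: "'a measure \<Rightarrow> ('a \<Rightarrow> real) \<Rightarrow> ('a \<Rightarrow> real) \<Rightarrow> real" where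
  "cov M Y Z = (\<integral>\<omega>. (Y \<omega> - (\<integral>\<omega>'. Y \<omega>' \<partial>M)) * (Z \<omega> - (\<integral>\<omega>'. Z \<omega>' \<partial>M)) \<partial>M)"

definition corr :: "'a measure \<Rightarrow> ('a \<Rightarrow> real) \<Rightarrow> ('a \<Rightarrow> real) \<Rightarrow> real" where
  "corr M Y Z = cov M Y Z / sqrt (cov M Y Y * cov M Z Z)"

definition backward_incr :: "(real \<Rightarrow> 'a \<Rightarrow> real) \<Rightarrow> real \<Rightarrow> real \<Rightarrow> 'a \<Rightarrow> real" where
  "backward_incr X d t = (\<lambda>\<omega>. X t \<omega> - X (t - d) \<omega>)"

end

theory Submission
  imports Defs "HOL-Real_Asymp.Real_Asymp"
begin

text \<open>
  In terms of the increments over a grid, the joint moment generating function is a multiple power series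
  in independent variables, so the mixed moments of increments can be read off: each is, up to factorials,
  a single coefficient integral. For one grid point this gives (i), and for two points (ii), because
  \<open>X\<^sub>t X\<^sub>s = X\<^sub>t\<^sup>2 + X\<^sub>t (X\<^sub>s - X\<^sub>t)\<close>. For increments over short intervals, all factors of the integrand that
  couple different intervals are nearly constant, so the integral factorizes asymptotically into elementary
  one-interval integrals; this gives (iv) and, with second moments, the covariances and correlations
  in (iii). The denominators in (iii) are nonzero because \<open>exp (- lam * t) * t powr (\<alpha> - 1)\<close>
  is strictly decreasing in \<open>t \<in> {0<..T}\<close>.
\<close>

subsection \<open>Mixed moments from moment generating functions\<close>

text \<open>The integrands of the coefficient integrals are nonnegative but may be singular for
  \<open>\<alpha> < 1\<close>, so the integrals are handled as nonnegative integrals: Tonelli and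
  monotonicity then need no prior integrability. They live on a region rescaled by the last time
  \<open>\<tau>\<close>, and the prefactor in \<open>mgf_summand\<close> is the power of
  \<open>\<tau>\<close> that undoes the rescaling. One increment of length d has k-th moment
  asymptotic to a_T k! \<nu>^(k-1) d^(\<alpha>(k-1)+1) / Gamma(\<alpha>(k-1)+2). For k = 2 this is
  a_T c d^2 times 2/(\<alpha>(\<alpha>+1)) d^(\<alpha>-1), the origin of c''. A product of two means
  is a_T^2 d^2. It has the order of the mixed second moment for every \<alpha>, and of the second
  moment itself when \<alpha> = 1, so it survives in the covariance and, for \<alpha> = 1, in the
  variance.\<close>

lemma powser_sums_unique:
  fixes a b :: "nat \<Rightarrow> real"
  assumes "\<And>x. (\<lambda>n. a n * x ^ n) sums f x" and "\<And>x. (\<lambda>n. b n * x ^ n) sums f x"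
  shows "a n = b n"
proof -
  define e where "e n = a n - b n" for n
  have e: "(\<lambda>n. e n * x ^ n) sums 0" for x
    using sums_diff[OF assms(1)[of x] assms(2)[of x]] by (simp add: e_def algebra_simps)
  have "e n = 0"
  proof (induction n rule: less_induct)
    case (less n)
    \<comment> \<open>Dividing by \<open>x ^ n\<close> leaves a power series with constant term
      \<open>e n\<close> that vanishes away from the origin; its limit at 0 is both
      \<open>e n\<close> and 0.\<close>
    have "(\<lambda>k. e (k + n) * x ^ k) sums 0" if "x \<noteq> 0" for x
    proof -
      have "(\<lambda>k. e (k + n) * x ^ (k + n)) sums (0 - (\<Sum>k<n. e k * x ^ k))"
        using sums_split_initial_segment[OF e[of x], of n] by simp
      then have "(\<lambda>k. inverse (x ^ n) * (e (k + n) * x ^ (k + n))) sums (inverse (x ^ n) * 0)"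
        by (intro sums_mult) (simp add: less)
      moreover have "inverse (x ^ n) * (e (k + n) * x ^ (k + n)) = e (k + n) * x ^ k" for k
        using that by (simp add: power_add field_simps)
      ultimately show ?thesis by simp
    qed
    then have "((\<lambda>_. 0) \<longlongrightarrow> e (0 + n)) (at (0::real))"
      by (intro powser_limit_0_strong[where a = "\<lambda>k. e (k + n)" and s = 1]) auto
    then show ?case
      using tendsto_unique[OF _ tendsto_const[of "0::real" "at (0::real)"]] by force
  qed
  then show ?thesis by (simp add: e_def)
qed

text \<open>The exponential series is integrated term by term under the majorant \<open>w\<close>,
  whose integrability is the hypothesis at \<open>x\<close> and at \<open>- x\<close>. The weight
  \<open>Z\<close> will hold the factors of all variables other than the one being expanded.\<close>

lemma mgf_expansion:
  fixes Z Y :: "'a \<Rightarrow> real"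
  assumes [measurable]: "Z \<in> borel_measurable M" "Y \<in> borel_measurable M"
    and int: "\<And>x. integrable M (\<lambda>\<omega>. Z \<omega> * exp (x * Y \<omega>))"
  shows "integrable M (\<lambda>\<omega>. Z \<omega> * Y \<omega> ^ n)"
    and "(\<lambda>n. (\<integral>\<omega>. Z \<omega> * Y \<omega> ^ n \<partial>M) / fact n * x ^ n) sums (\<integral>\<omega>. Z \<omega> * exp (x * Y \<omega>) \<partial>M)"
proof -
  define w where "w x \<omega> = \<bar>Z \<omega> * exp (x * Y \<omega>)\<bar> + \<bar>Z \<omega> * exp (- x * Y \<omega>)\<bar>" for x \<omega>
  have w: "integrable M (w x)" for x
    unfolding w_def by (intro Bochner_Integration.integrable_add integrable_abs int)
  have partial: "\<bar>Z \<omega>\<bar> * (\<Sum>n<N. \<bar>x * Y \<omega>\<bar> ^ n / fact n) \<le> w x \<omega>" for x N \<omega>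
  proof -
    have "(\<Sum>n<N. \<bar>x * Y \<omega>\<bar> ^ n / fact n) \<le> exp \<bar>x * Y \<omega>\<bar>"
      using exp_converges[of "\<bar>x * Y \<omega>\<bar>"] sum_le_suminf[of "\<lambda>n. \<bar>x * Y \<omega>\<bar> ^ n / fact n" "{..<N}"]
      by (auto simp: sums_iff divide_inverse mult.commute)
    also have "\<dots> \<le> exp (x * Y \<omega>) + exp (- x * Y \<omega>)"
      by (auto simp: abs_if)
    finally show ?thesis
      unfolding w_def abs_mult abs_exp_cancel by (metis abs_ge_zero distrib_left mult_left_mono)
  qed
  show intn: "integrable M (\<lambda>\<omega>. Z \<omega> * Y \<omega> ^ n)" for n
  proof (rule Bochner_Integration.integrable_bound)
    show "integrable M (\<lambda>\<omega>. fact n * w 1 \<omega>)" using w by simp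
    show "AE \<omega> in M. norm (Z \<omega> * Y \<omega> ^ n) \<le> norm (fact n * w 1 \<omega>)"
    proof (intro AE_I2)
      fix \<omega>
      \<comment> \<open>A single term of the series at \<open>x = 1\<close> already bounds the
        monomial, up to the factor \<open>fact n\<close>.\<close>
      have "\<bar>Z \<omega>\<bar> * (\<bar>Y \<omega>\<bar> ^ n / fact n) \<le> \<bar>Z \<omega>\<bar> * (\<Sum>k<Suc n. \<bar>1 * Y \<omega>\<bar> ^ k / fact k)"
        by (intro mult_left_mono) (auto intro!: sum_nonneg)
      also have "\<dots> \<le> w 1 \<omega>" by (rule partial)
      also have "\<dots> \<le> \<bar>w 1 \<omega>\<bar>" by simp
      finally show "norm (Z \<omega> * Y \<omega> ^ n) \<le> norm (fact n * w 1 \<omega>)"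
        by (simp add: abs_mult power_abs field_simps)
    qed
  qed simp
  have "(\<lambda>N. \<integral>\<omega>. (\<Sum>n<N. Z \<omega> * ((x * Y \<omega>) ^ n / fact n)) \<partial>M) \<longlonglongrightarrow> (\<integral>\<omega>. Z \<omega> * exp (x * Y \<omega>) \<partial>M)"
  proof (rule integral_dominated_convergence[where w = "w x"])
    have "(\<lambda>n. (x * Y \<omega>) ^ n / fact n) sums exp (x * Y \<omega>)" for \<omega>
      using exp_converges[of "x * Y \<omega>"] by (simp add: divide_inverse mult.commute)
    then show "AE \<omega> in M. (\<lambda>N. \<Sum>n<N. Z \<omega> * ((x * Y \<omega>) ^ n / fact n)) \<longlonglongrightarrow> Z \<omega> * exp (x * Y \<omega>)"
      using sums_mult unfolding sums_def by blast
    show "AE \<omega> in M. norm (\<Sum>n<N. Z \<omega> * ((x * Y \<omega>) ^ n / fact n)) \<le> w x \<omega>" for N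
    proof (intro AE_I2)
      fix \<omega>
      have "norm (\<Sum>n<N. Z \<omega> * ((x * Y \<omega>) ^ n / fact n)) \<le> \<bar>Z \<omega>\<bar> * (\<Sum>n<N. \<bar>x * Y \<omega>\<bar> ^ n / fact n)"
        unfolding sum_distrib_left by (rule order.trans[OF sum_norm_le]) (auto simp: abs_mult power_abs)
      also have "\<dots> \<le> w x \<omega>" by (rule partial)
      finally show "norm (\<Sum>n<N. Z \<omega> * ((x * Y \<omega>) ^ n / fact n)) \<le> w x \<omega>" .
    qed
  qed (use w in auto)
  also have "(\<lambda>N. \<integral>\<omega>. (\<Sum>n<N. Z \<omega> * ((x * Y \<omega>) ^ n / fact n)) \<partial>M) =
      (\<lambda>N. \<Sum>n<N. (\<integral>\<omega>. Z \<omega> * Y \<omega> ^ n \<partial>M) / fact n * x ^ n)"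
  proof
    fix N
    have *: "Z \<omega> * ((x * Y \<omega>) ^ n / fact n) = (Z \<omega> * Y \<omega> ^ n) * (x ^ n / fact n)" for \<omega> n
      by (simp add: power_mult_distrib)
    show "(\<integral>\<omega>. (\<Sum>n<N. Z \<omega> * ((x * Y \<omega>) ^ n / fact n)) \<partial>M) =
        (\<Sum>n<N. (\<integral>\<omega>. Z \<omega> * Y \<omega> ^ n \<partial>M) / fact n * x ^ n)"
      unfolding * Bochner_Integration.integral_sum[OF integrable_mult_left[OF intn]] integral_mult_left_zero
      by simp
  qed
  finally show "(\<lambda>n. (\<integral>\<omega>. Z \<omega> * Y \<omega> ^ n \<partial>M) / fact n * x ^ n) sums (\<integral>\<omega>. Z \<omega> * exp (x * Y \<omega>) \<partial>M)"
    by (simp add: sums_def)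
qed

text \<open>Induction on the index set: comparing the expansions in the variable of one index \<open>j\<close> replaces
the weight \<open>W\<close> by \<open>W * Y j ^ n\<close>, so the uniqueness of power series in one variable suffices.\<close>

lemma mixed_moments_from_mgf:
  fixes Y :: "'i \<Rightarrow> 'a \<Rightarrow> real" and W :: "'a \<Rightarrow> real"
  assumes "finite I" and "W \<in> borel_measurable M" and "\<And>i. i \<in> I \<Longrightarrow> Y i \<in> borel_measurable M"
    and "\<And>u. integrable M (\<lambda>\<omega>. W \<omega> * exp (\<Sum>i\<in>I. u i * Y i \<omega>))"
    and "\<And>u. ((\<lambda>\<kappa>. a \<kappa> * (\<Prod>i\<in>I. u i ^ \<kappa> i)) has_sum
               (\<integral>\<omega>. W \<omega> * exp (\<Sum>i\<in>I. u i * Y i \<omega>) \<partial>M)) (I \<rightarrow>\<^sub>E UNIV)"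
    and "\<kappa> \<in> I \<rightarrow>\<^sub>E UNIV"
  shows "integrable M (\<lambda>\<omega>. W \<omega> * (\<Prod>i\<in>I. Y i \<omega> ^ \<kappa> i))"
    and "(\<integral>\<omega>. W \<omega> * (\<Prod>i\<in>I. Y i \<omega> ^ \<kappa> i) \<partial>M) = (\<Prod>i\<in>I. fact (\<kappa> i)) * a \<kappa>"
proof -
  have "integrable M (\<lambda>\<omega>. W \<omega> * (\<Prod>i\<in>I. Y i \<omega> ^ \<kappa> i)) \<and>
      (\<integral>\<omega>. W \<omega> * (\<Prod>i\<in>I. Y i \<omega> ^ \<kappa> i) \<partial>M) = (\<Prod>i\<in>I. fact (\<kappa> i)) * a \<kappa>"
    using assms
  proof (induction I arbitrary: W a \<kappa> rule: finite_induct)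
    case empty
    then show ?case using empty(3)[of undefined] empty(4)[of undefined]
      by (simp add: has_sum_finite_iff)
  next
    case (insert j I)
    note [measurable] = insert.prems(1) and Ym = insert.prems(2)
    have [measurable]: "Y j \<in> borel_measurable M" by (simp add: Ym)
    obtain n g where \<kappa>: "\<kappa> = g(j := n)" and g: "g \<in> I \<rightarrow>\<^sub>E UNIV"
      using insert.prems(5) unfolding PiE_insert_eq by auto
    \<comment> \<open>The weight seen by the variable of \<open>j\<close>: the exponentials of the
      remaining variables stay unexpanded inside it.\<close>
    define Z where "Z u \<omega> = W \<omega> * exp (\<Sum>i\<in>I. u i * Y i \<omega>)" for u \<omega>
    have Zm [measurable]: "Z u \<in> borel_measurable M" for u
      using Ym unfolding Z_def by (intro borel_measurable_times borel_measurable_exp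
          measurable_compose[OF borel_measurable_sum borel_measurable_exp]) auto
    have ex: "W \<omega> * exp (\<Sum>i\<in>insert j I. (u(j := x)) i * Y i \<omega>) = Z u \<omega> * exp (x * Y j \<omega>)" for u x \<omega>
    proof -
      have "(\<Sum>i\<in>I. (u(j := x)) i * Y i \<omega>) = (\<Sum>i\<in>I. u i * Y i \<omega>)"
        by (intro sum.cong) (use insert.hyps in auto)
      then show ?thesis unfolding Z_def using insert.hyps by (simp add: exp_add)
    qed
    have Zint: "integrable M (\<lambda>\<omega>. Z u \<omega> * exp (x * Y j \<omega>))" for u x
      using insert.prems(3)[of "u(j := x)"] unfolding ex .
    have inj: "inj_on (\<lambda>(y, g). g(j := y)) (UNIV \<times> (I \<rightarrow>\<^sub>E (UNIV :: nat set)))"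
      using inj_combinator[OF insert.hyps(2), of "\<lambda>_. UNIV"] by simp
    have S: "((\<lambda>(n, g). x ^ n * (a (g(j := n)) * (\<Prod>i\<in>I. u i ^ g i))) has_sum
        (\<integral>\<omega>. Z u \<omega> * exp (x * Y j \<omega>) \<partial>M)) (UNIV \<times> (I \<rightarrow>\<^sub>E UNIV))" for u x
    proof -
      have *: "a (g(j := n)) * (\<Prod>i\<in>insert j I. (u(j := x)) i ^ (g(j := n)) i) =
          x ^ n * (a (g(j := n)) * (\<Prod>i\<in>I. u i ^ g i))" for g n
      proof -
        have "(\<Prod>i\<in>I. (u(j := x)) i ^ (g(j := n)) i) = (\<Prod>i\<in>I. u i ^ g i)"
          by (intro prod.cong) (use insert.hyps in auto)
        then show ?thesis using insert.hyps by simp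
      qed
      show ?thesis
        using insert.prems(4)[of "u(j := x)"]
        unfolding ex PiE_insert_eq
        unfolding has_sum_reindex[OF inj]
        by (simp add: case_prod_unfold o_def * del: fun_upd_apply)
    qed
    define b where "b u n = (\<Sum>\<^sub>\<infinity>g\<in>I \<rightarrow>\<^sub>E UNIV. a (g(j := n)) * (\<Prod>i\<in>I. u i ^ g i))" for u n
    have b: "((\<lambda>g. a (g(j := n)) * (\<Prod>i\<in>I. u i ^ g i)) has_sum b u n) (I \<rightarrow>\<^sub>E UNIV)" for u n
      \<comment> \<open>At \<open>x = 1\<close> the factor \<open>x ^ n\<close> disappears, so
        summability over the product set gives summability of every slice.\<close>
      unfolding b_def using summable_on_SigmaD1[OF has_sum_imp_summable[OF S[of 1 u]], of n]
      by (intro has_sum_infsum) simp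
    \<comment> \<open>For fixed \<open>u\<close> both sides are coefficients of the same power
      series in \<open>x\<close>: one from expanding the exponential, one from summing the given
      family over the other exponents first.\<close>
    have "(\<integral>\<omega>. Z u \<omega> * Y j \<omega> ^ n \<partial>M) / fact n = b u n" for u n
    proof (rule powser_sums_unique)
      show "(\<lambda>n. (\<integral>\<omega>. Z u \<omega> * Y j \<omega> ^ n \<partial>M) / fact n * x ^ n) sums (\<integral>\<omega>. Z u \<omega> * exp (x * Y j \<omega>) \<partial>M)" for x
        by (rule mgf_expansion) (auto intro: Zint)
      have "((\<lambda>n. x ^ n * b u n) has_sum (\<integral>\<omega>. Z u \<omega> * exp (x * Y j \<omega>) \<partial>M)) UNIV" for x
        using has_sum_SigmaD[OF S[of x u], of "\<lambda>n. x ^ n * b u n"] has_sum_cmult_right[OF b]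
        by auto
      then show "(\<lambda>n. b u n * x ^ n) sums (\<integral>\<omega>. Z u \<omega> * exp (x * Y j \<omega>) \<partial>M)" for x
        by (intro has_sum_imp_sums) (simp add: mult.commute)
    qed
    then have Zn: "(\<integral>\<omega>. Z u \<omega> * Y j \<omega> ^ n \<partial>M) = fact n * b u n" for u n
      by (simp add: field_simps)
    have comm: "(W \<omega> * Y j \<omega> ^ n) * exp (\<Sum>i\<in>I. u i * Y i \<omega>) = Z u \<omega> * Y j \<omega> ^ n" for u \<omega>
      by (simp add: Z_def)
    have IH: "integrable M (\<lambda>\<omega>. (W \<omega> * Y j \<omega> ^ n) * (\<Prod>i\<in>I. Y i \<omega> ^ g i)) \<and>
        (\<integral>\<omega>. (W \<omega> * Y j \<omega> ^ n) * (\<Prod>i\<in>I. Y i \<omega> ^ g i) \<partial>M) =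
        (\<Prod>i\<in>I. fact (g i)) * (fact n * a (g(j := n)))"
    proof (rule insert.IH)
      show "integrable M (\<lambda>\<omega>. (W \<omega> * Y j \<omega> ^ n) * exp (\<Sum>i\<in>I. u i * Y i \<omega>))" for u
        unfolding comm by (rule mgf_expansion) (auto intro: Zint)
      show "((\<lambda>\<kappa>. fact n * a (\<kappa>(j := n)) * (\<Prod>i\<in>I. u i ^ \<kappa> i)) has_sum
          (\<integral>\<omega>. (W \<omega> * Y j \<omega> ^ n) * exp (\<Sum>i\<in>I. u i * Y i \<omega>) \<partial>M)) (I \<rightarrow>\<^sub>E UNIV)" for u
        unfolding comm Zn using has_sum_cmult_right[OF b, of "fact n"] by (simp add: mult.assoc)
    qed (use Ym g in auto)
    have "(\<Prod>i\<in>I. Y i \<omega> ^ \<kappa> i) = (\<Prod>i\<in>I. Y i \<omega> ^ g i)" for \<omega>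
      unfolding \<kappa> by (intro prod.cong) (use insert.hyps in auto)
    moreover have "(\<Prod>i\<in>I. fact (\<kappa> i) :: real) = (\<Prod>i\<in>I. fact (g i))"
      unfolding \<kappa> by (intro prod.cong) (use insert.hyps in auto)
    ultimately show ?case using IH insert.hyps by (simp add: \<kappa> mult_ac fun_upd_def)
  qed
  then show "integrable M (\<lambda>\<omega>. W \<omega> * (\<Prod>i\<in>I. Y i \<omega> ^ \<kappa> i))"
    and "(\<integral>\<omega>. W \<omega> * (\<Prod>i\<in>I. Y i \<omega> ^ \<kappa> i) \<partial>M) = (\<Prod>i\<in>I. fact (\<kappa> i)) * a \<kappa>" by auto
qed

subsection \<open>Mixed moments of increments\<close>

lemma bij_betw_nth_smallest:
  assumes "finite C"
  shows "bij_betw (nth_smallest C) {1..card C} C"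
proof -
  have "bij_betw ((!) (sorted_list_of_set C)) {..<card C} C"
    using assms by (intro bij_betw_nth) auto
  moreover have "bij_betw (\<lambda>i. i - 1) {1..card C} {..<card C}"
    by (rule bij_betwI[where g = Suc]) auto
  ultimately have "bij_betw ((!) (sorted_list_of_set C) \<circ> (\<lambda>i. i - 1)) {1..card C} C"
    by (rule bij_betw_trans[rotated])
  then show ?thesis
    by (simp add: nth_smallest_def[abs_def] o_def)
qed

text \<open>Allows a subset \<open>C\<close> to be given by its increasing enumeration
  \<open>f\<close>, which is how the later lemmas select intervals.\<close>

lemma nth_smallest_image:
  assumes "strict_mono_on {1..q} f" and "i \<in> {1..q}"
  shows "nth_smallest (f ` {1..q}) i = f i"
proof -
  have "sorted_wrt (<) (map f [1..<Suc q])"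
    unfolding sorted_wrt_map
    by (rule sorted_wrt_mono_rel[OF _ sorted_wrt_upt]) (use assms in \<open>auto simp: strict_mono_on_def\<close>)
  then have "sorted_list_of_set (set (map f [1..<Suc q])) = map f [1..<Suc q]"
    by (intro sorted_list_of_set.idem_if_sorted_distinct) (auto simp: strict_sorted_iff)
  moreover have "set (map f [1..<Suc q]) = f ` {1..q}" by auto
  moreover obtain j where "i = Suc j" "j < q" using assms(2) by (cases i) auto
  ultimately show ?thesis by (simp add: nth_smallest_def nth_map del: upt_Suc)
qed

text \<open>The expansion ranges over extensional exponent functions, whereas moments are stated for
  arbitrary \<open>k\<close>. Nonemptiness matters because \<open>mgf_coeff\<close> inspects
  \<open>k 1\<close> unconditionally.\<close>

lemma mgf_coeff_restrict:
  assumes "C \<noteq> {}" and "finite C"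
  shows "mgf_coeff c \<alpha> lam t C (restrict k {1..card C}) = mgf_coeff c \<alpha> lam t C k"
proof -
  have "card C \<ge> 1" using assms by (simp add: Suc_le_eq card_gt_0_iff)
  then have 1: "restrict k {1..card C} 1 = k 1" by simp
  have m: "block_many C (restrict k {1..card C}) = block_many C k"
    "block_one C (restrict k {1..card C}) = block_one C k"
    by (auto simp: block_many_def block_one_def)
  have r: "(\<Prod>i\<in>{i \<in> block_many C k. 2 \<le> i}. h i (restrict k {1..card C} i)) =
      (\<Prod>i\<in>{i \<in> block_many C k. 2 \<le> i}. h i (k i))" for h :: "nat \<Rightarrow> nat \<Rightarrow> real"
    by (rule prod.cong) (auto simp: block_many_def)
  show ?thesis
    unfolding mgf_coeff_def mgf_region_def Let_def m 1
    by (subst r[of "\<lambda>i n. c * (_ i) powr _ * _ i n"]) (rule refl)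
qed

text \<open>Summation by parts. Where it is applied both boundary terms vanish: \<open>x 0\<close>
  becomes \<open>X 0\<close>, which is almost surely 0, and \<open>v\<close> is cut off after
  \<open>m\<close>.\<close>

lemma abel_sum:
  fixes v x :: "nat \<Rightarrow> real"
  shows "(\<Sum>i=1..m. (v i - v (Suc i)) * x i) =
    (\<Sum>i=1..m. v i * (x i - x (i - 1))) + v 1 * x 0 - v (Suc m) * x m"
  by (induction m) (auto simp: algebra_simps)

text \<open>\<open>mgf_summand\<close> without the powers of the partial sums of \<open>s\<close>:
  up to \<open>rate_const\<close>, the coefficient of a monomial in the free variables
  \<open>u\<close>.\<close>

definition increment_coeff ::
  "real \<Rightarrow> real \<Rightarrow> real \<Rightarrow> (nat \<Rightarrow> real) \<Rightarrow> nat set \<Rightarrow> (nat \<Rightarrow> nat) \<Rightarrow> real" where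
  "increment_coeff c \<alpha> lam t C k =
     t (nth_smallest C (card C)) powr (\<alpha> * (real (\<Sum>i=1..card C. k i) - 1) + 1) *
     mgf_coeff c \<alpha> lam t C k"

definition exponent_support :: "nat \<Rightarrow> (nat \<Rightarrow> nat) \<Rightarrow> nat set" where
  "exponent_support m \<kappa> = {i \<in> {1..m}. \<kappa> i \<noteq> 0}"

text \<open>With \<open>exponent_support\<close>, the dictionary between exponent vectors on
  \<open>{1..m}\<close> that may contain zeros and pairs of a set \<open>C\<close> with positive
  exponents numbered by rank in \<open>C\<close>.\<close>

definition compress :: "nat set \<Rightarrow> (nat \<Rightarrow> nat) \<Rightarrow> nat \<Rightarrow> nat" where
  "compress C \<kappa> = (\<lambda>i\<in>{1..card C}. \<kappa> (nth_smallest C i))"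

lemma bij_betw_compress:
  assumes "C \<subseteq> {1..m}"
  shows "bij_betw (compress C) {\<kappa> \<in> {1..m} \<rightarrow>\<^sub>E UNIV. exponent_support m \<kappa> = C} ({1..card C} \<rightarrow>\<^sub>E {1..})"
proof -
  have fin: "finite C" using assms finite_subset by blast
  let ?n = "nth_smallest C"
  let ?inv = "inv_into {1..card C} ?n"
  have bij: "bij_betw ?n {1..card C} C" by (rule bij_betw_nth_smallest[OF fin])
  have inC: "?n i \<in> C" if "i \<in> {1..card C}" for i using bij that by (auto simp: bij_betw_def)
  have left: "?inv (?n i) = i" if "i \<in> {1..card C}" for i
    using bij_betw_inv_into_left[OF bij that] .
  have right: "?n (?inv j) = j" if "j \<in> C" for j
    using bij_betw_inv_into_right[OF bij that] .
  have inv: "?inv j \<in> {1..card C}" if "j \<in> C" for j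
    using bij_betw_apply[OF bij_betw_inv_into[OF bij] that] .
  show ?thesis
  \<comment> \<open>The inverse puts the exponent of rank \<open>i\<close> at the
    \<open>i\<close>-th element of \<open>C\<close> and 0 at the rest of \<open>{1..m}\<close>;
    outside \<open>{1..m}\<close> the value stays \<open>undefined\<close>, as extensionality
    demands.\<close>
  proof (rule bij_betwI[where g = "\<lambda>k. \<lambda>j\<in>{1..m}. if j \<in> C then k (?inv j) else 0"])
    show "compress C \<in> {\<kappa> \<in> {1..m} \<rightarrow>\<^sub>E UNIV. exponent_support m \<kappa> = C} \<rightarrow> {1..card C} \<rightarrow>\<^sub>E {1..}"
      using inC unfolding compress_def exponent_support_def by fastforce
    show "(\<lambda>k. \<lambda>j\<in>{1..m}. if j \<in> C then k (?inv j) else 0) \<in>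
        ({1..card C} \<rightarrow>\<^sub>E {1..}) \<rightarrow> {\<kappa> \<in> {1..m} \<rightarrow>\<^sub>E UNIV. exponent_support m \<kappa> = C}"
    proof (intro funcsetI CollectI conjI)
      fix k :: "nat \<Rightarrow> nat" assume k: "k \<in> {1..card C} \<rightarrow>\<^sub>E {1..}"
      have "k (?inv j) \<noteq> 0" if "j \<in> C" for j
        using PiE_mem[OF k inv[OF that]] by simp
      then show "exponent_support m (\<lambda>j\<in>{1..m}. if j \<in> C then k (?inv j) else 0) = C"
        using assms unfolding exponent_support_def by auto
    qed simp
    show "(\<lambda>j\<in>{1..m}. if j \<in> C then compress C \<kappa> (?inv j) else 0) = \<kappa>"
      if "\<kappa> \<in> {\<kappa> \<in> {1..m} \<rightarrow>\<^sub>E UNIV. exponent_support m \<kappa> = C}" for \<kappa>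
    proof
      fix j
      show "(\<lambda>j\<in>{1..m}. if j \<in> C then compress C \<kappa> (?inv j) else 0) j = \<kappa> j"
      proof (cases "j \<in> {1..m}")
        case True
        show ?thesis
        proof (cases "j \<in> C")
          case True
          then show ?thesis using \<open>j \<in> {1..m}\<close> inv[OF True] right[OF True] by (simp add: compress_def del: One_nat_def)
        next
          case False
          moreover have "\<kappa> j = 0" using that False True by (auto simp: exponent_support_def)
          ultimately show ?thesis using True by simp
        qed
      next
        case False
        moreover have "\<kappa> j = undefined" using that False PiE_arb by blast
        ultimately show ?thesis by auto
      qed
    qed
    show "compress C (\<lambda>j\<in>{1..m}. if j \<in> C then k (?inv j) else 0) = k"
      if "k \<in> {1..card C} \<rightarrow>\<^sub>E {1..}" for k
    proof
      fix i
      show "compress C (\<lambda>j\<in>{1..m}. if j \<in> C then k (?inv j) else 0) i = k i"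
      proof (cases "i \<in> {1..card C}")
        case True
        moreover have "nth_smallest C i \<in> {1..m}" using inC[OF True] assms by blast
        ultimately show ?thesis using inC[OF True] left[OF True] by (simp add: compress_def del: One_nat_def)
      next
        case False
        moreover have "k i = undefined" using that False PiE_arb by blast
        ultimately show ?thesis by (auto simp: compress_def)
      qed
    qed
  qed
qed

lemma grid_mono:
  fixes t :: "nat \<Rightarrow> real"
  assumes "\<And>i. i \<in> {1..m} \<Longrightarrow> t (i - 1) < t i" and "i \<le> j" and "j \<le> m"
  shows "t i \<le> t j"
  using assms(2,3)
proof (induction j)
  case (Suc j)
  then show ?case using assms(1)[of "Suc j"] by (cases "i = Suc j") auto
qed simp

text \<open>With \<open>s i = u i - u (i + 1)\<close> the partial sums \<open>s i + \<dots> + s m\<close> of the defining expansion become the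
free variables \<open>u i\<close>. The sums over the subsets \<open>C\<close> and over the positive exponents on \<open>C\<close> then merge into
one sum over all exponents, \<open>C\<close> being the set where the exponent does not vanish.\<close>

lemma increment_mgf:
  assumes P: "is_limit_process c \<alpha> lam b T M X"
    and m: "m \<ge> 1" and t: "t 0 = 0" "\<And>i. i \<in> {1..m} \<Longrightarrow> t (i - 1) < t i" "t m \<le> T"
  shows "integrable M (\<lambda>\<omega>. exp (\<Sum>i\<in>{1..m}. u i * (X (t i) \<omega> - X (t (i - 1)) \<omega>)))" (is ?int)
    and "((\<lambda>\<kappa>. (if exponent_support m \<kappa> = {} then 1
                  else rate_const c \<alpha> lam b T *
                    increment_coeff c \<alpha> lam t (exponent_support m \<kappa>) (compress (exponent_support m \<kappa>) \<kappa>)) *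
               (\<Prod>i\<in>{1..m}. u i ^ \<kappa> i)) has_sum
           (\<integral>\<omega>. exp (\<Sum>i\<in>{1..m}. u i * (X (t i) \<omega> - X (t (i - 1)) \<omega>)) \<partial>M)) ({1..m} \<rightarrow>\<^sub>E UNIV)"
      (is "(?f has_sum ?E) _")
proof -
  \<comment> \<open>Cutting \<open>u\<close> off after \<open>m\<close> gives
    \<open>s m = u m\<close>, so that the partial sums from \<open>i\<close> to \<open>m\<close>
    telescope to \<open>u i\<close>.\<close>
  define v where "v i = (if i \<le> m then u i else 0)" for i
  define s where "s i = v i - v (Suc i)" for i
  have S: "(\<Sum>j=i..m. s j) = u i" if "i \<in> {1..m}" for i
    using sum_natinterval_diff[of v i m] that by (auto simp: s_def v_def)
  have mono: "0 \<le> t i \<and> t i \<le> t m" if "i \<le> m" for i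
    using grid_mono[of m t, OF t(2), of 0 i] grid_mono[of m t, OF t(2), of i m] that t(1) by auto
  have [measurable]: "X (t i) \<in> borel_measurable M" if "i \<le> m" for i
    using P mono[OF that] t(3) unfolding is_limit_process_def by auto
  have X0: "AE \<omega> in M. X (t 0) \<omega> = 0"
    using P t(1) unfolding is_limit_process_def by auto
  have fdd: "m \<ge> 1 \<and> t 0 = 0 \<and> (\<forall>i \<in> {1..m}. t (i - 1) < t i) \<and> t m \<le> T"
    using m t by auto
  note fd = conjunct2[OF conjunct2[OF conjunct2[OF P[unfolded is_limit_process_def]]], rule_format, OF fdd, of s]
  note int = conjunct1[OF fd] and summable = conjunct1[OF conjunct2[OF fd], rule_format]
    and mgf = conjunct2[OF conjunct2[OF fd]]
  \<comment> \<open>Only almost everywhere: the increment over the first interval involves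
    \<open>X 0\<close>.\<close>
  have ae: "AE \<omega> in M. exp (\<Sum>i=1..m. s i * X (t i) \<omega>) =
      exp (\<Sum>i\<in>{1..m}. u i * (X (t i) \<omega> - X (t (i - 1)) \<omega>))"
    using X0
  proof eventually_elim
    case (elim \<omega>)
    have "(\<Sum>i=1..m. v i * (X (t i) \<omega> - X (t (i - 1)) \<omega>)) =
        (\<Sum>i=1..m. u i * (X (t i) \<omega> - X (t (i - 1)) \<omega>))"
      by (intro sum.cong) (auto simp: v_def)
    then show ?case
      using abel_sum[of v "\<lambda>i. X (t i) \<omega>" m] elim by (simp add: s_def v_def)
  qed
  have meas1: "(\<lambda>\<omega>. exp (\<Sum>i=1..m. s i * X (t i) \<omega>)) \<in> borel_measurable M"
    by (intro measurable_compose[OF _ borel_measurable_exp] borel_measurable_sum) auto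
  have meas2: "(\<lambda>\<omega>. exp (\<Sum>i\<in>{1..m}. u i * (X (t i) \<omega> - X (t (i - 1)) \<omega>))) \<in> borel_measurable M"
    by (intro measurable_compose[OF _ borel_measurable_exp] borel_measurable_sum borel_measurable_times
        borel_measurable_diff) auto
  show ?int
    using integrable_cong_AE[OF meas1 meas2 ae] int by blast
  have Eeq: "(\<integral>\<omega>. exp (\<Sum>i=1..m. s i * X (t i) \<omega>) \<partial>M) = ?E"
    using meas1 meas2 ae by (rule integral_cong_AE)
  define D where "D C = {\<kappa> \<in> {1..m} \<rightarrow>\<^sub>E UNIV. exponent_support m \<kappa> = C}" for C
  \<comment> \<open>The contribution of the exponent vectors with support \<open>C\<close>. The
    empty support belongs to the zero vector alone and yields the leading 1 of the
    expansion.\<close>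
  define val where "val C = (if C = {} then 1 else rate_const c \<alpha> lam b T *
     (\<Sum>\<^sub>\<infinity>k \<in> {1..card C} \<rightarrow>\<^sub>E {1..}. mgf_summand c \<alpha> lam m t s C k))" for C
  have piece: "(?f has_sum val C) (D C)" if C: "C \<subseteq> {1..m}" for C
  proof (cases "C = {}")
    case True
    have "D {} = {\<lambda>i\<in>{1..m}. 0}"
      unfolding D_def exponent_support_def by (auto simp: PiE_iff extensional_def restrict_def fun_eq_iff)
    then show ?thesis
      by (simp add: True val_def has_sum_finite_iff exponent_support_def)
  next
    case False
    have fin: "finite C" using C finite_subset by blast
    have bij: "bij_betw (nth_smallest C) {1..card C} C" by (rule bij_betw_nth_smallest[OF fin])
    have sm: "mgf_summand c \<alpha> lam m t s C summable_on ({1..card C} \<rightarrow>\<^sub>E {1..})"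
      using False C by (intro summable) simp
    then have "((\<lambda>k. rate_const c \<alpha> lam b T * mgf_summand c \<alpha> lam m t s C k) has_sum val C)
        ({1..card C} \<rightarrow>\<^sub>E {1..})"
      using False by (simp add: val_def has_sum_cmult_right)
    then have "((\<lambda>\<kappa>. rate_const c \<alpha> lam b T * mgf_summand c \<alpha> lam m t s C (compress C \<kappa>)) has_sum val C) (D C)"
      unfolding D_def by (subst has_sum_reindex_bij_betw[OF bij_betw_compress[OF C]])
    moreover have "rate_const c \<alpha> lam b T * mgf_summand c \<alpha> lam m t s C (compress C \<kappa>) = ?f \<kappa>"
      if "\<kappa> \<in> D C" for \<kappa>
    proof -
      have supp: "exponent_support m \<kappa> = C" using that by (simp add: D_def)
      have "(\<Prod>i=1..card C. (\<Sum>j=nth_smallest C i..m. s j) ^ compress C \<kappa> i) =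
          (\<Prod>i=1..card C. u (nth_smallest C i) ^ \<kappa> (nth_smallest C i))"
      proof (intro prod.cong refl)
        fix i assume i: "i \<in> {1..card C}"
        then have "nth_smallest C i \<in> {1..m}" using bij_betw_apply[OF bij i] C by blast
        with i show "(\<Sum>j=nth_smallest C i..m. s j) ^ compress C \<kappa> i =
            u (nth_smallest C i) ^ \<kappa> (nth_smallest C i)"
          using S by (simp add: compress_def)
      qed
      also have "\<dots> = (\<Prod>i\<in>C. u i ^ \<kappa> i)"
        using prod.reindex_bij_betw[OF bij, of "\<lambda>i. u i ^ \<kappa> i"] by simp
      also have "\<dots> = (\<Prod>i\<in>{1..m}. u i ^ \<kappa> i)"
        by (rule prod.mono_neutral_left) (use C supp in \<open>auto simp: exponent_support_def\<close>)
      finally show ?thesis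
        unfolding mgf_summand_def supp increment_coeff_def using False by simp
    qed
    ultimately show ?thesis by (simp cong: has_sum_cong)
  qed
  have "(?f has_sum (\<Sum>C\<in>Pow {1..m}. val C)) (\<Union>C\<in>Pow {1..m}. D C)"
  proof (rule sum_has_sum)
    show "(?f has_sum val C) (D C)" if "C \<in> Pow {1..m}" for C
      using piece that by blast
    show "D C \<inter> D C' = {}" if "C \<noteq> C'" for C C'
      using that unfolding D_def by blast
  qed simp
  moreover have "(\<Union>C\<in>Pow {1..m}. D C) = {1..m} \<rightarrow>\<^sub>E UNIV"
  proof -
    have "exponent_support m \<kappa> \<in> Pow {1..m}" for \<kappa> unfolding exponent_support_def by blast
    then show ?thesis unfolding D_def by blast
  qed
  moreover have "(\<Sum>C\<in>Pow {1..m}. val C) = ?E"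
  proof -
    have "{C. C \<noteq> {} \<and> C \<subseteq> {1..m}} = Pow {1..m} - {{}}" by auto
    then have "(\<Sum>C\<in>Pow {1..m}. val C) = val {} + (\<Sum>C\<in>{C. C \<noteq> {} \<and> C \<subseteq> {1..m}}. val C)"
      using sum.remove[of "Pow {1..m}" "{}" val] by simp
    also have "\<dots> = ?E"
      unfolding Eeq[symmetric] mgf by (simp add: val_def sum_distrib_left)
    finally show ?thesis .
  qed
  ultimately show "(?f has_sum ?E) ({1..m} \<rightarrow>\<^sub>E UNIV)" by simp
qed

lemma increment_moment:
  assumes P: "is_limit_process c \<alpha> lam b T M X"
    and m: "m \<ge> 1" and t: "t 0 = 0" "\<And>i. i \<in> {1..m} \<Longrightarrow> t (i - 1) < t i" "t m \<le> T"
    and f: "strict_mono_on {1..q} f" "f ` {1..q} \<subseteq> {1..m}" and q: "q \<ge> 1"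
    and k: "\<And>i. i \<in> {1..q} \<Longrightarrow> k i \<ge> 1"
  shows "integrable M (\<lambda>\<omega>. \<Prod>i=1..q. (X (t (f i)) \<omega> - X (t (f i - 1)) \<omega>) ^ k i)"
    and "(\<integral>\<omega>. (\<Prod>i=1..q. (X (t (f i)) \<omega> - X (t (f i - 1)) \<omega>) ^ k i) \<partial>M) =
      (\<Prod>i=1..q. fact (k i)) * (rate_const c \<alpha> lam b T *
        (t (f q) powr (\<alpha> * (real (\<Sum>i=1..q. k i) - 1) + 1) * mgf_coeff c \<alpha> lam t (f ` {1..q}) k))"
proof -
  define C where "C = f ` {1..q}"
  have inj: "inj_on f {1..q}" using f(1) by (rule strict_mono_on_imp_inj_on)
  have C: "C \<noteq> {}" "finite C" "card C = q" using q inj by (auto simp: C_def card_image)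
  \<comment> \<open>Increments not selected by \<open>f\<close> get exponent 0: they drop out of the
    moment, although their intervals belong to the grid.\<close>
  define \<kappa> where "\<kappa> = (\<lambda>j\<in>{1..m}. if j \<in> C then k (inv_into {1..q} f j) else 0)"
  have \<kappa>f: "\<kappa> (f i) = k i" if "i \<in> {1..q}" for i
  proof -
    have "f i \<in> {1..m}" using f(2) that by blast
    then show ?thesis using that inj by (simp add: \<kappa>_def C_def)
  qed
  have supp: "exponent_support m \<kappa> = C"
  proof -
    have pos: "\<kappa> j \<noteq> 0" if "j \<in> C" for j
      using that k \<kappa>f unfolding C_def by fastforce
    have "j \<in> C" if "j \<in> {1..m}" "\<kappa> j \<noteq> 0" for j
      using that by (simp add: \<kappa>_def split: if_splits)
    moreover have "C \<subseteq> {1..m}" using f(2) by (simp add: C_def)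
    ultimately show ?thesis using pos unfolding exponent_support_def by (intro set_eqI iffI CollectI conjI) auto
  qed
  have comp: "compress C \<kappa> = restrict k {1..card C}"
    unfolding compress_def C(3) using nth_smallest_image[OF f(1)] \<kappa>f
    by (intro restrict_ext) (simp add: C_def)
  have reindex: "(\<Prod>j\<in>{1..m}. h j ^ \<kappa> j) = (\<Prod>i=1..q. h (f i) ^ k i)" for h :: "nat \<Rightarrow> real"
  proof -
    have "(\<Prod>j\<in>{1..m}. h j ^ \<kappa> j) = (\<Prod>j\<in>C. h j ^ \<kappa> j)"
      by (rule prod.mono_neutral_right) (use f(2) in \<open>auto simp: C_def \<kappa>_def\<close>)
    also have "\<dots> = (\<Prod>i=1..q. h (f i) ^ k i)"
      unfolding C_def using inj \<kappa>f by (subst prod.reindex) auto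
    finally show ?thesis .
  qed
  have facts: "(\<Prod>j\<in>{1..m}. fact (\<kappa> j) :: real) = (\<Prod>i=1..q. fact (k i))"
  proof -
    have "(\<Prod>j\<in>{1..m}. fact (\<kappa> j) :: real) = (\<Prod>j\<in>C. fact (\<kappa> j))"
      by (rule prod.mono_neutral_right) (use f(2) in \<open>auto simp: C_def \<kappa>_def\<close>)
    also have "\<dots> = (\<Prod>i=1..q. fact (k i))"
      unfolding C_def using inj \<kappa>f by (subst prod.reindex) auto
    finally show ?thesis .
  qed
  have tm: "0 \<le> t i \<and> t i \<le> T" if "i \<le> m" for i
    using grid_mono[of m t, OF t(2), of 0 i] grid_mono[of m t, OF t(2), of i m] that t(1,3) by auto
  have meas: "X (t i) \<in> borel_measurable M" if "i \<le> m" for i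
    using P tm[OF that] unfolding is_limit_process_def by auto
  define W :: "'a \<Rightarrow> real" where "W = (\<lambda>_. 1)"
  note mom = mixed_moments_from_mgf[where W = W and I = "{1..m}" and \<kappa> = \<kappa> and M = M
      and Y = "\<lambda>i \<omega>. X (t i) \<omega> - X (t (i - 1)) \<omega>" and
      a = "\<lambda>\<kappa>. if exponent_support m \<kappa> = {} then 1 else rate_const c \<alpha> lam b T *
                    increment_coeff c \<alpha> lam t (exponent_support m \<kappa>) (compress (exponent_support m \<kappa>) \<kappa>)"]
  have "integrable M (\<lambda>\<omega>. W \<omega> * (\<Prod>i\<in>{1..m}. (X (t i) \<omega> - X (t (i - 1)) \<omega>) ^ \<kappa> i))"
    by (rule mom) (use increment_mgf[OF P m t] in \<open>auto intro!: meas borel_measurable_diff simp: W_def \<kappa>_def\<close>)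
  then show "integrable M (\<lambda>\<omega>. \<Prod>i=1..q. (X (t (f i)) \<omega> - X (t (f i - 1)) \<omega>) ^ k i)"
    unfolding reindex by (simp add: W_def)
  have "(\<integral>\<omega>. W \<omega> * (\<Prod>i\<in>{1..m}. (X (t i) \<omega> - X (t (i - 1)) \<omega>) ^ \<kappa> i) \<partial>M) =
      (\<Prod>i\<in>{1..m}. fact (\<kappa> i)) * (rate_const c \<alpha> lam b T * increment_coeff c \<alpha> lam t C (compress C \<kappa>))"
    by (subst mom) (use increment_mgf[OF P m t] C in \<open>auto intro!: meas borel_measurable_diff simp: W_def \<kappa>_def[symmetric] supp, auto simp: \<kappa>_def\<close>)
  moreover have "increment_coeff c \<alpha> lam t C (compress C \<kappa>) =
      t (f q) powr (\<alpha> * (real (\<Sum>i=1..q. k i) - 1) + 1) * mgf_coeff c \<alpha> lam t C k"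
  proof -
    have "nth_smallest C (card C) = f q" unfolding C(3) unfolding C_def by (rule nth_smallest_image[OF f(1)]) (use q in simp)
    moreover have "(\<Sum>i=1..card C. restrict k {1..card C} i) = (\<Sum>i=1..q. k i)"
      unfolding C(3) by (intro sum.cong) auto
    ultimately show ?thesis
      unfolding increment_coeff_def comp mgf_coeff_restrict[OF C(1,2)] by simp
  qed
  ultimately show "(\<integral>\<omega>. (\<Prod>i=1..q. (X (t (f i)) \<omega> - X (t (f i - 1)) \<omega>) ^ k i) \<partial>M) =
      (\<Prod>i=1..q. fact (k i)) * (rate_const c \<alpha> lam b T *
        (t (f q) powr (\<alpha> * (real (\<Sum>i=1..q. k i) - 1) + 1) * mgf_coeff c \<alpha> lam t (f ` {1..q}) k))"
    unfolding reindex facts by (simp add: W_def C_def)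
qed

subsection \<open>The coefficient integrals\<close>

text \<open>The function \<open>w\<close> of \<open>mgf_coeff\<close>. For \<open>n \<ge> 2\<close>
  it is the (n-1)-fold convolution power of the kernel c u^(\<alpha>-1) on the positive
  half-line.\<close>

definition cell_weight :: "real \<Rightarrow> real \<Rightarrow> nat \<Rightarrow> real \<Rightarrow> real" where
  "cell_weight c \<alpha> n u =
     (c * Gamma \<alpha>) ^ (n - 1) * u powr (\<alpha> * real (n - 1) - 1) / Gamma (real (n - 1) * \<alpha>)"

text \<open>The indicator of the constraints on the \<open>i\<close>-th block \<open>(x'\<^sub>i, x\<^sub>i) = (a, b)\<close> of the region, with the factor of the
integrand that depends on this block only; for exponent 1 there is no \<open>x'\<^sub>i\<close> and \<open>a\<close> is ignored. The coupling
between different blocks is collected in \<open>link\<close>: the two exponential factors of the integrand combine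
to \<open>exp (- lam * \<tau> * (x\<^sub>q - x'\<^sub>1))\<close>, with \<open>x\<^sub>1\<close> in place of \<open>x'\<^sub>1\<close> if the first exponent is 1.\<close>

definition cell :: "real \<Rightarrow> real \<Rightarrow> nat \<Rightarrow> real \<Rightarrow> real \<Rightarrow> real \<Rightarrow> real \<Rightarrow> real" where
  "cell c \<alpha> n L R a b =
     (if n \<ge> 2 then of_bool (L < a \<and> a < b \<and> b < R) * cell_weight c \<alpha> n (b - a)
      else of_bool (L < b \<and> b < R))"

text \<open>Turns the two kinds of coupling factors in \<open>mgf_coeff\<close>, which measure the
  gap up to x'_i or up to x_i, into one formula: a block of exponent 1 is a single point and is its
  own start.\<close>

definition block_start :: "(nat \<Rightarrow> nat) \<Rightarrow> (nat \<Rightarrow> real) \<times> (nat \<Rightarrow> real) \<Rightarrow> nat \<Rightarrow> real" where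
  "block_start k p i = (if k i \<ge> 2 then fst p i else snd p i)"

definition link ::
  "real \<Rightarrow> real \<Rightarrow> real \<Rightarrow> real \<Rightarrow> nat \<Rightarrow> (nat \<Rightarrow> nat) \<Rightarrow> (nat \<Rightarrow> real) \<times> (nat \<Rightarrow> real) \<Rightarrow> real" where
  "link c \<alpha> lam \<tau> q k p =
     exp (- lam * \<tau> * (snd p q - block_start k p 1)) *
     (\<Prod>i=2..q. c * (block_start k p i - snd p (i - 1)) powr (\<alpha> - 1))"

abbreviation block_space :: "nat \<Rightarrow> (nat \<Rightarrow> nat) \<Rightarrow> ((nat \<Rightarrow> real) \<times> (nat \<Rightarrow> real)) measure" where
  "block_space q k \<equiv> PiM {i \<in> {1..q}. k i \<ge> 2} (\<lambda>_. lborel) \<Otimes>\<^sub>M PiM {1..q} (\<lambda>_. lborel)"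

interpretation lborel_product: product_sigma_finite "\<lambda>_::nat. lborel :: real measure"
  by standard

text \<open>For \<open>n \<le> 1\<close> the weight is 0, since \<open>Gamma 0 = 0\<close> and
  division by 0 gives 0.\<close>

lemma cell_weight_nonneg:
  assumes "c > 0" "\<alpha> > 0"
  shows "cell_weight c \<alpha> n u \<ge> 0"
proof (cases "n - 1 = 0")
  case False
  then have "Gamma (real (n - 1) * \<alpha>) > 0" using assms by (intro Gamma_real_pos) auto
  then show ?thesis using assms Gamma_real_pos[of \<alpha>] by (simp add: cell_weight_def)
qed (simp add: cell_weight_def)

lemma cell_nonneg: "c > 0 \<Longrightarrow> \<alpha> > 0 \<Longrightarrow> cell c \<alpha> n L R a b \<ge> 0"
  by (simp add: cell_def cell_weight_nonneg)

lemma link_nonneg: "c > 0 \<Longrightarrow> link c \<alpha> lam \<tau> q k p \<ge> 0"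
  by (simp add: link_def prod_nonneg)

lemma cell_measurable [measurable]:
  "(\<lambda>p. cell c \<alpha> n L R (fst p) (snd p)) \<in> borel_measurable (borel \<Otimes>\<^sub>M borel)"
  unfolding cell_def cell_weight_def by measurable

lemma coordinate_measurable:
  assumes "i \<in> {1..q}"
  shows "(\<lambda>p. snd p i) \<in> borel_measurable (block_space q k)"
    and "k i \<ge> 2 \<Longrightarrow> (\<lambda>p. fst p i) \<in> borel_measurable (block_space q k)"
    and "(\<lambda>p. block_start k p i) \<in> borel_measurable (block_space q k)"
proof -
  have "(\<lambda>p. snd p i) \<in> block_space q k \<rightarrow>\<^sub>M (lborel :: real measure)"
    using assms by (intro measurable_compose[OF measurable_snd measurable_component_singleton]) auto
  then show 1: "(\<lambda>p. snd p i) \<in> borel_measurable (block_space q k)" by simp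
  have "(\<lambda>p. fst p i) \<in> block_space q k \<rightarrow>\<^sub>M (lborel :: real measure)" if "k i \<ge> 2"
    using assms that by (intro measurable_compose[OF measurable_fst measurable_component_singleton]) auto
  then show 2: "(\<lambda>p. fst p i) \<in> borel_measurable (block_space q k)" if "k i \<ge> 2" using that by simp
  show "(\<lambda>p. block_start k p i) \<in> borel_measurable (block_space q k)"
    using 1 2 by (cases "k i \<ge> 2") (simp_all add: block_start_def)
qed

lemma cell_coordinate_measurable:
  assumes "i \<in> {1..q}"
  shows "(\<lambda>p. cell c \<alpha> (k i) L R (fst p i) (snd p i)) \<in> borel_measurable (block_space q k)"
proof (cases "k i \<ge> 2")
  case True
  then show ?thesis
    using measurable_compose[OF measurable_Pair[OF coordinate_measurable(2,1)[OF assms]] cell_measurable]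
    by simp
next
  case False
  \<comment> \<open>For exponent 1 the index \<open>i\<close> is not among the coordinates of the
    first factor. As \<open>cell\<close> ignores this argument, \<open>snd p i\<close> can stand in
    for it.\<close>
  have "(\<lambda>p. cell c \<alpha> (k i) L R (snd p i) (snd p i)) \<in> borel_measurable (block_space q k)"
    using measurable_compose[OF measurable_Pair[OF coordinate_measurable(1,1)[OF assms]] cell_measurable]
    by simp
  then show ?thesis using False by (simp add: cell_def)
qed

lemma link_measurable:
  assumes "q \<ge> 1"
  shows "link c \<alpha> lam \<tau> q k \<in> borel_measurable (block_space q k)"
proof -
  have [measurable]: "(\<lambda>p. snd p q) \<in> borel_measurable (block_space q k)"
      "(\<lambda>p. block_start k p 1) \<in> borel_measurable (block_space q k)"
    by (rule coordinate_measurable; use assms in simp)+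
  have factor: "(\<lambda>p. c * (block_start k p i - snd p (i - 1)) powr (\<alpha> - 1)) \<in> borel_measurable (block_space q k)"
    if "i \<in> {2..q}" for i
  proof -
    have [measurable]: "(\<lambda>p. snd p (i - 1)) \<in> borel_measurable (block_space q k)"
        "(\<lambda>p. block_start k p i) \<in> borel_measurable (block_space q k)"
      by (rule coordinate_measurable; use that in auto)+
    show ?thesis by measurable
  qed
  have "(\<lambda>p. \<Prod>i=2..q. c * (block_start k p i - snd p (i - 1)) powr (\<alpha> - 1)) \<in> borel_measurable (block_space q k)"
    by (intro borel_measurable_prod factor)
  moreover have "(\<lambda>p. exp (- lam * \<tau> * (snd p q - block_start k p 1))) \<in> borel_measurable (block_space q k)"
    by measurable
  ultimately show ?thesis unfolding link_def by (intro borel_measurable_times)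
qed

lemma prod_of_bool: "finite I \<Longrightarrow> (\<Prod>i\<in>I. of_bool (P i) :: real) = of_bool (\<forall>i\<in>I. P i)"
  by (induction I rule: finite_induct) auto

text \<open>The integrand is regrouped by blocks, so that all coupling sits in \<open>link\<close>.
  For a nonnegative measurable function the Lebesgue integral is \<open>enn2real\<close> of the
  nonnegative integral even without integrability: if the latter is infinite, both are 0.\<close>

lemma mgf_coeff_eq_nn_integral:
  assumes "c > 0" "\<alpha> > 0" and f: "strict_mono_on {1..q} f" and q: "q \<ge> 1"
    and k: "\<And>i. i \<in> {1..q} \<Longrightarrow> k i \<ge> 1"
  shows "mgf_coeff c \<alpha> lam t (f ` {1..q}) k =
    enn2real (\<integral>\<^sup>+p. ennreal ((\<Prod>i=1..q. cell c \<alpha> (k i) (t (f i - 1) / t (f q)) (t (f i) / t (f q)) (fst p i) (snd p i)) *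
      link c \<alpha> lam (t (f q)) q k p) \<partial>block_space q k)"
proof -
  define C where "C = f ` {1..q}"
  define \<tau> where "\<tau> = t (f q)"
  have card: "card C = q" using strict_mono_on_imp_inj_on[OF f] by (auto simp: C_def card_image)
  have nth: "nth_smallest C i = f i" if "i \<in> {1..q}" for i
    using nth_smallest_image[OF f that] by (simp add: C_def)
  have many: "block_many C k = {i \<in> {1..q}. k i \<ge> 2}" and one: "block_one C k = {i \<in> {1..q}. k i = 1}"
    by (auto simp: block_many_def block_one_def card)
  let ?in = "\<lambda>p i. if k i \<ge> 2 then t (f i - 1) / \<tau> < fst p i \<and> fst p i < snd p i \<and> snd p i < t (f i) / \<tau>
     else t (f i - 1) / \<tau> < snd p i \<and> snd p i < t (f i) / \<tau>"
  have region: "indicator (mgf_region t C k) p = (\<Prod>i=1..q. of_bool (?in p i) :: real)" for p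
  proof -
    have "p \<in> mgf_region t C k \<longleftrightarrow> (\<forall>i\<in>{1..q}. ?in p i)"
      using k q by (force simp: mgf_region_def Let_def many one nth card \<tau>_def split: prod.splits if_splits)
    then show ?thesis by (simp add: prod_of_bool indicator_def)
  qed
  have integrand: "(if k 1 > 1 then cell_weight c \<alpha> (k 1) (x 1 - x' 1) * exp (- lam * \<tau> * (x 1 - x' 1)) else 1) *
      (\<Prod>i \<in> {i \<in> block_many C k. i \<ge> 2}. c * (x' i - x (i - 1)) powr (\<alpha> - 1) * cell_weight c \<alpha> (k i) (x i - x' i)) *
      (\<Prod>j \<in> {j \<in> block_one C k. j \<ge> 2}. c * (x j - x (j - 1)) powr (\<alpha> - 1)) *
      exp (- lam * \<tau> * (x q - x 1)) =
      (\<Prod>i=1..q. if k i \<ge> 2 then cell_weight c \<alpha> (k i) (x i - x' i) else 1) * link c \<alpha> lam \<tau> q k (x', x)" for x x'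
  proof -
    let ?w = "\<lambda>i. if k i \<ge> 2 then cell_weight c \<alpha> (k i) (x i - x' i) else 1"
    let ?g = "\<lambda>i. c * (block_start k (x', x) i - x (i - 1)) powr (\<alpha> - 1)"
    \<comment> \<open>All exponents are at least 1, so the two products together meet every index of
      \<open>{2..q}\<close>.\<close>
    have split: "{2..q} = {i \<in> block_many C k. i \<ge> 2} \<union> {j \<in> block_one C k. j \<ge> 2}"
    proof (rule set_eqI)
      show "i \<in> {2..q} \<longleftrightarrow> i \<in> {i \<in> block_many C k. i \<ge> 2} \<union> {j \<in> block_one C k. j \<ge> 2}" for i
        unfolding many one using k[of i] by auto
    qed
    have "(\<Prod>i=2..q. ?g i * ?w i) =
        (\<Prod>i \<in> {i \<in> block_many C k. i \<ge> 2}. ?g i * ?w i) * (\<Prod>j \<in> {j \<in> block_one C k. j \<ge> 2}. ?g j * ?w j)"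
      unfolding split by (rule prod.union_disjoint) (auto simp: many one)
    also have "(\<Prod>i \<in> {i \<in> block_many C k. i \<ge> 2}. ?g i * ?w i) =
        (\<Prod>i \<in> {i \<in> block_many C k. i \<ge> 2}. c * (x' i - x (i - 1)) powr (\<alpha> - 1) * cell_weight c \<alpha> (k i) (x i - x' i))"
      by (rule prod.cong) (auto simp: many block_start_def)
    also have "(\<Prod>j \<in> {j \<in> block_one C k. j \<ge> 2}. ?g j * ?w j) =
        (\<Prod>j \<in> {j \<in> block_one C k. j \<ge> 2}. c * (x j - x (j - 1)) powr (\<alpha> - 1))"
      by (rule prod.cong) (auto simp: one block_start_def)
    finally have rest: "(\<Prod>i \<in> {i \<in> block_many C k. i \<ge> 2}. c * (x' i - x (i - 1)) powr (\<alpha> - 1) * cell_weight c \<alpha> (k i) (x i - x' i)) *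
        (\<Prod>j \<in> {j \<in> block_one C k. j \<ge> 2}. c * (x j - x (j - 1)) powr (\<alpha> - 1)) =
        (\<Prod>i=2..q. ?g i) * (\<Prod>i=2..q. ?w i)" by (simp add: prod.distrib)
    have first: "(if k 1 > 1 then cell_weight c \<alpha> (k 1) (x 1 - x' 1) * exp (- lam * \<tau> * (x 1 - x' 1)) else 1) *
        exp (- lam * \<tau> * (x q - x 1)) = ?w 1 * exp (- lam * \<tau> * (x q - block_start k (x', x) 1))"
      by (auto simp: block_start_def algebra_simps simp flip: exp_add)
    have "{1..q} = insert 1 {2..q}" using q by auto
    then have all: "(\<Prod>i=1..q. ?w i) = ?w 1 * (\<Prod>i=2..q. ?w i)" by simp
    have arrange: "A * B * D * E = (A * E) * (B * D)" for A B D E :: real by simp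
    show ?thesis
      unfolding arrange rest first all link_def by (simp add: mult_ac)
  qed
  have total: "indicator (mgf_region t C k) p *\<^sub>R (let x' = fst p; x = snd p in
            (if k 1 > 1 then cell_weight c \<alpha> (k 1) (x 1 - x' 1) * exp (- lam * \<tau> * (x 1 - x' 1)) else 1) *
            (\<Prod>i \<in> {i \<in> block_many C k. i \<ge> 2}.
                c * (x' i - x (i - 1)) powr (\<alpha> - 1) * cell_weight c \<alpha> (k i) (x i - x' i)) *
            (\<Prod>j \<in> {j \<in> block_one C k. j \<ge> 2}. c * (x j - x (j - 1)) powr (\<alpha> - 1)) *
            exp (- lam * \<tau> * (x q - x 1))) =
      (\<Prod>i=1..q. cell c \<alpha> (k i) (t (f i - 1) / \<tau>) (t (f i) / \<tau>) (fst p i) (snd p i)) * link c \<alpha> lam \<tau> q k p" for p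
    unfolding Let_def integrand region prod.collapse real_scaleR_def mult.assoc[symmetric] prod.distrib[symmetric]
    by (intro arg_cong2[where f = "(*)"] prod.cong refl) (simp add: cell_def)
  have "mgf_coeff c \<alpha> lam t C k = (\<integral>p. (\<Prod>i=1..q. cell c \<alpha> (k i) (t (f i - 1) / \<tau>) (t (f i) / \<tau>) (fst p i) (snd p i)) *
      link c \<alpha> lam \<tau> q k p \<partial>block_space q k)"
  proof -
    have "t (nth_smallest C (card C)) = \<tau>" using nth q by (simp add: card \<tau>_def)
    then show ?thesis
      unfolding total[symmetric] mgf_coeff_def set_lebesgue_integral_def card many[symmetric] Let_def
        cell_weight_def[symmetric]
      by (simp only: card)
  qed
  also have "\<dots> = enn2real (\<integral>\<^sup>+p. ennreal ((\<Prod>i=1..q. cell c \<alpha> (k i) (t (f i - 1) / \<tau>) (t (f i) / \<tau>) (fst p i) (snd p i)) *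
      link c \<alpha> lam \<tau> q k p) \<partial>block_space q k)"
    by (intro integral_eq_nn_integral borel_measurable_times borel_measurable_prod link_measurable
        cell_coordinate_measurable AE_I2 mult_nonneg_nonneg prod_nonneg cell_nonneg link_nonneg assms)
  finally show ?thesis unfolding C_def \<tau>_def .
qed

text \<open>Without coupling the integral factorizes by Tonelli: over the x-coordinates for fixed
  x', then over x'. A block of exponent 1 has no x'-coordinate; by \<open>indep\<close> the value 0
  may be inserted for it, and its factor is then constant in the outer integral.\<close>

lemma block_nn_integral:
  fixes \<phi> :: "nat \<Rightarrow> real \<Rightarrow> real \<Rightarrow> real"
  assumes meas: "\<And>i. (\<lambda>p. \<phi> i (fst p) (snd p)) \<in> borel_measurable (borel \<Otimes>\<^sub>M borel)"
    and nonneg: "\<And>i a b. \<phi> i a b \<ge> 0"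
    and indep: "\<And>i a a' b. i \<in> {1..q} \<Longrightarrow> k i < 2 \<Longrightarrow> \<phi> i a b = \<phi> i a' b"
  shows "(\<integral>\<^sup>+p. ennreal (\<Prod>i=1..q. \<phi> i (fst p i) (snd p i)) \<partial>block_space q k) =
    (\<Prod>i=1..q. if k i \<ge> 2 then \<integral>\<^sup>+a. \<integral>\<^sup>+b. \<phi> i a b \<partial>lborel \<partial>lborel else \<integral>\<^sup>+b. \<phi> i 0 b \<partial>lborel)"
proof -
  note [measurable] = meas
  have [measurable]: "\<phi> i a \<in> borel_measurable borel" for i a
  proof -
    have "(\<lambda>b. \<phi> i (fst (a, b)) (snd (a, b))) \<in> borel_measurable borel"
      by (rule measurable_compose[OF _ meas]) simp
    then show ?thesis by simp
  qed
  interpret X: sigma_finite_measure "PiM {1..q} (\<lambda>_::nat. lborel :: real measure)"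
    by (rule lborel_product.sigma_finite) simp
  define J where "J = {i \<in> {1..q}. k i \<ge> 2}"
  have J: "finite J" "J \<subseteq> {1..q}" by (auto simp: J_def)
  define h where "h i a = (if k i \<ge> 2 then \<integral>\<^sup>+b. \<phi> i a b \<partial>lborel else \<integral>\<^sup>+b. \<phi> i 0 b \<partial>lborel)" for i a
  have coord: "(\<lambda>p. \<phi> i (fst p i) (snd p i)) \<in> borel_measurable (block_space q k)" if i: "i \<in> {1..q}" for i
  proof (cases "k i \<ge> 2")
    case True
    then show ?thesis
      using measurable_compose[OF measurable_Pair[OF coordinate_measurable(2,1)[OF i]] meas] by simp
  next
    case False
    then have "\<phi> i (fst p i) (snd p i) = \<phi> i 0 (snd p i)" for p :: "(nat \<Rightarrow> real) \<times> (nat \<Rightarrow> real)"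
      using indep[OF i] by simp
    then show ?thesis using measurable_compose[OF coordinate_measurable(1)[OF i], of "\<phi> i 0"] by simp
  qed
  have "(\<integral>\<^sup>+p. ennreal (\<Prod>i=1..q. \<phi> i (fst p i) (snd p i)) \<partial>block_space q k) =
      (\<integral>\<^sup>+x'. \<integral>\<^sup>+x. ennreal (\<Prod>i=1..q. \<phi> i (x' i) (x i)) \<partial>PiM {1..q} (\<lambda>_. lborel) \<partial>PiM J (\<lambda>_. lborel))"
    unfolding J_def
    by (subst X.nn_integral_fst[symmetric])
       (intro measurable_compose[OF _ measurable_ennreal] borel_measurable_prod coord refl | simp)+
  also have "\<dots> = (\<integral>\<^sup>+x'. (\<Prod>i=1..q. h i (x' i)) \<partial>PiM J (\<lambda>_. lborel))"
  proof (intro nn_integral_cong)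
    fix x' :: "nat \<Rightarrow> real"
    have "(\<integral>\<^sup>+x. ennreal (\<Prod>i=1..q. \<phi> i (x' i) (x i)) \<partial>PiM {1..q} (\<lambda>_. lborel)) =
        (\<integral>\<^sup>+x. (\<Prod>i=1..q. ennreal (\<phi> i (x' i) (x i))) \<partial>PiM {1..q} (\<lambda>_. lborel))"
      by (simp add: prod_ennreal nonneg)
    also have "\<dots> = (\<Prod>i=1..q. \<integral>\<^sup>+b. ennreal (\<phi> i (x' i) b) \<partial>lborel)"
      by (rule lborel_product.product_nn_integral_prod) auto
    also have "\<dots> = (\<Prod>i=1..q. h i (x' i))"
    proof (intro prod.cong refl)
      fix i assume i: "i \<in> {1..q}"
      then have "\<phi> i (x' i) b = \<phi> i 0 b" if "k i < 2" for b using indep that by blast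
      then show "(\<integral>\<^sup>+b. ennreal (\<phi> i (x' i) b) \<partial>lborel) = h i (x' i)"
        by (cases "k i \<ge> 2") (simp_all add: h_def)
    qed
    finally show "(\<integral>\<^sup>+x. ennreal (\<Prod>i=1..q. \<phi> i (x' i) (x i)) \<partial>PiM {1..q} (\<lambda>_. lborel)) = (\<Prod>i=1..q. h i (x' i))" .
  qed
  also have "\<dots> = (\<integral>\<^sup>+x'. (\<Prod>i\<in>J. h i (x' i)) * (\<Prod>i\<in>{1..q} - J. h i 0) \<partial>PiM J (\<lambda>_. lborel))"
  proof (intro nn_integral_cong)
    fix x' :: "nat \<Rightarrow> real"
    have "(\<Prod>i=1..q. h i (x' i)) = (\<Prod>i\<in>{1..q} - J. h i (x' i)) * (\<Prod>i\<in>J. h i (x' i))"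
      using J by (intro prod.subset_diff) auto
    also have "(\<Prod>i\<in>{1..q} - J. h i (x' i)) = (\<Prod>i\<in>{1..q} - J. h i 0)"
      by (intro prod.cong) (auto simp: h_def J_def)
    finally show "(\<Prod>i=1..q. h i (x' i)) = (\<Prod>i\<in>J. h i (x' i)) * (\<Prod>i\<in>{1..q} - J. h i 0)"
      by (simp add: mult.commute)
  qed
  also have "\<dots> = (\<integral>\<^sup>+x'. (\<Prod>i\<in>J. h i (x' i)) \<partial>PiM J (\<lambda>_. lborel)) * (\<Prod>i\<in>{1..q} - J. h i 0)"
  proof (rule nn_integral_multc)
    have h: "h i \<in> borel_measurable lborel" for i
      unfolding h_def by (cases "k i \<ge> 2") simp_all
    show "(\<lambda>x'. \<Prod>i\<in>J. h i (x' i)) \<in> borel_measurable (PiM J (\<lambda>_. lborel))"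
    proof (rule borel_measurable_prod_ennreal)
      fix i assume "i \<in> J"
      show "(\<lambda>x'. h i (x' i)) \<in> borel_measurable (PiM J (\<lambda>_. lborel))"
        by (rule measurable_compose[OF measurable_component_singleton[OF \<open>i \<in> J\<close>] h])
    qed
  qed
  also have "(\<integral>\<^sup>+x'. (\<Prod>i\<in>J. h i (x' i)) \<partial>PiM J (\<lambda>_. lborel)) = (\<Prod>i\<in>J. \<integral>\<^sup>+a. h i a \<partial>lborel)"
  proof (rule lborel_product.product_nn_integral_prod)
    show "h i \<in> borel_measurable lborel" for i
      unfolding h_def by (cases "k i \<ge> 2") simp_all
  qed (rule J)
  also have "\<dots> * (\<Prod>i\<in>{1..q} - J. h i 0) =
      (\<Prod>i=1..q. if k i \<ge> 2 then \<integral>\<^sup>+a. \<integral>\<^sup>+b. \<phi> i a b \<partial>lborel \<partial>lborel else \<integral>\<^sup>+b. \<phi> i 0 b \<partial>lborel)" (is "_ = prod ?R _")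
  proof -
    have "prod ?R {1..q} = prod ?R ({1..q} - J) * prod ?R J"
      using J by (intro prod.subset_diff) auto
    moreover have "prod ?R ({1..q} - J) = (\<Prod>i\<in>{1..q} - J. h i 0)"
      by (intro prod.cong) (auto simp: h_def J_def)
    moreover have "prod ?R J = (\<Prod>i\<in>J. \<integral>\<^sup>+a. h i a \<partial>lborel)"
      by (intro prod.cong) (auto simp: h_def J_def)
    ultimately show ?thesis by (simp add: mult.commute)
  qed
  finally show ?thesis .
qed

section \<open>Cell volumes and two-sided bounds for the coefficient integrals\<close>

lemma nn_integral_powr_from_0:
  fixes a R :: real
  assumes "a > - 1" "R \<ge> 0"
  shows "(\<integral>\<^sup>+y. ennreal (of_bool (0 < y \<and> y < R) * y powr a) \<partial>lborel) = ennreal (R powr (a + 1) / (a + 1))"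
proof -
  have "(\<integral>\<^sup>+y. ennreal (of_bool (0 < y \<and> y < R) * y powr a) \<partial>lborel) =
      (\<integral>\<^sup>+y. ennreal (y powr a) * indicator {0..R} y \<partial>lborel)"
  proof (rule nn_integral_cong_AE)
    show "AE y in lborel. ennreal (of_bool (0 < y \<and> y < R) * y powr a) = ennreal (y powr a) * indicator {0..R} y"
      using AE_lborel_singleton[of R] AE_lborel_singleton[of 0]
      by eventually_elim (auto simp: indicator_def)
  qed
  also have "\<dots> = ennreal (R powr (a + 1) / (a + 1))"
    using has_integral_powr_from_0[OF assms] by (intro nn_integral_has_integral_lebesgue') auto
  finally show ?thesis .
qed

text \<open>The integral of a cell of length 1. As Gamma p * p * (p + 1) equals Gamma (p + 2), it is
  \<nu>^(n-1) / Gamma(\<alpha>(n-1) + 2) with \<nu> = c Gamma(\<alpha>). This is 1 also at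
  \<open>n = 1\<close>, but there the written denominator is 0, hence the separate case.\<close>

definition cell_const :: "real \<Rightarrow> real \<Rightarrow> nat \<Rightarrow> real" where
  "cell_const c \<alpha> n = (let p = \<alpha> * real (n - 1) in
     if n \<ge> 2 then (c * Gamma \<alpha>) ^ (n - 1) / (Gamma p * p * (p + 1)) else 1)"

lemma cell_const_pos:
  assumes "c > 0" "\<alpha> > 0"
  shows "cell_const c \<alpha> n > 0"
proof (cases "n \<ge> 2")
  case True
  define p where "p = \<alpha> * real (n - 1)"
  have "p > 0" using assms True by (simp add: p_def)
  then show ?thesis
    using True assms Gamma_real_pos[of \<alpha>] Gamma_real_pos[of p] add_pos_pos[of p 1]
    unfolding cell_const_def Let_def p_def[symmetric] by simp
qed (simp add: cell_const_def)

lemma cell_measurable_snd [measurable]: "cell c \<alpha> n L R a \<in> borel_measurable borel"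
proof -
  have "(\<lambda>b. cell c \<alpha> n L R (fst (a, b)) (snd (a, b))) \<in> borel_measurable borel"
    by (rule measurable_compose[OF _ cell_measurable]) simp
  then show ?thesis by simp
qed

text \<open>With u = b - a, the inner integral of u^(p-1) is (R - a)^p / p; the reflection y = R - a
  reduces the outer integral to a pure power again, which adds the factor 1/(p+1).\<close>

lemma nn_integral_cell_many:
  assumes "c > 0" "\<alpha> > 0" "L \<le> R" "n \<ge> 2"
  shows "(\<integral>\<^sup>+a. \<integral>\<^sup>+b. cell c \<alpha> n L R a b \<partial>lborel \<partial>lborel) =
    ennreal (cell_const c \<alpha> n * (R - L) powr (\<alpha> * real (n - 1) + 1))"
proof -
  define p where "p = \<alpha> * real (n - 1)"
  have p: "p > 0" using assms by (simp add: p_def)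
  define K where "K = (c * Gamma \<alpha>) ^ (n - 1) / Gamma p"
  have K: "K \<ge> 0" using assms p Gamma_real_pos[of \<alpha>] Gamma_real_pos[of p] by (simp add: K_def)
  have inner: "(\<integral>\<^sup>+b. cell c \<alpha> n L R a b \<partial>lborel) =
      ennreal (K / p) * ennreal (of_bool (L < a \<and> a < R) * (R - a) powr p)" for a
  proof (cases "L < a \<and> a < R")
    case True
    have "(\<integral>\<^sup>+b. cell c \<alpha> n L R a b \<partial>lborel) = (\<integral>\<^sup>+y. cell c \<alpha> n L R a (a + 1 * y) \<partial>lborel)"
      using nn_integral_real_affine[of "\<lambda>b. ennreal (cell c \<alpha> n L R a b)" 1 a] by simp
    also have "\<dots> = (\<integral>\<^sup>+y. ennreal K * ennreal (of_bool (0 < y \<and> y < R - a) * y powr (p - 1)) \<partial>lborel)"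
      using True K assms(4)
      by (intro nn_integral_cong)
         (auto simp: cell_def cell_weight_def K_def p_def mult_ac simp flip: ennreal_mult)
    also have "\<dots> = ennreal K * ennreal ((R - a) powr p / p)"
      using nn_integral_powr_from_0[of "p - 1" "R - a"] p True
      by (subst nn_integral_cmult) auto
    finally show ?thesis using True K p by (simp flip: ennreal_mult)
  next
    case False
    then have "cell c \<alpha> n L R a b = 0" for b using assms(4) by (auto simp: cell_def)
    then show ?thesis using False by simp
  qed
  have "(\<integral>\<^sup>+a. \<integral>\<^sup>+b. cell c \<alpha> n L R a b \<partial>lborel \<partial>lborel) =
      ennreal (K / p) * (\<integral>\<^sup>+a. ennreal (of_bool (L < a \<and> a < R) * (R - a) powr p) \<partial>lborel)"
    unfolding inner by (rule nn_integral_cmult) simp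
  also have "(\<integral>\<^sup>+a. ennreal (of_bool (L < a \<and> a < R) * (R - a) powr p) \<partial>lborel) =
      (\<integral>\<^sup>+y. ennreal (of_bool (0 < y \<and> y < R - L) * y powr p) \<partial>lborel)"
    using nn_integral_real_affine[of "\<lambda>a. ennreal (of_bool (L < a \<and> a < R) * (R - a) powr p)" "-1" R]
    by (simp add: algebra_simps conj_commute)
  also have "\<dots> = ennreal ((R - L) powr (p + 1) / (p + 1))"
    using p assms by (intro nn_integral_powr_from_0) auto
  also have "ennreal (K / p) * \<dots> = ennreal (cell_const c \<alpha> n * (R - L) powr (\<alpha> * real (n - 1) + 1))"
    unfolding cell_const_def Let_def p_def[symmetric]
    using assms(4) p divide_nonneg_pos[OF K p] by (subst ennreal_mult'[symmetric]) (simp_all add: K_def)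
  finally show ?thesis .
qed

lemma nn_integral_cell_one:
  assumes "L \<le> R" "n < 2"
  shows "(\<integral>\<^sup>+b. cell c \<alpha> n L R a b \<partial>lborel) = ennreal (cell_const c \<alpha> n * (R - L) powr (\<alpha> * real (n - 1) + 1))"
proof -
  have "(\<integral>\<^sup>+b. cell c \<alpha> n L R a b \<partial>lborel) = (\<integral>\<^sup>+b. indicator {L<..<R} b \<partial>lborel)"
    using assms by (intro nn_integral_cong) (auto simp: cell_def indicator_def)
  also have "\<dots> = ennreal (R - L)" using assms by simp
  also have "n - 1 = 0" using assms by simp
  then have "R - L = cell_const c \<alpha> n * (R - L) powr (\<alpha> * real (n - 1) + 1)"
    using assms by (simp add: cell_const_def)
  finally show ?thesis .
qed

text \<open>The product of the cells alone integrates exactly to \<open>V\<close>, so only the link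
  has to be estimated. Its bounds are required merely inside the cells, since elsewhere the product
  of the cells vanishes.\<close>

lemma mgf_coeff_bounds:
  assumes "c > 0" "\<alpha> > 0" and f: "strict_mono_on {1..q} f" and q: "q \<ge> 1"
    and k: "\<And>i. i \<in> {1..q} \<Longrightarrow> k i \<ge> 1"
    and t: "\<And>i. i \<in> {1..q} \<Longrightarrow> t (f i - 1) \<le> t (f i)" "t (f q) > 0"
    and "Lo \<ge> 0" "Hi \<ge> 0"
    and link: "\<And>p. (\<And>i. i \<in> {1..q} \<Longrightarrow> t (f i - 1) / t (f q) < block_start k p i \<and>
        block_start k p i \<le> snd p i \<and> snd p i < t (f i) / t (f q)) \<Longrightarrow>
      Lo \<le> link c \<alpha> lam (t (f q)) q k p \<and> link c \<alpha> lam (t (f q)) q k p \<le> Hi"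
  defines "V \<equiv> \<Prod>i=1..q. cell_const c \<alpha> (k i) * ((t (f i) - t (f i - 1)) / t (f q)) powr (\<alpha> * real (k i - 1) + 1)"
  shows "Lo * V \<le> mgf_coeff c \<alpha> lam t (f ` {1..q}) k" and "mgf_coeff c \<alpha> lam t (f ` {1..q}) k \<le> Hi * V"
proof -
  define \<tau> where "\<tau> = t (f q)"
  define \<phi> where "\<phi> i = cell c \<alpha> (k i) (t (f i - 1) / \<tau>) (t (f i) / \<tau>)" for i
  define I where "I = (\<integral>\<^sup>+p. ennreal ((\<Prod>i=1..q. \<phi> i (fst p i) (snd p i)) * link c \<alpha> lam \<tau> q k p) \<partial>block_space q k)"
  have coeff: "mgf_coeff c \<alpha> lam t (f ` {1..q}) k = enn2real I"
    unfolding I_def \<phi>_def \<tau>_def using assms by (intro mgf_coeff_eq_nn_integral) auto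
  have LR: "t (f i - 1) / \<tau> \<le> t (f i) / \<tau>" if "i \<in> {1..q}" for i
    using t that unfolding \<tau>_def by (intro divide_right_mono) auto
  have V: "V \<ge> 0" unfolding V_def using cell_const_pos[OF assms(1,2)] by (intro prod_nonneg) (simp add: less_imp_le)
  have vol: "(\<integral>\<^sup>+p. ennreal (\<Prod>i=1..q. \<phi> i (fst p i) (snd p i)) \<partial>block_space q k) = ennreal V"
  proof -
    have "(\<integral>\<^sup>+p. ennreal (\<Prod>i=1..q. \<phi> i (fst p i) (snd p i)) \<partial>block_space q k) =
        (\<Prod>i=1..q. if k i \<ge> 2 then \<integral>\<^sup>+a. \<integral>\<^sup>+b. \<phi> i a b \<partial>lborel \<partial>lborel else \<integral>\<^sup>+b. \<phi> i 0 b \<partial>lborel)"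
    proof (rule block_nn_integral)
      show "(\<lambda>p. \<phi> i (fst p) (snd p)) \<in> borel_measurable (borel \<Otimes>\<^sub>M borel)" for i
        unfolding \<phi>_def by (rule cell_measurable)
      show "\<phi> i a b \<ge> 0" for i a b unfolding \<phi>_def using assms(1,2) by (rule cell_nonneg)
      show "\<phi> i a b = \<phi> i a' b" if "k i < 2" for i a a' b using that by (simp add: \<phi>_def cell_def)
    qed
    also have "\<dots> = (\<Prod>i=1..q. ennreal (cell_const c \<alpha> (k i) * ((t (f i) - t (f i - 1)) / t (f q)) powr (\<alpha> * real (k i - 1) + 1)))"
    proof (intro prod.cong refl)
      fix i assume i: "i \<in> {1..q}"
      show "(if k i \<ge> 2 then \<integral>\<^sup>+a. \<integral>\<^sup>+b. \<phi> i a b \<partial>lborel \<partial>lborel else \<integral>\<^sup>+b. \<phi> i 0 b \<partial>lborel) =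
          ennreal (cell_const c \<alpha> (k i) * ((t (f i) - t (f i - 1)) / t (f q)) powr (\<alpha> * real (k i - 1) + 1))"
        using nn_integral_cell_many[OF assms(1,2) LR[OF i], of "k i"] nn_integral_cell_one[OF LR[OF i], of "k i" c \<alpha> 0]
        by (cases "k i \<ge> 2") (simp_all add: \<phi>_def \<tau>_def diff_divide_distrib)
    qed
    also have "\<dots> = ennreal V"
      unfolding V_def using cell_const_pos[OF assms(1,2)] by (intro prod_ennreal) (simp add: less_imp_le)
    finally show ?thesis .
  qed
  have meas: "(\<lambda>p. \<Prod>i=1..q. \<phi> i (fst p i) (snd p i)) \<in> borel_measurable (block_space q k)"
    unfolding \<phi>_def by (intro borel_measurable_prod cell_coordinate_measurable)
  have bounds: "Lo * (\<Prod>i=1..q. \<phi> i (fst p i) (snd p i)) \<le> (\<Prod>i=1..q. \<phi> i (fst p i) (snd p i)) * link c \<alpha> lam \<tau> q k p"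
    "(\<Prod>i=1..q. \<phi> i (fst p i) (snd p i)) * link c \<alpha> lam \<tau> q k p \<le> Hi * (\<Prod>i=1..q. \<phi> i (fst p i) (snd p i))" for p
  proof -
    have nn: "(\<Prod>i=1..q. \<phi> i (fst p i) (snd p i)) \<ge> 0"
      unfolding \<phi>_def using assms(1,2) by (intro prod_nonneg cell_nonneg) auto
    have "Lo \<le> link c \<alpha> lam \<tau> q k p \<and> link c \<alpha> lam \<tau> q k p \<le> Hi" if "(\<Prod>i=1..q. \<phi> i (fst p i) (snd p i)) \<noteq> 0"
      unfolding \<tau>_def
    proof (rule link)
      fix i assume "i \<in> {1..q}"
      with that have "\<phi> i (fst p i) (snd p i) \<noteq> 0" by auto
      then show "t (f i - 1) / t (f q) < block_start k p i \<and> block_start k p i \<le> snd p i \<and> snd p i < t (f i) / t (f q)"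
        unfolding \<phi>_def cell_def \<tau>_def block_start_def by (auto split: if_splits)
    qed
    then have "(\<Prod>i=1..q. \<phi> i (fst p i) (snd p i)) = 0 \<or> Lo \<le> link c \<alpha> lam \<tau> q k p \<and> link c \<alpha> lam \<tau> q k p \<le> Hi"
      by blast
    then show "Lo * (\<Prod>i=1..q. \<phi> i (fst p i) (snd p i)) \<le> (\<Prod>i=1..q. \<phi> i (fst p i) (snd p i)) * link c \<alpha> lam \<tau> q k p"
      "(\<Prod>i=1..q. \<phi> i (fst p i) (snd p i)) * link c \<alpha> lam \<tau> q k p \<le> Hi * (\<Prod>i=1..q. \<phi> i (fst p i) (snd p i))"
      using nn by (metis (no_types, lifting) mult.commute mult_left_mono mult_zero_left mult_zero_right order_refl)+
  qed
  have scale: "(\<integral>\<^sup>+p. ennreal (K * (\<Prod>i=1..q. \<phi> i (fst p i) (snd p i))) \<partial>block_space q k) = ennreal (K * V)"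
    if "K \<ge> 0" for K
  proof -
    have "(\<integral>\<^sup>+p. ennreal (K * (\<Prod>i=1..q. \<phi> i (fst p i) (snd p i))) \<partial>block_space q k) =
        (\<integral>\<^sup>+p. ennreal K * ennreal (\<Prod>i=1..q. \<phi> i (fst p i) (snd p i)) \<partial>block_space q k)"
      using that by (simp add: ennreal_mult')
    also have "\<dots> = ennreal K * ennreal V"
      unfolding nn_integral_cmult[OF measurable_compose[OF meas measurable_ennreal]] vol ..
    finally show ?thesis using that by (simp add: ennreal_mult')
  qed
  have up: "I \<le> ennreal (Hi * V)"
    unfolding I_def using scale[OF assms(9)] bounds(2)
    by (metis (no_types, lifting) ennreal_leI nn_integral_mono)
  have low: "ennreal (Lo * V) \<le> I"
    unfolding I_def using scale[OF assms(8)] bounds(1)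
    by (metis (no_types, lifting) ennreal_leI nn_integral_mono)
  show "mgf_coeff c \<alpha> lam t (f ` {1..q}) k \<le> Hi * V"
    unfolding coeff using enn2real_leI[OF _ up] V assms(9) by simp
  \<comment> \<open>\<open>enn2real\<close> is monotone only below \<open>top\<close>; the upper
    bound supplies the finiteness needed for the lower one.\<close>
  have "I < top" using up by (simp add: order.strict_trans1)
  then show "Lo * V \<le> mgf_coeff c \<alpha> lam t (f ` {1..q}) k"
    unfolding coeff using enn2real_mono[OF low] V assms(8) by simp
qed

subsection \<open>Moments of short increments\<close>

text \<open>Counting powers of \<open>\<tau>\<close>: the q - 1 links and the q cells carry total
  exponent (q-1)(\<alpha>-1) + \<Sum>(\<alpha>(k_i-1)+1) in the denominator, which equals the
  exponent of the prefactor. Hence \<open>\<tau>\<close> disappears.\<close>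

lemma scaling_identity:
  fixes \<tau> d \<alpha> :: real and g :: "nat \<Rightarrow> real"
  assumes "\<tau> > 0" "d \<ge> 0" and g: "\<And>i. i \<in> {2..q} \<Longrightarrow> g i \<ge> 0" and q: "q \<ge> 1"
    and k: "\<And>i. i \<in> {1..q} \<Longrightarrow> k i \<ge> 1"
  shows "\<tau> powr (\<alpha> * (real (\<Sum>i=1..q. k i) - 1) + 1) *
      ((\<Prod>i=2..q. c * (g i / \<tau>) powr (\<alpha> - 1)) * (\<Prod>i=1..q. K i * (d / \<tau>) powr (\<alpha> * real (k i - 1) + 1))) =
    (\<Prod>i=2..q. c * g i powr (\<alpha> - 1)) * (\<Prod>i=1..q. K i * d powr (\<alpha> * real (k i - 1) + 1))"
proof -
  let ?A = "\<Prod>i=2..q. \<tau> powr (\<alpha> - 1)" and ?B = "\<Prod>i=1..q. \<tau> powr (\<alpha> * real (k i - 1) + 1)"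
  have "(\<Sum>i=1..q. \<alpha> * real (k i - 1) + 1) = (\<Sum>i=1..q. \<alpha> * real (k i) + (1 - \<alpha>))"
    using k by (intro sum.cong refl) (auto simp: of_nat_diff algebra_simps)
  also have "\<dots> = \<alpha> * real (\<Sum>i=1..q. k i) + real q * (1 - \<alpha>)"
    by (simp add: sum.distrib sum_distrib_left)
  finally have "(\<Sum>i=2..q. \<alpha> - 1) + (\<Sum>i=1..q. \<alpha> * real (k i - 1) + 1) = \<alpha> * (real (\<Sum>i=1..q. k i) - 1) + 1"
    using q by (simp add: of_nat_diff algebra_simps)
  moreover have "?A * ?B = \<tau> powr ((\<Sum>i=2..q. \<alpha> - 1) + (\<Sum>i=1..q. \<alpha> * real (k i - 1) + 1))"
  proof -
    have "?A = \<tau> powr (\<Sum>i=2..q. \<alpha> - 1)" by (rule powr_sum[symmetric]) (use assms(1) in auto)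
    moreover have "?B = \<tau> powr (\<Sum>i=1..q. \<alpha> * real (k i - 1) + 1)"
      by (rule powr_sum[symmetric]) (use assms(1) in auto)
    ultimately show ?thesis by (simp only: powr_add[of \<tau> "sum _ _" "sum _ _"])
  qed
  ultimately have AB: "\<tau> powr (\<alpha> * (real (\<Sum>i=1..q. k i) - 1) + 1) = ?A * ?B" by simp
  have 1: "(\<Prod>i=2..q. c * (g i / \<tau>) powr (\<alpha> - 1)) = (\<Prod>i=2..q. c * g i powr (\<alpha> - 1)) / ?A"
    unfolding prod_dividef[symmetric] using g assms(1) by (intro prod.cong refl) (auto simp: powr_divide)
  have 2: "(\<Prod>i=1..q. K i * (d / \<tau>) powr (\<alpha> * real (k i - 1) + 1)) =
      (\<Prod>i=1..q. K i * d powr (\<alpha> * real (k i - 1) + 1)) / ?B"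
    unfolding prod_dividef[symmetric] using assms(1,2) by (intro prod.cong refl) (auto simp: powr_divide)
  have "?A \<noteq> 0" "?B \<noteq> 0" using assms(1) by auto
  moreover have "A * B * (x / A * (y / B)) = x * y" if "A \<noteq> 0" "B \<noteq> 0" for A B x y :: real
    using that by simp
  ultimately show ?thesis unfolding AB 1 2 by blast
qed

text \<open>The leading order in \<open>d\<close> of a joint moment of \<open>q\<close> increments,
  apart from the limit of the link. It does not depend on the positions of the intervals, and the
  rate \<open>a\<close> enters once whatever \<open>q\<close> is.\<close>

definition incr_scale :: "real \<Rightarrow> real \<Rightarrow> real \<Rightarrow> nat \<Rightarrow> (nat \<Rightarrow> nat) \<Rightarrow> real \<Rightarrow> real" where
  "incr_scale c \<alpha> a q k d = (\<Prod>i=1..q. fact (k i)) *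
     (a * (\<Prod>i=1..q. cell_const c \<alpha> (k i) * d powr (\<alpha> * real (k i - 1) + 1)))"

text \<open>The grid consists of the points \<open>s i - d\<close> (odd indices) and \<open>s i\<close> (even indices), and only the even
increments enter. On the region the link factor is almost constant.\<close>

lemma backward_incr_moment_bounds:
  assumes P: "is_limit_process c \<alpha> lam b T M X"
    and c: "c > 0" and \<alpha>: "0 < \<alpha>" "\<alpha> \<le> 1" and b: "b > 0"
    and s: "d < s 1" "\<And>i. i \<in> {2..q} \<Longrightarrow> s (i - 1) + d < s i" "s q \<le> T"
    and d: "d > 0" and q: "q \<ge> 1" and k: "\<And>i. i \<in> {1..q} \<Longrightarrow> k i \<ge> 1"
  defines "E \<equiv> \<integral>\<omega>. (\<Prod>i=1..q. backward_incr X d (s i) \<omega> ^ k i) \<partial>M"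
    and "N \<equiv> incr_scale c \<alpha> (rate_const c \<alpha> lam b T) q k d"
    and "G \<equiv> \<lambda>e. exp (- lam * (s q - s 1)) * (\<Prod>i=2..q. c * (s i - s (i - 1) + e) powr (\<alpha> - 1))"
  shows "integrable M (\<lambda>\<omega>. \<Prod>i=1..q. backward_incr X d (s i) \<omega> ^ k i)"
    and "exp (- \<bar>lam\<bar> * d) * G d * N \<le> E" and "E \<le> exp (\<bar>lam\<bar> * d) * G (- d) * N"
proof -
  define t where "t j = (if j = 0 then 0 else if even j then s (j div 2) else s (Suc j div 2) - d)" for j
  define f where "f i = 2 * i" for i :: nat
  have tf: "t (f i) = s i" "t (f i - 1) = s i - d" if "i \<ge> 1" for i
    using that by (auto simp: t_def f_def)
  note tf = tf tf(2)[unfolded One_nat_def]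
  have grid: "t (j - 1) < t j" if "j \<in> {1..2 * q}" for j
  proof (cases "even j")
    case True
    then obtain i where "j = 2 * i" by (elim evenE)
    then show ?thesis using that tf[of i] d by (simp add: f_def)
  next
    case False
    then obtain i where i: "j = 2 * i + 1" by (elim oddE)
    show ?thesis
    proof (cases "i = 0")
      case True
      then show ?thesis using i s(1) by (simp add: t_def)
    next
      case False
      then show ?thesis using i s(2)[of "Suc i"] that by (simp add: t_def)
    qed
  qed
  have f: "strict_mono_on {1..q} f" "f ` {1..q} \<subseteq> {1..2 * q}" by (auto simp: f_def strict_mono_on_def)
  note mom = increment_moment[OF P, of "2 * q" t q f k]
  have mom': "1 \<le> 2 * q" "t 0 = 0" "t (2 * q) \<le> T" using q s(3) by (auto simp: t_def)
  have incr: "(\<Prod>i=1..q. (X (t (f i)) \<omega> - X (t (f i - 1)) \<omega>) ^ k i) = (\<Prod>i=1..q. backward_incr X d (s i) \<omega> ^ k i)" for \<omega>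
    by (intro prod.cong refl) (auto simp: tf backward_incr_def)
  show "integrable M (\<lambda>\<omega>. \<Prod>i=1..q. backward_incr X d (s i) \<omega> ^ k i)"
    using mom(1)[OF mom'(1,2) grid mom'(3) f q k] unfolding incr .
  define A where "A = mgf_coeff c \<alpha> lam t (f ` {1..q}) k"
  define \<tau> where "\<tau> = s q"
  define pw where "pw = \<tau> powr (\<alpha> * (real (\<Sum>i=1..q. k i) - 1) + 1)"
  have E: "E = (\<Prod>i=1..q. fact (k i)) * (rate_const c \<alpha> lam b T * (pw * A))"
    using mom(2)[OF mom'(1,2) grid mom'(3) f q k] unfolding incr E_def A_def pw_def \<tau>_def tf(1)[OF q] .
  have "t 0 < t (2 * q)"
  proof -
    have "t 0 < t 1" using grid[of 1] q by simp
    also have "t 1 \<le> t (2 * q)" using grid_mono[of "2 * q" t, OF grid, of 1 "2 * q"] q by simp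
    finally show ?thesis .
  qed
  then have \<tau>: "\<tau> > 0" using q by (simp add: t_def \<tau>_def)
  have rate: "rate_const c \<alpha> lam b T \<ge> 0"
    using c b by (simp add: rate_const_def)
  define V where "V = (\<Prod>i=1..q. cell_const c \<alpha> (k i) * (d / \<tau>) powr (\<alpha> * real (k i - 1) + 1))"
  \<comment> \<open>\<open>H\<close> is \<open>G\<close> in the rescaled coordinates of the region.
    The shift \<open>e = d\<close> stands for the longest and \<open>e = - d\<close> for the
    shortest possible gaps between blocks.\<close>
  define H where "H e = exp (- lam * (s q - s 1)) * (\<Prod>i=2..q. c * ((s i - s (i - 1) + e) / \<tau>) powr (\<alpha> - 1))" for e
  have H: "H e \<ge> 0" for e using c by (simp add: H_def prod_nonneg)
  have link: "exp (- \<bar>lam\<bar> * d) * H d \<le> link c \<alpha> lam (t (f q)) q k p \<and>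
      link c \<alpha> lam (t (f q)) q k p \<le> exp (\<bar>lam\<bar> * d) * H (- d)"
    if p: "\<And>i. i \<in> {1..q} \<Longrightarrow> t (f i - 1) / t (f q) < block_start k p i \<and>
        block_start k p i \<le> snd p i \<and> snd p i < t (f i) / t (f q)" for p
  proof -
    \<comment> \<open>Back in unscaled time, the \<open>i\<close>-th block lies in the open interval
      from \<open>s i - d\<close> to \<open>s i\<close>.\<close>
    have cellp: "s i - d < \<tau> * block_start k p i" "\<tau> * block_start k p i \<le> \<tau> * snd p i" "\<tau> * snd p i < s i"
      if "i \<in> {1..q}" for i
      using p[OF that] that q \<tau> by (auto simp: tf \<tau>_def field_simps)
    define z where "z = \<tau> * (snd p q - block_start k p 1)"
    have "\<bar>z - (s q - s 1)\<bar> \<le> d"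
      using cellp[of 1] cellp[of q] q by (auto simp: z_def algebra_simps abs_le_iff)
    then have "\<bar>lam * (z - (s q - s 1))\<bar> \<le> \<bar>lam\<bar> * d"
      by (simp add: abs_mult mult_left_mono)
    then have e: "exp (- \<bar>lam\<bar> * d) * exp (- lam * (s q - s 1)) \<le> exp (- lam * z)"
      "exp (- lam * z) \<le> exp (\<bar>lam\<bar> * d) * exp (- lam * (s q - s 1))"
      unfolding exp_add[symmetric] by (auto simp: abs_le_iff algebra_simps)
    \<comment> \<open>The gap between consecutive blocks differs from \<open>s i - s (i - 1)\<close>
      by at most \<open>d\<close>, and the power is antitone because
      \<open>\<alpha> \<le> 1\<close>.\<close>
    have fac: "c * ((s i - s (i - 1) + d) / \<tau>) powr (\<alpha> - 1) \<le> c * (block_start k p i - snd p (i - 1)) powr (\<alpha> - 1)"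
      "c * (block_start k p i - snd p (i - 1)) powr (\<alpha> - 1) \<le> c * ((s i - s (i - 1) + - d) / \<tau>) powr (\<alpha> - 1)"
      if i: "i \<in> {2..q}" for i
    proof -
      have i': "i \<in> {1..q}" "i - 1 \<in> {1..q}" using i by auto
      have pos: "0 < (s i - s (i - 1) + - d) / \<tau>" using s(2)[OF i] \<tau> by simp
      have "s i - s (i - 1) + - d \<le> \<tau> * (block_start k p i - snd p (i - 1))"
        "\<tau> * (block_start k p i - snd p (i - 1)) \<le> s i - s (i - 1) + d"
        unfolding right_diff_distrib using cellp[OF i'(1)] cellp[OF i'(2)] by linarith+
      then have lo: "(s i - s (i - 1) + - d) / \<tau> \<le> block_start k p i - snd p (i - 1)"
        and hi: "block_start k p i - snd p (i - 1) \<le> (s i - s (i - 1) + d) / \<tau>"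
        using \<tau> by (simp_all add: pos_divide_le_eq pos_le_divide_eq mult.commute)
      show "c * ((s i - s (i - 1) + d) / \<tau>) powr (\<alpha> - 1) \<le> c * (block_start k p i - snd p (i - 1)) powr (\<alpha> - 1)"
        using c \<alpha> pos lo hi by (intro mult_left_mono powr_mono2') auto
      show "c * (block_start k p i - snd p (i - 1)) powr (\<alpha> - 1) \<le> c * ((s i - s (i - 1) + - d) / \<tau>) powr (\<alpha> - 1)"
        using c \<alpha> pos lo by (intro mult_left_mono powr_mono2') auto
    qed
    have lk: "link c \<alpha> lam (t (f q)) q k p = exp (- lam * z) * (\<Prod>i=2..q. c * (block_start k p i - snd p (i - 1)) powr (\<alpha> - 1))"
      by (simp add: link_def z_def tf(1)[OF q] \<tau>_def mult.assoc)
    show ?thesis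
    proof
      show "exp (- \<bar>lam\<bar> * d) * H d \<le> link c \<alpha> lam (t (f q)) q k p"
        unfolding H_def lk mult.assoc[symmetric]
        by (intro mult_mono e prod_mono conjI fac prod_nonneg) (use c in auto)
      show "link c \<alpha> lam (t (f q)) q k p \<le> exp (\<bar>lam\<bar> * d) * H (- d)"
        unfolding H_def lk mult.assoc[symmetric]
        by (intro mult_mono e prod_mono conjI fac prod_nonneg) (use c in auto)
    qed
  qed
  have Veq: "(\<Prod>i=1..q. cell_const c \<alpha> (k i) * ((t (f i) - t (f i - 1)) / t (f q)) powr (\<alpha> * real (k i - 1) + 1)) = V"
    unfolding V_def by (intro prod.cong refl) (use q in \<open>auto simp: tf \<tau>_def\<close>)
  have tle: "t (f i - 1) \<le> t (f i)" if "i \<in> {1..q}" for i using that d by (simp add: tf)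
  have tpos: "t (f q) > 0" using \<tau> unfolding tf(1)[OF q] \<tau>_def .
  have A: "exp (- \<bar>lam\<bar> * d) * H d * V \<le> A" "A \<le> exp (\<bar>lam\<bar> * d) * H (- d) * V"
    unfolding A_def Veq[symmetric]
    by (rule mgf_coeff_bounds[OF c \<alpha>(1) f(1) q k tle tpos _ _ link]; (simp add: H)?)+
  have scaled: "(\<Prod>i=1..q. fact (k i)) * (rate_const c \<alpha> lam b T * (pw * (x * H e * V))) = x * G e * N"
    if "\<And>i. i \<in> {2..q} \<Longrightarrow> s i - s (i - 1) + e \<ge> 0" for x e
  proof -
    have "pw * ((\<Prod>i=2..q. c * ((s i - s (i - 1) + e) / \<tau>) powr (\<alpha> - 1)) * V) =
        (\<Prod>i=2..q. c * (s i - s (i - 1) + e) powr (\<alpha> - 1)) *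
        (\<Prod>i=1..q. cell_const c \<alpha> (k i) * d powr (\<alpha> * real (k i - 1) + 1))"
      unfolding pw_def V_def using \<tau> d q k that by (intro scaling_identity) auto
    then show ?thesis unfolding H_def G_def N_def incr_scale_def by algebra
  qed
  have gap: "s i - s (i - 1) + d \<ge> 0" "s i - s (i - 1) + - d \<ge> 0" if "i \<in> {2..q}" for i
    using s(2)[OF that] d by auto
  have nn: "(\<Prod>i=1..q. fact (k i) :: real) \<ge> 0" "pw \<ge> 0" by (auto simp: pw_def prod_nonneg)
  have "exp (- \<bar>lam\<bar> * d) * G d * N =
      (\<Prod>i=1..q. fact (k i)) * (rate_const c \<alpha> lam b T * (pw * (exp (- \<bar>lam\<bar> * d) * H d * V)))"
    by (rule scaled[symmetric]) (rule gap(1))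
  also have "\<dots> \<le> E" unfolding E by (intro mult_left_mono rate nn A)
  finally show "exp (- \<bar>lam\<bar> * d) * G d * N \<le> E" .
  have "E \<le> (\<Prod>i=1..q. fact (k i)) * (rate_const c \<alpha> lam b T * (pw * (exp (\<bar>lam\<bar> * d) * H (- d) * V)))"
    unfolding E by (intro mult_left_mono rate nn A)
  also have "\<dots> = exp (\<bar>lam\<bar> * d) * G (- d) * N"
    by (rule scaled) (rule gap(2))
  finally show "E \<le> exp (\<bar>lam\<bar> * d) * G (- d) * N" .
qed

lemma eventually_small_increment:
  fixes s :: "nat \<Rightarrow> real"
  assumes "0 < s 1" "\<And>i. i \<in> {2..q} \<Longrightarrow> s (i - 1) < s i"
  shows "eventually (\<lambda>d. d > 0 \<and> d < s 1 \<and> (\<forall>i\<in>{2..q}. s (i - 1) + d < s i)) (at_right 0)"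
proof -
  have "eventually (\<lambda>d. \<forall>i\<in>{2..q}. s (i - 1) + d < s i) (at_right 0)"
  proof (rule eventually_ball_finite[OF finite_atLeastAtMost], rule ballI)
    fix i assume "i \<in> {2..q}"
    then have "eventually (\<lambda>d. d < s i - s (i - 1)) (at_right 0)"
      using assms(2)[of i] by (auto simp: eventually_at_right_field intro!: exI[of _ "s i - s (i - 1)"])
    then show "eventually (\<lambda>d. s (i - 1) + d < s i) (at_right 0)"
      by eventually_elim auto
  qed
  moreover have "eventually (\<lambda>d. d < s 1) (at_right 0)"
    using assms(1) by (auto simp: eventually_at_right_field intro!: exI[of _ "s 1"])
  ultimately show ?thesis
    using eventually_at_right_less[of "0::real"] by eventually_elim auto
qed

text \<open>A squeeze: divided by the positive scale, both bounds tend to the stated limit. The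
  limiting gaps \<open>s i - s (i - 1)\<close> must be nonzero for this, since the exponent
  \<open>\<alpha> - 1\<close> may be negative.\<close>

lemma backward_incr_moment_asymp:
  assumes P: "is_limit_process c \<alpha> lam b T M X"
    and c: "c > 0" and \<alpha>: "0 < \<alpha>" "\<alpha> \<le> 1" and b: "b > 0"
    and s: "0 < s 1" "\<And>i. i \<in> {2..q} \<Longrightarrow> s (i - 1) < s i" "s q \<le> T"
    and q: "q \<ge> 1" and k: "\<And>i. i \<in> {1..q} \<Longrightarrow> k i \<ge> 1"
  shows "((\<lambda>d. (\<integral>\<omega>. (\<Prod>i=1..q. backward_incr X d (s i) \<omega> ^ k i) \<partial>M) /
        incr_scale c \<alpha> (rate_const c \<alpha> lam b T) q k d)
      \<longlongrightarrow> exp (- lam * (s q - s 1)) * (\<Prod>i=2..q. c * (s i - s (i - 1)) powr (\<alpha> - 1))) (at_right 0)"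
    (is "((\<lambda>d. ?E d / ?N d) \<longlongrightarrow> ?L) _")
proof -
  let ?G = "\<lambda>e. exp (- lam * (s q - s 1)) * (\<Prod>i=2..q. c * (s i - s (i - 1) + e) powr (\<alpha> - 1))"
  have ev: "eventually (\<lambda>d. d > 0 \<and> d < s 1 \<and> (\<forall>i\<in>{2..q}. s (i - 1) + d < s i)) (at_right 0)"
    by (rule eventually_small_increment) (use s in auto)
  have gap: "s i - s (i - 1) \<noteq> 0" if "i \<in> {2..q}" for i using s(2)[OF that] by simp
  have pos: "0 < s i" if "1 \<le> i" "i \<le> q" for i
    using that
  proof (induction i rule: dec_induct)
    case (step n)
    then show ?case using s(2)[of "Suc n"] by auto
  qed (rule s(1))
  then have "T > 0" using q s(3) by fastforce
  then have rate: "rate_const c \<alpha> lam b T > 0" using c b by (simp add: rate_const_def)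
  have N: "?N d > 0" if "d > 0" for d
    unfolding incr_scale_def using that rate cell_const_pos[OF c \<alpha>(1)]
    by (intro mult_pos_pos prod_pos) auto
  show ?thesis
  proof (rule tendsto_sandwich)
    show "eventually (\<lambda>d. exp (- \<bar>lam\<bar> * d) * ?G d \<le> ?E d / ?N d) (at_right 0)"
      using ev
    proof eventually_elim
      case (elim d)
      have "exp (- \<bar>lam\<bar> * d) * ?G d * ?N d \<le> ?E d"
        using elim by (intro backward_incr_moment_bounds(2)[OF P c \<alpha> b]) (use s(3) q k in auto)
      then show ?case using elim N[of d]
        by (subst pos_le_divide_eq) auto
    qed
    show "eventually (\<lambda>d. ?E d / ?N d \<le> exp (\<bar>lam\<bar> * d) * ?G (- d)) (at_right 0)"
      using ev
    proof eventually_elim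
      case (elim d)
      have "?E d \<le> exp (\<bar>lam\<bar> * d) * ?G (- d) * ?N d"
        using elim by (intro backward_incr_moment_bounds(3)[OF P c \<alpha> b]) (use s(3) q k in auto)
      then show ?case using elim N[of d]
        by (subst pos_divide_le_eq) auto
    qed
    have "((\<lambda>d. exp (- \<bar>lam\<bar> * d) * ?G d) \<longlongrightarrow> exp (- \<bar>lam\<bar> * 0) * ?G 0) (at_right 0)"
      using gap by (intro tendsto_intros) auto
    then show "((\<lambda>d. exp (- \<bar>lam\<bar> * d) * ?G d) \<longlongrightarrow> ?L) (at_right 0)" by simp
    have "((\<lambda>d. exp (\<bar>lam\<bar> * d) * ?G (- d)) \<longlongrightarrow> exp (\<bar>lam\<bar> * 0) * ?G (- 0)) (at_right 0)"
      using gap by (intro tendsto_intros) auto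
    then show "((\<lambda>d. exp (\<bar>lam\<bar> * d) * ?G (- d)) \<longlongrightarrow> ?L) (at_right 0)" by simp
  qed
qed

subsection \<open>Explicit moments\<close>

text \<open>A nested Lebesgue integral counts an infinite inner integral as 0, hence the finiteness
  hypothesis. The outer integral may be infinite; both sides are then 0.\<close>

lemma enn2real_nested_nn_integral:
  fixes F :: "real \<Rightarrow> real \<Rightarrow> real"
  assumes [measurable]: "(\<lambda>p. F (fst p) (snd p)) \<in> borel_measurable (borel \<Otimes>\<^sub>M borel)"
    and nonneg: "\<And>x y. F x y \<ge> 0"
    and fin: "AE x in lborel. (\<integral>\<^sup>+y. F x y \<partial>lborel) < \<infinity>"
  shows "enn2real (\<integral>\<^sup>+x. \<integral>\<^sup>+y. F x y \<partial>lborel \<partial>lborel) = (\<integral>x. \<integral>y. F x y \<partial>lborel \<partial>lborel)"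
proof -
  have [measurable]: "F x \<in> borel_measurable borel" for x
  proof -
    have "(\<lambda>y. F (fst (x, y)) (snd (x, y))) \<in> borel_measurable borel"
      by (rule measurable_compose[OF _ assms(1)]) simp
    then show ?thesis by simp
  qed
  have "(\<integral>\<^sup>+x. \<integral>\<^sup>+y. F x y \<partial>lborel \<partial>lborel) = (\<integral>\<^sup>+x. ennreal (\<integral>y. F x y \<partial>lborel) \<partial>lborel)"
  proof (rule nn_integral_cong_AE)
    show "AE x in lborel. (\<integral>\<^sup>+y. F x y \<partial>lborel) = ennreal (\<integral>y. F x y \<partial>lborel)"
      using fin
    proof eventually_elim
      case (elim x)
      then show ?case
        using nonneg by (intro nn_integral_eq_integral integrableI_nonneg) auto
    qed
  qed
  moreover have "(\<lambda>x. \<integral>y. F x y \<partial>lborel) \<in> borel_measurable lborel"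
    by (intro lborel.borel_measurable_lebesgue_integral) (simp add: case_prod_beta')
  ultimately show ?thesis
    using nonneg by (subst integral_eq_nn_integral) (auto intro!: AE_I2 integral_nonneg_AE)
qed

text \<open>After interchanging the order, the substitution \<open>y = b - a\<close> carries the
  triangle of pairs (a, b) to that of pairs (x, y) with x = b. Open and closed intervals differ by
  null sets.\<close>

lemma triangle_LBINT:
  fixes h :: "real \<Rightarrow> real"
  assumes [measurable]: "h \<in> borel_measurable borel" and nonneg: "\<And>y. h y \<ge> 0"
    and fin: "\<And>x. 0 < x \<Longrightarrow> x < 1 \<Longrightarrow> (\<integral>\<^sup>+y. ennreal (of_bool (0 < y \<and> y < x) * h y) \<partial>lborel) < \<infinity>"
  shows "enn2real (\<integral>\<^sup>+a. \<integral>\<^sup>+b. ennreal (of_bool (0 < a \<and> a < b \<and> b < 1) * h (b - a)) \<partial>lborel \<partial>lborel) =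
    (LBINT x:{0..1}. LBINT y:{0..x}. h y)"
proof -
  define F where "F x y = of_bool (0 < x \<and> x < 1 \<and> 0 < y \<and> y < x) * h y" for x y
  have Fm: "(\<lambda>p. F (fst p) (snd p)) \<in> borel_measurable (borel \<Otimes>\<^sub>M borel)"
    unfolding F_def by measurable
  have "(\<integral>\<^sup>+a. \<integral>\<^sup>+b. ennreal (of_bool (0 < a \<and> a < b \<and> b < 1) * h (b - a)) \<partial>lborel \<partial>lborel) =
      (\<integral>\<^sup>+b. \<integral>\<^sup>+a. ennreal (of_bool (0 < a \<and> a < b \<and> b < 1) * h (b - a)) \<partial>lborel \<partial>lborel)"
    by (rule lborel_pair.Fubini') measurable
  also have "\<dots> = (\<integral>\<^sup>+x. \<integral>\<^sup>+y. F x y \<partial>lborel \<partial>lborel)"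
  proof (rule nn_integral_cong)
    fix b :: real
    have "(\<integral>\<^sup>+a. ennreal (of_bool (0 < a \<and> a < b \<and> b < 1) * h (b - a)) \<partial>lborel) =
        (\<integral>\<^sup>+y. ennreal (of_bool (0 < b - y \<and> b - y < b \<and> b < 1) * h (b - (b - y))) \<partial>lborel)"
      using nn_integral_real_affine[of "\<lambda>a. ennreal (of_bool (0 < a \<and> a < b \<and> b < 1) * h (b - a))" "-1" b] by simp
    also have "\<dots> = (\<integral>\<^sup>+y. F b y \<partial>lborel)"
      by (intro nn_integral_cong) (auto simp: F_def)
    finally show "(\<integral>\<^sup>+a. ennreal (of_bool (0 < a \<and> a < b \<and> b < 1) * h (b - a)) \<partial>lborel) = (\<integral>\<^sup>+y. F b y \<partial>lborel)" .
  qed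
  also have "enn2real \<dots> = (\<integral>x. \<integral>y. F x y \<partial>lborel \<partial>lborel)"
  proof (rule enn2real_nested_nn_integral[OF Fm])
    show "F x y \<ge> 0" for x y by (simp add: F_def nonneg)
    have "(\<integral>\<^sup>+y. F x y \<partial>lborel) < \<infinity>" for x
    proof (cases "0 < x \<and> x < 1")
      case True
      then show ?thesis using fin[of x] by (simp add: F_def)
    next
      case False
      then have "F x y = 0" for y by (auto simp: F_def)
      then show ?thesis by simp
    qed
    then show "AE x in lborel. (\<integral>\<^sup>+y. F x y \<partial>lborel) < \<infinity>" by simp
  qed
  also have "\<dots> = (\<integral>x. of_bool (0 \<le> x \<and> x \<le> 1) * (\<integral>y. of_bool (0 \<le> y \<and> y \<le> x) * h y \<partial>lborel) \<partial>lborel)"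
  proof (rule integral_cong_AE)
    show "(\<lambda>x. \<integral>y. F x y \<partial>lborel) \<in> borel_measurable lborel"
      using Fm by (intro lborel.borel_measurable_lebesgue_integral) (simp add: case_prod_beta')
    have "(\<lambda>x. \<integral>y. of_bool (0 \<le> y \<and> y \<le> x) * h y \<partial>lborel) \<in> borel_measurable lborel"
      by (intro lborel.borel_measurable_lebesgue_integral) (simp add: case_prod_beta')
    then show "(\<lambda>x. of_bool (0 \<le> x \<and> x \<le> 1) * (\<integral>y. of_bool (0 \<le> y \<and> y \<le> x) * h y \<partial>lborel)) \<in> borel_measurable lborel"
      by measurable
    show "AE x in lborel. (\<integral>y. F x y \<partial>lborel) =
        of_bool (0 \<le> x \<and> x \<le> 1) * (\<integral>y. of_bool (0 \<le> y \<and> y \<le> x) * h y \<partial>lborel)"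
      using AE_lborel_singleton[of 0] AE_lborel_singleton[of 1]
    proof eventually_elim
      case (elim x)
      show ?case
      proof (cases "0 < x \<and> x < 1")
        case True
        have "(\<integral>y. F x y \<partial>lborel) = (\<integral>y. of_bool (0 \<le> y \<and> y \<le> x) * h y \<partial>lborel)"
        proof (rule integral_cong_AE)
          show "AE y in lborel. F x y = of_bool (0 \<le> y \<and> y \<le> x) * h y"
            using AE_lborel_singleton[of 0] AE_lborel_singleton[of x]
            by eventually_elim (use True in \<open>auto simp: F_def\<close>)
        qed (simp_all add: F_def)
        then show ?thesis using True by simp
      next
        case False
        then have "F x y = 0" for y by (auto simp: F_def)
        then show ?thesis using False elim by auto
      qed
    qed
  qed
  also have "\<dots> = (LBINT x:{0..1}. LBINT y:{0..x}. h y)"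
    by (simp add: set_lebesgue_integral_def indicator_def)
  finally show ?thesis .
qed

text \<open>\<open>y\<close> runs over the first and \<open>x\<close> over the second of two
  intervals that meet at \<open>r\<close>. Finiteness is asked only for \<open>x > r\<close>, where
  a singularity of \<open>H\<close> on the diagonal does no harm.\<close>

lemma rectangle_LBINT:
  fixes H :: "real \<Rightarrow> real \<Rightarrow> real"
  assumes Hm [measurable]: "(\<lambda>p. H (fst p) (snd p)) \<in> borel_measurable (borel \<Otimes>\<^sub>M borel)"
    and nonneg: "\<And>x y. H x y \<ge> 0"
    and fin: "\<And>x. r < x \<Longrightarrow> x < 1 \<Longrightarrow> (\<integral>\<^sup>+y. ennreal (of_bool (0 < y \<and> y < r) * H x y) \<partial>lborel) < \<infinity>"
  shows "enn2real (\<integral>\<^sup>+x. \<integral>\<^sup>+y. ennreal (of_bool (r < x \<and> x < 1 \<and> 0 < y \<and> y < r) * H x y) \<partial>lborel \<partial>lborel) =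
    (LBINT x:{r..1}. LBINT y:{0..r}. H x y)"
proof -
  define F where "F x y = of_bool (r < x \<and> x < 1 \<and> 0 < y \<and> y < r) * H x y" for x y
  have Hx [measurable]: "H x \<in> borel_measurable borel" for x
  proof -
    have "(\<lambda>y. H (fst (x, y)) (snd (x, y))) \<in> borel_measurable borel"
      by (rule measurable_compose[OF _ Hm]) simp
    then show ?thesis by simp
  qed
  have Fm: "(\<lambda>p. F (fst p) (snd p)) \<in> borel_measurable (borel \<Otimes>\<^sub>M borel)"
    unfolding F_def by measurable
  have "enn2real (\<integral>\<^sup>+x. \<integral>\<^sup>+y. F x y \<partial>lborel \<partial>lborel) = (\<integral>x. \<integral>y. F x y \<partial>lborel \<partial>lborel)"
  proof (rule enn2real_nested_nn_integral[OF Fm])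
    show "F x y \<ge> 0" for x y by (simp add: F_def nonneg)
    have "(\<integral>\<^sup>+y. F x y \<partial>lborel) < \<infinity>" for x
    proof (cases "r < x \<and> x < 1")
      case True
      then show ?thesis using fin[of x] by (simp add: F_def)
    next
      case False
      then have "F x y = 0" for y by (auto simp: F_def)
      then show ?thesis by simp
    qed
    then show "AE x in lborel. (\<integral>\<^sup>+y. F x y \<partial>lborel) < \<infinity>" by simp
  qed
  also have "\<dots> = (\<integral>x. of_bool (r \<le> x \<and> x \<le> 1) * (\<integral>y. of_bool (0 \<le> y \<and> y \<le> r) * H x y \<partial>lborel) \<partial>lborel)"
  proof (rule integral_cong_AE)
    show "(\<lambda>x. \<integral>y. F x y \<partial>lborel) \<in> borel_measurable lborel"
      using Fm by (intro lborel.borel_measurable_lebesgue_integral) (simp add: case_prod_beta')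
    have "(\<lambda>x. \<integral>y. of_bool (0 \<le> y \<and> y \<le> r) * H x y \<partial>lborel) \<in> borel_measurable lborel"
      by (intro lborel.borel_measurable_lebesgue_integral) (simp add: case_prod_beta')
    then show "(\<lambda>x. of_bool (r \<le> x \<and> x \<le> 1) * (\<integral>y. of_bool (0 \<le> y \<and> y \<le> r) * H x y \<partial>lborel)) \<in> borel_measurable lborel"
      by measurable
    show "AE x in lborel. (\<integral>y. F x y \<partial>lborel) =
        of_bool (r \<le> x \<and> x \<le> 1) * (\<integral>y. of_bool (0 \<le> y \<and> y \<le> r) * H x y \<partial>lborel)"
      using AE_lborel_singleton[of r] AE_lborel_singleton[of 1]
    proof eventually_elim
      case (elim x)
      show ?case
      proof (cases "r < x \<and> x < 1")
        case True
        have "(\<integral>y. F x y \<partial>lborel) = (\<integral>y. of_bool (0 \<le> y \<and> y \<le> r) * H x y \<partial>lborel)"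
        proof (rule integral_cong_AE)
          show "AE y in lborel. F x y = of_bool (0 \<le> y \<and> y \<le> r) * H x y"
            using AE_lborel_singleton[of 0] AE_lborel_singleton[of r]
            by eventually_elim (use True in \<open>auto simp: F_def\<close>)
        qed (simp_all add: F_def)
        then show ?thesis using True by simp
      next
        case False
        then have "F x y = 0" for y by (auto simp: F_def)
        then show ?thesis using False elim by auto
      qed
    qed
  qed
  also have "\<dots> = (LBINT x:{r..1}. LBINT y:{0..r}. H x y)"
    by (simp add: set_lebesgue_integral_def indicator_def)
  finally show ?thesis unfolding F_def .
qed

text \<open>For one block of exponent 1 the link is \<open>exp 0\<close> times an empty product, so
  the two-sided bounds apply with both constants equal to 1.\<close>

lemma mgf_coeff_single_one:
  assumes "c > 0" "\<alpha> > 0" and t: "t 0 = 0" "t 1 > 0"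
  shows "mgf_coeff c \<alpha> lam t {1} (\<lambda>_. 1) = 1"
proof -
  have id: "strict_mono_on {1..1::nat} id" by (simp add: strict_mono_on_def)
  have V: "(\<Prod>i=1..1. cell_const c \<alpha> 1 * ((t (id i) - t (id i - 1)) / t (id 1)) powr (\<alpha> * real (1 - 1) + 1)) = 1"
    using t by (simp add: cell_const_def)
  have link: "1 \<le> link c \<alpha> lam (t (id 1)) 1 (\<lambda>_. 1) p \<and> link c \<alpha> lam (t (id 1)) 1 (\<lambda>_. 1) p \<le> 1" for p
    by (simp add: link_def block_start_def)
  have "1 * 1 \<le> mgf_coeff c \<alpha> lam t (id ` {1..1}) (\<lambda>_. 1)" "mgf_coeff c \<alpha> lam t (id ` {1..1}) (\<lambda>_. 1) \<le> 1 * 1"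
    using mgf_coeff_bounds[OF assms(1,2) id, of "\<lambda>_. 1" t 1 1 lam] link t unfolding V by auto
  then show ?thesis by simp
qed

text \<open>The link of a single block is an exponential of its length, so it merges with the weight
  into a function \<open>h\<close> of \<open>b - a\<close> alone, integrated over a
  triangle.\<close>

lemma mgf_coeff_single_many:
  assumes "c > 0" "\<alpha> > 0" and t: "t 0 = 0" "t 1 > 0" and k: "k \<ge> 2"
  shows "mgf_coeff c \<alpha> lam t {1} (\<lambda>_. k) =
    (c * Gamma \<alpha>) ^ (k - 1) / Gamma (real (k - 1) * \<alpha>) *
    (LBINT x:{0..1}. LBINT y:{0..x}. exp (- lam * t 1 * y) * y powr (\<alpha> * real (k - 1) - 1))"
proof -
  define p where "p = \<alpha> * real (k - 1)"
  have p: "p > 0" using assms by (simp add: p_def)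
  define h where "h y = cell_weight c \<alpha> k y * exp (- lam * t 1 * y)" for y
  have id: "strict_mono_on {1..1::nat} id" by (simp add: strict_mono_on_def)
  have hm [measurable]: "h \<in> borel_measurable borel" unfolding h_def cell_weight_def by measurable
  have h: "h y \<ge> 0" for y using assms by (simp add: h_def cell_weight_nonneg)
  define K where "K = (c * Gamma \<alpha>) ^ (k - 1) / Gamma (real (k - 1) * \<alpha>)"
  have hK: "h y = K * (exp (- lam * t 1 * y) * y powr (\<alpha> * real (k - 1) - 1))" for y
    by (simp add: h_def cell_weight_def K_def)
  have K: "K \<ge> 0" using h[of 1] unfolding hK by (simp add: zero_le_mult_iff)
  define \<phi> where "\<phi> i a b = of_bool (0 < a \<and> a < b \<and> b < 1) * h (b - a)" for i :: nat and a b
  have "mgf_coeff c \<alpha> lam t (id ` {1..1}) (\<lambda>_. k) =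
    enn2real (\<integral>\<^sup>+p. ennreal ((\<Prod>i=1..1. cell c \<alpha> k (t (id i - 1) / t (id 1)) (t (id i) / t (id 1)) (fst p i) (snd p i)) *
      link c \<alpha> lam (t (id 1)) 1 (\<lambda>_. k) p) \<partial>block_space 1 (\<lambda>_. k))"
    using k by (intro mgf_coeff_eq_nn_integral assms(1,2) id) auto
  also have "(\<lambda>p. (\<Prod>i=1..1. cell c \<alpha> k (t (id i - 1) / t (id 1)) (t (id i) / t (id 1)) (fst p i) (snd p i)) *
      link c \<alpha> lam (t (id 1)) 1 (\<lambda>_. k) p) = (\<lambda>p. \<Prod>i=1..1. \<phi> i (fst p i) (snd p i))"
    using t k by (auto simp: \<phi>_def cell_def link_def block_start_def h_def)
  also have "(\<integral>\<^sup>+p. ennreal (\<Prod>i=1..1. \<phi> i (fst p i) (snd p i)) \<partial>block_space 1 (\<lambda>_. k)) =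
      (\<Prod>i::nat=1..1. if k \<ge> 2 then \<integral>\<^sup>+a. \<integral>\<^sup>+b. \<phi> i a b \<partial>lborel \<partial>lborel else \<integral>\<^sup>+b. \<phi> i 0 b \<partial>lborel)"
  proof (rule block_nn_integral)
    show "(\<lambda>p. \<phi> i (fst p) (snd p)) \<in> borel_measurable (borel \<Otimes>\<^sub>M borel)" for i
      unfolding \<phi>_def by measurable
    show "\<phi> i a b \<ge> 0" for i a b using h by (simp add: \<phi>_def)
  qed (use k in auto)
  also have "\<dots> = (\<integral>\<^sup>+a. \<integral>\<^sup>+b. ennreal (of_bool (0 < a \<and> a < b \<and> b < 1) * h (b - a)) \<partial>lborel \<partial>lborel)"
    using k by (simp add: \<phi>_def)
  also have "enn2real \<dots> = (LBINT x:{0..1}. LBINT y:{0..x}. h y)"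
  proof (rule triangle_LBINT[OF hm h])
    fix x :: real assume x: "0 < x" "x < 1"
    have "(\<integral>\<^sup>+y. ennreal (of_bool (0 < y \<and> y < x) * h y) \<partial>lborel) \<le>
        (\<integral>\<^sup>+y. ennreal (K * exp \<bar>lam * t 1\<bar>) * ennreal (of_bool (0 < y \<and> y < x) * y powr (p - 1)) \<partial>lborel)"
    proof (rule nn_integral_mono)
      fix y :: real
      \<comment> \<open>On the unit interval the exponential is bounded, and y^(p-1) is integrable
        at 0 because \<open>p > 0\<close>.\<close>
      have "h y \<le> K * exp \<bar>lam * t 1\<bar> * y powr (p - 1)" if y: "0 < y" "y < x"
      proof -
        have "- lam * t 1 * y \<le> \<bar>lam * t 1\<bar> * y" using y by (intro mult_right_mono) auto
        also have "\<dots> \<le> \<bar>lam * t 1\<bar> * 1" using y x by (intro mult_left_mono) auto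
        finally have "exp (- lam * t 1 * y) \<le> exp \<bar>lam * t 1\<bar>" by simp
        then show ?thesis
          unfolding hK p_def[symmetric] mult.assoc using K by (intro mult_left_mono mult_right_mono) auto
      qed
      then show "ennreal (of_bool (0 < y \<and> y < x) * h y) \<le>
          ennreal (K * exp \<bar>lam * t 1\<bar>) * ennreal (of_bool (0 < y \<and> y < x) * y powr (p - 1))"
        using K by (auto simp flip: ennreal_mult intro!: ennreal_leI)
    qed
    also have "\<dots> = ennreal (K * exp \<bar>lam * t 1\<bar>) * ennreal (x powr p / p)"
      using nn_integral_powr_from_0[of "p - 1" x] p x by (subst nn_integral_cmult) auto
    also have "\<dots> < \<infinity>" by (simp add: ennreal_mult_less_top)
    finally show "(\<integral>\<^sup>+y. ennreal (of_bool (0 < y \<and> y < x) * h y) \<partial>lborel) < \<infinity>" .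
  qed
  also have "\<dots> = K * (LBINT x:{0..1}. LBINT y:{0..x}. exp (- lam * t 1 * y) * y powr (\<alpha> * real (k - 1) - 1))"
    unfolding hK by simp
  finally show ?thesis by (simp add: K_def)
qed

lemma mgf_coeff_pair:
  assumes "c > 0" "\<alpha> > 0" "\<alpha> \<le> 1" and t: "t 0 = 0" "0 < t 1" "t 1 < t 2"
  shows "mgf_coeff c \<alpha> lam t {1..2} (\<lambda>_. 1) =
    c * (LBINT x\<^sub>2:{t 1 / t 2..1}. LBINT x\<^sub>1:{0..t 1 / t 2}.
           (x\<^sub>2 - x\<^sub>1) powr (\<alpha> - 1) * exp (- lam * t 2 * (x\<^sub>2 - x\<^sub>1)))"
proof -
  define r where "r = t 1 / t 2"
  have r: "0 < r" "r < 1" using t by (auto simp: r_def)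
  define H where "H x y = c * ((x - y) powr (\<alpha> - 1) * exp (- lam * t 2 * (x - y)))" for x y
  have H: "H x y \<ge> 0" for x y using assms(1) by (simp add: H_def)
  define F where "F x y = of_bool (r < x \<and> x < 1 \<and> 0 < y \<and> y < r) * H x y" for x y
  have Hm: "(\<lambda>p. H (fst p) (snd p)) \<in> borel_measurable (borel \<Otimes>\<^sub>M borel)" unfolding H_def by measurable
  then have Fm [measurable]: "(\<lambda>p. F (fst p) (snd p)) \<in> borel_measurable (borel \<Otimes>\<^sub>M borel)"
    unfolding F_def by measurable
  have id: "strict_mono_on {1..2::nat} id" by (simp add: strict_mono_on_def)
  \<comment> \<open>Writing the index set as \<open>{2, 1}\<close> makes the second coordinate the
    outer variable of the iterated integral.\<close>
  have two: "{1..2::nat} = {2, 1}" "{2..2::nat} = {2}" by auto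
  have empty: "{i \<in> {1..2::nat}. (1::nat) \<ge> 2} = {}" by auto
  interpret X: sigma_finite_measure "PiM {1..2} (\<lambda>_::nat. lborel :: real measure)"
    by (rule lborel_product.sigma_finite) simp
  have "mgf_coeff c \<alpha> lam t (id ` {1..2}) (\<lambda>_. 1) =
    enn2real (\<integral>\<^sup>+p. ennreal ((\<Prod>i=1..2. cell c \<alpha> 1 (t (id i - 1) / t (id 2)) (t (id i) / t (id 2)) (fst p i) (snd p i)) *
      link c \<alpha> lam (t (id 2)) 2 (\<lambda>_. 1) p) \<partial>block_space 2 (\<lambda>_. 1))"
    by (intro mgf_coeff_eq_nn_integral assms(1,2) id) auto
  also have "(\<lambda>p. (\<Prod>i=1..2. cell c \<alpha> 1 (t (id i - 1) / t (id 2)) (t (id i) / t (id 2)) (fst p i) (snd p i)) *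
      link c \<alpha> lam (t (id 2)) 2 (\<lambda>_. 1) p) = (\<lambda>p. F (snd p 2) (snd p 1))"
  proof -
    have "(\<Prod>i=1..2. g i) = g 2 * g 1" for g :: "nat \<Rightarrow> real" unfolding two by simp
    note this[unfolded One_nat_def, simp]
    show ?thesis
      using t by (auto simp: two F_def H_def cell_def link_def block_start_def r_def of_bool_conj mult_ac)
  qed
  also have "(\<integral>\<^sup>+p. ennreal (F (snd p 2) (snd p 1)) \<partial>block_space 2 (\<lambda>_. 1)) =
      (\<integral>\<^sup>+x'. \<integral>\<^sup>+x. ennreal (F (x 2) (x 1)) \<partial>PiM {1..2::nat} (\<lambda>_. lborel) \<partial>PiM ({} :: nat set) (\<lambda>_. lborel :: real measure))"
  proof -
    have "(\<lambda>p. (snd p 2, snd p 1)) \<in> block_space 2 (\<lambda>_. 1) \<rightarrow>\<^sub>M borel \<Otimes>\<^sub>M borel"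
      by (intro measurable_Pair coordinate_measurable) auto
    from measurable_compose[OF this Fm]
    have "(\<lambda>p. ennreal (F (snd p 2) (snd p 1))) \<in> borel_measurable (block_space 2 (\<lambda>_. 1))"
      by (intro measurable_compose[OF _ measurable_ennreal]) simp
    from X.nn_integral_fst[OF this] show ?thesis unfolding empty by simp
  qed
  \<comment> \<open>Both exponents are 1, so there are no x'-coordinates and the first factor is the
    one-point product over the empty index set.\<close>
  also have "\<dots> = (\<integral>\<^sup>+x. ennreal (F (x 2) (x 1)) \<partial>PiM {1..2::nat} (\<lambda>_. lborel))"
    by (simp add: PiM_empty nn_integral_count_space_finite)
  also have "\<dots> = (\<integral>\<^sup>+z. ennreal (F (fst z) (snd z)) \<partial>(lborel \<Otimes>\<^sub>M lborel))"
    unfolding two by (rule lborel_product.product_nn_integral_pair) (auto simp: case_prod_beta')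
  also have "\<dots> = (\<integral>\<^sup>+x. \<integral>\<^sup>+y. ennreal (F x y) \<partial>lborel \<partial>lborel)"
    using lborel.nn_integral_fst[of "\<lambda>z. ennreal (F (fst z) (snd z))" lborel] by simp
  also have "enn2real \<dots> = (LBINT x:{r..1}. LBINT y:{0..r}. H x y)"
    unfolding F_def
  proof (rule rectangle_LBINT[OF Hm H])
    fix x :: real assume x: "r < x" "x < 1"
    \<comment> \<open>For fixed \<open>x > r\<close> the distance \<open>x - y\<close> stays above
      \<open>x - r\<close>. The bound may depend on \<open>x\<close>, since only the inner integral
      has to be finite.\<close>
    define B where "B = c * ((x - r) powr (\<alpha> - 1) * exp \<bar>lam * t 2\<bar>)"
    have "(\<integral>\<^sup>+y. ennreal (of_bool (0 < y \<and> y < r) * H x y) \<partial>lborel) \<le> (\<integral>\<^sup>+y. ennreal B * indicator {0..r} y \<partial>lborel)"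
    proof (rule nn_integral_mono)
      fix y :: real
      have "H x y \<le> B" if y: "0 < y" "y < r"
      proof -
        have "(x - y) powr (\<alpha> - 1) \<le> (x - r) powr (\<alpha> - 1)" using assms(3) x y by (intro powr_mono2') auto
        moreover have "exp (- lam * t 2 * (x - y)) \<le> exp \<bar>lam * t 2\<bar>"
        proof -
          have "- lam * t 2 * (x - y) \<le> \<bar>lam * t 2\<bar> * (x - y)" using x y by (intro mult_right_mono) auto
          also have "\<dots> \<le> \<bar>lam * t 2\<bar> * 1" using x y by (intro mult_left_mono) auto
          finally show ?thesis by simp
        qed
        ultimately show ?thesis unfolding H_def B_def using assms(1) by (intro mult_left_mono mult_mono) auto
      qed
      then show "ennreal (of_bool (0 < y \<and> y < r) * H x y) \<le> ennreal B * indicator {0..r} y"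
        by (auto simp: indicator_def intro!: ennreal_leI)
    qed
    also have "\<dots> = ennreal B * ennreal r" using r by (simp add: nn_integral_cmult)
    also have "\<dots> < \<infinity>" by (simp add: ennreal_mult_less_top)
    finally show "(\<integral>\<^sup>+y. ennreal (of_bool (0 < y \<and> y < r) * H x y) \<partial>lborel) < \<infinity>" .
  qed
  also have "\<dots> = c * (LBINT x:{r..1}. LBINT y:{0..r}. (x - y) powr (\<alpha> - 1) * exp (- lam * t 2 * (x - y)))"
    unfolding H_def by simp
  finally show ?thesis unfolding r_def by simp
qed

section \<open>Exact moments of the process and of its increments\<close>

lemma limit_process_basics:
  assumes "is_limit_process c \<alpha> lam b T M X"
  shows "prob_space M" and "\<And>u. 0 \<le> u \<Longrightarrow> u \<le> T \<Longrightarrow> X u \<in> borel_measurable M"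
    and "AE \<omega> in M. X 0 \<omega> = 0"
  using assms by (auto simp: is_limit_process_def)

lemma single_moment:
  fixes k :: nat
  assumes P: "is_limit_process c \<alpha> lam b T M X" and t: "0 < t" "t \<le> T" and k: "k \<ge> 1"
  shows "integrable M (\<lambda>\<omega>. X t \<omega> ^ k)"
    and "(\<integral>\<omega>. X t \<omega> ^ k \<partial>M) = fact k * (rate_const c \<alpha> lam b T *
      (t powr (\<alpha> * (real k - 1) + 1) * mgf_coeff c \<alpha> lam (\<lambda>i. if i = 0 then 0 else t) {1} (\<lambda>_. k)))"
proof -
  \<comment> \<open>The grid consists of one interval from 0 to \<open>t\<close>; its increment is
    \<open>X t\<close> almost surely, because \<open>X 0\<close> vanishes almost surely.\<close>
  define g where "g i = (if i = 0 then 0 else t)" for i :: nat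
  have id: "strict_mono_on {1..1::nat} id" by (simp add: strict_mono_on_def)
  note [measurable] = limit_process_basics(2)[OF P]
  have [measurable]: "X t \<in> borel_measurable M" "X 0 \<in> borel_measurable M" using t by auto
  have ae: "AE \<omega> in M. (X t \<omega> - X 0 \<omega>) ^ k = X t \<omega> ^ k"
    using limit_process_basics(3)[OF P] by eventually_elim simp
  have grid: "g (i - 1) < g i" if "i \<in> {1..1}" for i using that t by (simp add: g_def)
  have "integrable M (\<lambda>\<omega>. \<Prod>i=1..1. (X (g (id i)) \<omega> - X (g (id i - 1)) \<omega>) ^ k)"
    "(\<integral>\<omega>. (\<Prod>i=1..1. (X (g (id i)) \<omega> - X (g (id i - 1)) \<omega>) ^ k) \<partial>M) =
      (\<Prod>i=1..1::nat. fact k) * (rate_const c \<alpha> lam b T *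
        (g (id 1) powr (\<alpha> * (real (\<Sum>i=1..1::nat. k) - 1) + 1) * mgf_coeff c \<alpha> lam g (id ` {1..1}) (\<lambda>_. k)))"
    by (rule increment_moment[where m = 1 and q = 1 and t = g and f = id, OF P];
        (rule grid, assumption)?; use id t k in \<open>simp add: g_def\<close>)+
  then have int: "integrable M (\<lambda>\<omega>. (X t \<omega> - X 0 \<omega>) ^ k)"
    and eq: "(\<integral>\<omega>. (X t \<omega> - X 0 \<omega>) ^ k \<partial>M) = fact k * (rate_const c \<alpha> lam b T *
        (t powr (\<alpha> * (real k - 1) + 1) * mgf_coeff c \<alpha> lam g {1} (\<lambda>_. k)))"
    by (simp_all add: g_def)
  show "integrable M (\<lambda>\<omega>. X t \<omega> ^ k)"
    by (rule integrable_cong_AE_imp[OF int _ ae]) measurable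
  have "(\<integral>\<omega>. X t \<omega> ^ k \<partial>M) = (\<integral>\<omega>. (X t \<omega> - X 0 \<omega>) ^ k \<partial>M)"
    by (rule integral_cong_AE[OF _ _ ae, symmetric]) measurable
  then show "(\<integral>\<omega>. X t \<omega> ^ k \<partial>M) = fact k * (rate_const c \<alpha> lam b T *
      (t powr (\<alpha> * (real k - 1) + 1) * mgf_coeff c \<alpha> lam (\<lambda>i. if i = 0 then 0 else t) {1} (\<lambda>_. k)))"
    unfolding eq g_def[abs_def] .
qed

lemma first_moment:
  assumes P: "is_limit_process c \<alpha> lam b T M X" and t: "0 < t" "t \<le> T" and c: "c > 0" and \<alpha>: "\<alpha> > 0"
  shows "integrable M (X t)" and "(\<integral>\<omega>. X t \<omega> \<partial>M) = t * rate_const c \<alpha> lam b T"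
  using single_moment[OF P t, of 1] mgf_coeff_single_one[OF c \<alpha>, of "\<lambda>i. if i = 0 then 0 else t" lam] t by simp_all

lemma higher_moment:
  assumes P: "is_limit_process c \<alpha> lam b T M X" and t: "0 < t" "t \<le> T" and c: "c > 0" and \<alpha>: "\<alpha> > 0"
    and k: "k \<ge> 2"
  shows "(\<integral>\<omega>. X t \<omega> ^ k \<partial>M) = t powr (\<alpha> * real (k - 1) + 1) *
    (rate_const c \<alpha> lam b T * fact k * (c * Gamma \<alpha>) ^ (k - 1) / Gamma (real (k - 1) * \<alpha>)) *
    (LBINT x:{0..1}. LBINT y:{0..x}. exp (- lam * t * y) * y powr (\<alpha> * real (k - 1) - 1))"
proof -
  have "real k - 1 = real (k - 1)" using k by simp
  then show ?thesis
    using single_moment(2)[OF P t, of k] mgf_coeff_single_many[OF c \<alpha>, of "\<lambda>i. if i = 0 then 0 else t" k lam] t k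
    by (simp add: mult_ac)
qed

lemma product_moment:
  assumes P: "is_limit_process c \<alpha> lam b T M X" and t: "0 < t" "t < s" "s \<le> T"
    and c: "c > 0" and \<alpha>: "\<alpha> > 0" "\<alpha> \<le> 1"
  shows "integrable M (\<lambda>\<omega>. X t \<omega> * X s \<omega>)"
    and "(\<integral>\<omega>. X t \<omega> * X s \<omega> \<partial>M) =
      s powr (\<alpha> + 1) * c * rate_const c \<alpha> lam b T *
        (LBINT x\<^sub>2:{t/s..1}. LBINT x\<^sub>1:{0..t/s}. (x\<^sub>2 - x\<^sub>1) powr (\<alpha> - 1) * exp (- lam * s * (x\<^sub>2 - x\<^sub>1))) +
      t powr (\<alpha> + 1) * 2 * c * rate_const c \<alpha> lam b T *
        (LBINT x:{0..1}. LBINT y:{0..x}. exp (- lam * t * y) * y powr (\<alpha> - 1))"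
proof -
  define g where "g i = (if i = 0 then 0 else if i = 1 then t else s)" for i :: nat
  have id: "strict_mono_on {1..2::nat} id" by (simp add: strict_mono_on_def)
  have [measurable]: "X t \<in> borel_measurable M" "X s \<in> borel_measurable M" "X 0 \<in> borel_measurable M"
    using t by (auto intro!: limit_process_basics(2)[OF P])
  have grid: "g (i - 1) < g i" if "i \<in> {1..2}" for i
  proof -
    have "i = 1 \<or> i = 2" using that by auto
    then show ?thesis using t by (auto simp: g_def)
  qed
  have two: "(\<Prod>i=1..2. y i) = y 1 * y 2" for y :: "nat \<Rightarrow> real"
    by (simp add: numeral_2_eq_2)
  have sums: "(\<Sum>i=1..2::nat. 1::nat) = 2" by simp
  have "integrable M (\<lambda>\<omega>. \<Prod>i=1..2. (X (g (id i)) \<omega> - X (g (id i - 1)) \<omega>) ^ 1)"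
    "(\<integral>\<omega>. (\<Prod>i=1..2. (X (g (id i)) \<omega> - X (g (id i - 1)) \<omega>) ^ 1) \<partial>M) =
      (\<Prod>i=1..2::nat. fact 1) * (rate_const c \<alpha> lam b T *
        (g (id 2) powr (\<alpha> * (real (\<Sum>i=1..2::nat. 1) - 1) + 1) * mgf_coeff c \<alpha> lam g (id ` {1..2}) (\<lambda>_. 1)))"
    by (rule increment_moment[where m = 2 and q = 2 and t = g and f = id, OF P];
        (rule grid, assumption)?; use id t in \<open>simp add: g_def\<close>)+
  then have int: "integrable M (\<lambda>\<omega>. (X t \<omega> - X 0 \<omega>) * (X s \<omega> - X t \<omega>))"
    and eq: "(\<integral>\<omega>. (X t \<omega> - X 0 \<omega>) * (X s \<omega> - X t \<omega>) \<partial>M) =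
      rate_const c \<alpha> lam b T * (s powr (\<alpha> + 1) * mgf_coeff c \<alpha> lam g {1..2} (\<lambda>_. 1))"
    unfolding two sums by (simp_all add: g_def)
  have ae: "AE \<omega> in M. (X t \<omega> - X 0 \<omega>) * (X s \<omega> - X t \<omega>) + X t \<omega> ^ 2 = X t \<omega> * X s \<omega>"
    using limit_process_basics(3)[OF P] by eventually_elim (simp add: power2_eq_square algebra_simps)
  have sq: "integrable M (\<lambda>\<omega>. X t \<omega> ^ 2)" using t by (intro single_moment(1)[OF P]) auto
  show "integrable M (\<lambda>\<omega>. X t \<omega> * X s \<omega>)"
    by (rule integrable_cong_AE_imp[OF Bochner_Integration.integrable_add[OF int sq] _ ae]) measurable
  have "(\<integral>\<omega>. X t \<omega> * X s \<omega> \<partial>M) = (\<integral>\<omega>. (X t \<omega> - X 0 \<omega>) * (X s \<omega> - X t \<omega>) + X t \<omega> ^ 2 \<partial>M)"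
    by (rule integral_cong_AE[OF _ _ ae, symmetric]) measurable
  also have "\<dots> = rate_const c \<alpha> lam b T * (s powr (\<alpha> + 1) * mgf_coeff c \<alpha> lam g {1..2} (\<lambda>_. 1)) +
      (\<integral>\<omega>. X t \<omega> ^ 2 \<partial>M)"
    using int sq by (simp add: eq)
  also have "mgf_coeff c \<alpha> lam g {1..2} (\<lambda>_. 1) = c * (LBINT x\<^sub>2:{t/s..1}. LBINT x\<^sub>1:{0..t/s}.
      (x\<^sub>2 - x\<^sub>1) powr (\<alpha> - 1) * exp (- lam * s * (x\<^sub>2 - x\<^sub>1)))"
    using mgf_coeff_pair[OF c \<alpha>, of g lam] t by (simp add: g_def)
  \<comment> \<open>For the second moment the factor \<open>Gamma \<alpha>\<close> in \<nu> cancels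
    the Gamma value in the denominator.\<close>
  also have "(\<integral>\<omega>. X t \<omega> ^ 2 \<partial>M) = t powr (\<alpha> + 1) * 2 * c * rate_const c \<alpha> lam b T *
        (LBINT x:{0..1}. LBINT y:{0..x}. exp (- lam * t * y) * y powr (\<alpha> - 1))"
    using higher_moment[OF P t(1) _ c \<alpha>(1), of 2] t Gamma_real_pos[OF \<alpha>(1)] by simp
  finally show "(\<integral>\<omega>. X t \<omega> * X s \<omega> \<partial>M) =
      s powr (\<alpha> + 1) * c * rate_const c \<alpha> lam b T *
        (LBINT x\<^sub>2:{t/s..1}. LBINT x\<^sub>1:{0..t/s}. (x\<^sub>2 - x\<^sub>1) powr (\<alpha> - 1) * exp (- lam * s * (x\<^sub>2 - x\<^sub>1))) +
      t powr (\<alpha> + 1) * 2 * c * rate_const c \<alpha> lam b T *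
        (LBINT x:{0..1}. LBINT y:{0..x}. exp (- lam * t * y) * y powr (\<alpha> - 1))"
    by simp
qed

lemma cov_eq:
  assumes "prob_space M" "integrable M Y" "integrable M Z" "integrable M (\<lambda>\<omega>. Y \<omega> * Z \<omega>)"
  shows "cov M Y Z = (\<integral>\<omega>. Y \<omega> * Z \<omega> \<partial>M) - (\<integral>\<omega>. Y \<omega> \<partial>M) * (\<integral>\<omega>. Z \<omega> \<partial>M)"
proof -
  interpret prob_space M by (rule assms(1))
  define y z where "y = (\<integral>\<omega>. Y \<omega> \<partial>M)" and "z = (\<integral>\<omega>. Z \<omega> \<partial>M)"
  have "(Y \<omega> - y) * (Z \<omega> - z) = Y \<omega> * Z \<omega> - z * Y \<omega> - y * Z \<omega> + y * z" for \<omega>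
    by (simp add: algebra_simps)
  then have "cov M Y Z = (\<integral>\<omega>. Y \<omega> * Z \<omega> - z * Y \<omega> - y * Z \<omega> + y * z \<partial>M)"
    by (simp add: cov_def y_def z_def)
  also have "\<dots> = (\<integral>\<omega>. Y \<omega> * Z \<omega> \<partial>M) - z * y - y * z + y * z"
    using assms by (simp add: y_def z_def prob_space)
  finally show ?thesis by (simp add: y_def z_def)
qed

text \<open>An exact value, not just an asymptotic one, so the product of the means in a covariance
  is exactly d^2 a_T^2.\<close>

lemma backward_incr_first_moment:
  assumes P: "is_limit_process c \<alpha> lam b T M X" and s: "0 < d" "d < s" "s \<le> T" and c: "c > 0" and \<alpha>: "\<alpha> > 0"
  shows "integrable M (backward_incr X d s)"
    and "(\<integral>\<omega>. backward_incr X d s \<omega> \<partial>M) = d * rate_const c \<alpha> lam b T"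
  using first_moment[OF P _ _ c \<alpha>, of s] first_moment[OF P _ _ c \<alpha>, of "s - d"] s
  by (simp_all add: backward_incr_def[abs_def] algebra_simps)

subsection \<open>Covariances and correlations of short increments\<close>

text \<open>Logarithms are compared. The tangent bound ln x \<le> x - 1 at x = t/T makes the
  logarithmic term linear in T - t, and the hypothesis on \<open>lam\<close> is a strict inequality
  between the corresponding slopes.\<close>

lemma decay_strict_antimono:
  fixes lam \<alpha> t T :: real
  assumes "0 < t" "t < T" "lam > (\<alpha> - 1) / T" "\<alpha> \<le> 1"
  shows "exp (- lam * T) * T powr (\<alpha> - 1) < exp (- lam * t) * t powr (\<alpha> - 1)"
proof -
  have T: "T > 0" using assms by simp
  have "ln (t / T) \<le> t / T - 1" using assms T by (intro ln_le_minus_one) simp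
  then have "ln t - ln T \<le> (t - T) / T" using assms T by (simp add: ln_div diff_divide_distrib)
  then have "(1 - \<alpha>) * (ln t - ln T) \<le> (1 - \<alpha>) * ((t - T) / T)" using assms by (intro mult_left_mono) auto
  moreover have "(\<alpha> - 1) / T * (T - t) < lam * (T - t)"
    using assms by (intro mult_strict_right_mono) auto
  moreover have "(\<alpha> - 1) / T * (T - t) = (1 - \<alpha>) * ((t - T) / T)" by (simp add: divide_simps) (simp add: algebra_simps)
  ultimately have "- lam * T + (\<alpha> - 1) * ln T < - lam * t + (\<alpha> - 1) * ln t"
    by (simp add: algebra_simps)
  then have "exp (- lam * T + (\<alpha> - 1) * ln T) < exp (- lam * t + (\<alpha> - 1) * ln t)" by simp
  then show ?thesis unfolding exp_add using assms T by (simp add: powr_def)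
qed

lemma incr_scale_one: "incr_scale c \<alpha> a 1 k d = fact (k 1) * (a * (cell_const c \<alpha> (k 1) * d powr (\<alpha> * real (k 1 - 1) + 1)))"
  by (simp add: incr_scale_def)

text \<open>A single increment has no coupling to others: the limit is \<open>exp 0\<close> times an
  empty product.\<close>

lemma backward_incr_power_asymp:
  assumes P: "is_limit_process c \<alpha> lam b T M X"
    and c: "c > 0" and \<alpha>: "0 < \<alpha>" "\<alpha> \<le> 1" and b: "b > 0" and s: "0 < s" "s \<le> T" and k: "k \<ge> 1"
  shows "((\<lambda>d. (\<integral>\<omega>. backward_incr X d s \<omega> ^ k \<partial>M) / incr_scale c \<alpha> (rate_const c \<alpha> lam b T) 1 (\<lambda>_. k) d) \<longlongrightarrow> 1) (at_right 0)"
  using backward_incr_moment_asymp[OF P c \<alpha> b, of "\<lambda>_. s" 1 "\<lambda>_. k"] s k by simp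

lemma backward_incr_pair_asymp:
  assumes P: "is_limit_process c \<alpha> lam b T M X"
    and c: "c > 0" and \<alpha>: "0 < \<alpha>" "\<alpha> \<le> 1" and b: "b > 0" and s: "0 < s" "0 < t" "s + t \<le> T"
  shows "((\<lambda>d. (\<integral>\<omega>. backward_incr X d s \<omega> * backward_incr X d (s + t) \<omega> \<partial>M) / (rate_const c \<alpha> lam b T * d\<^sup>2))
      \<longlongrightarrow> c * (exp (- lam * t) * t powr (\<alpha> - 1))) (at_right 0)"
proof -
  define u where "u i = (if i = 1 then s else s + t)" for i :: nat
  have two: "(\<Prod>i=1..2. y i) = y 1 * y 2" for y :: "nat \<Rightarrow> real" by (simp add: numeral_2_eq_2)
  have "((\<lambda>d. (\<integral>\<omega>. (\<Prod>i=1..2. backward_incr X d (u i) \<omega> ^ 1) \<partial>M) /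
        incr_scale c \<alpha> (rate_const c \<alpha> lam b T) 2 (\<lambda>_. 1) d)
      \<longlongrightarrow> exp (- lam * (u 2 - u 1)) * (\<Prod>i=2..2. c * (u i - u (i - 1)) powr (\<alpha> - 1))) (at_right 0)"
    using s by (intro backward_incr_moment_asymp[OF P c \<alpha> b]) (auto simp: u_def)
  then have "((\<lambda>d. (\<integral>\<omega>. backward_incr X d s \<omega> * backward_incr X d (s + t) \<omega> \<partial>M) /
        incr_scale c \<alpha> (rate_const c \<alpha> lam b T) 2 (\<lambda>_. 1) d)
      \<longlongrightarrow> c * (exp (- lam * t) * t powr (\<alpha> - 1))) (at_right 0)"
    unfolding two by (simp add: u_def mult_ac)
  \<comment> \<open>With both exponents 1 the cell constants are 1 and each cell contributes
    \<open>d powr 1\<close>, which is \<open>d\<close> for positive \<open>d\<close>.\<close>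
  moreover have "eventually (\<lambda>d. incr_scale c \<alpha> (rate_const c \<alpha> lam b T) 2 (\<lambda>_. 1) d = rate_const c \<alpha> lam b T * d\<^sup>2) (at_right 0)"
    using eventually_at_right_less[of "0::real"]
  proof eventually_elim
    case (elim d)
    then show ?case unfolding incr_scale_def two by (simp add: cell_const_def power2_eq_square)
  qed
  then have "eventually (\<lambda>d. (\<integral>\<omega>. backward_incr X d s \<omega> * backward_incr X d (s + t) \<omega> \<partial>M) /
        incr_scale c \<alpha> (rate_const c \<alpha> lam b T) 2 (\<lambda>_. 1) d =
      (\<integral>\<omega>. backward_incr X d s \<omega> * backward_incr X d (s + t) \<omega> \<partial>M) / (rate_const c \<alpha> lam b T * d\<^sup>2)) (at_right 0)"
    by eventually_elim simp
  ultimately show ?thesis by (rule Lim_transform_eventually)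
qed

lemma backward_incr_cov:
  assumes P: "is_limit_process c \<alpha> lam b T M X"
    and c: "c > 0" and \<alpha>: "0 < \<alpha>" "\<alpha> \<le> 1" and b: "b > 0" and s: "0 < s" "0 < t" "s + t \<le> T"
  shows "eventually (\<lambda>d. cov M (backward_incr X d s) (backward_incr X d (s + t)) =
    (\<integral>\<omega>. backward_incr X d s \<omega> * backward_incr X d (s + t) \<omega> \<partial>M) - d\<^sup>2 * (rate_const c \<alpha> lam b T)\<^sup>2) (at_right 0)"
proof -
  define u where "u i = (if i = 1 then s else s + t)" for i :: nat
  have two: "(\<Prod>i=1..2. y i) = y 1 * y 2" for y :: "nat \<Rightarrow> real" by (simp add: numeral_2_eq_2)
  have "eventually (\<lambda>d. d > 0 \<and> d < u 1 \<and> (\<forall>i\<in>{2..2}. u (i - 1) + d < u i)) (at_right 0)"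
    using s by (intro eventually_small_increment) (auto simp: u_def)
  then show ?thesis
  proof eventually_elim
    case (elim d)
    then have d: "d > 0" "d < s" "s + d < s + t" by (auto simp: u_def)
    have "integrable M (\<lambda>\<omega>. \<Prod>i=1..2. backward_incr X d (u i) \<omega> ^ 1)"
      using s d by (intro backward_incr_moment_bounds(1)[OF P c \<alpha> b]) (auto simp: u_def)
    then have "integrable M (\<lambda>\<omega>. backward_incr X d s \<omega> * backward_incr X d (s + t) \<omega>)"
      unfolding two by (simp add: u_def)
    then show ?case
      using backward_incr_first_moment[OF P d(1) _ _ c \<alpha>(1), of s] backward_incr_first_moment[OF P d(1) _ _ c \<alpha>(1), of "s + t"] s d
      by (subst cov_eq[OF limit_process_basics(1)[OF P]]) (auto simp: power2_eq_square)
  qed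
qed

lemma backward_incr_var:
  assumes P: "is_limit_process c \<alpha> lam b T M X"
    and c: "c > 0" and \<alpha>: "0 < \<alpha>" "\<alpha> \<le> 1" and b: "b > 0" and s: "0 < s" "s \<le> T"
  shows "eventually (\<lambda>d. cov M (backward_incr X d s) (backward_incr X d s) =
    (\<integral>\<omega>. backward_incr X d s \<omega> ^ 2 \<partial>M) - d\<^sup>2 * (rate_const c \<alpha> lam b T)\<^sup>2) (at_right 0)"
proof -
  \<comment> \<open>The range \<open>{2..1}\<close> is empty, so a single increment asks for
    \<open>0 < d\<close> and \<open>d < s\<close> only.\<close>
  have "eventually (\<lambda>d. d > 0 \<and> d < s \<and> (\<forall>i\<in>{2..1::nat}. s + d < s)) (at_right 0)"
    using s by (intro eventually_small_increment[of "\<lambda>_. s" 1]) auto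
  then show ?thesis
  proof eventually_elim
    case (elim d)
    then have d: "d > 0" "d < s" by auto
    have "integrable M (\<lambda>\<omega>. \<Prod>i=1..1::nat. backward_incr X d s \<omega> ^ 2)"
      using s d by (intro backward_incr_moment_bounds(1)[OF P c \<alpha> b, of _ "\<lambda>_. s"]) auto
    then have "integrable M (\<lambda>\<omega>. backward_incr X d s \<omega> * backward_incr X d s \<omega>)"
      by (simp add: power2_eq_square)
    then show ?case
      using backward_incr_first_moment[OF P d s(2) c \<alpha>(1)]
      by (subst cov_eq[OF limit_process_basics(1)[OF P]]) (auto simp: power2_eq_square)
  qed
qed

text \<open>With a = c h the rate, the second moment is asymptotic to a c d^2 times
  2/(\<alpha>(\<alpha>+1)) d^(\<alpha>-1), and the squared mean is a^2 d^2 = a c d^2 h. For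
  \<open>\<alpha> < 1\<close> the former dominates; for \<open>\<alpha> = 1\<close> both have order
  d^2, and \<open>h < 1\<close> keeps the difference positive.\<close>

lemma backward_incr_var_asymp:
  fixes h :: real
  assumes P: "is_limit_process c \<alpha> lam b T M X"
    and c: "c > 0" and \<alpha>: "0 < \<alpha>" "\<alpha> \<le> 1" and b: "b > 0" and s: "0 < s" "s \<le> T"
    and h: "rate_const c \<alpha> lam b T = c * h" "h > 0" "\<alpha> = 1 \<Longrightarrow> h < 1"
  defines "D \<equiv> \<lambda>d. 2 / (\<alpha> * (\<alpha> + 1)) * d powr (\<alpha> - 1) - h"
  shows "eventually (\<lambda>d. D d > 0) (at_right 0)"
    and "((\<lambda>d. cov M (backward_incr X d s) (backward_incr X d s) / (rate_const c \<alpha> lam b T * c * d\<^sup>2 * D d)) \<longlongrightarrow> 1) (at_right 0)"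
proof -
  define a where "a = rate_const c \<alpha> lam b T"
  define c'' where "c'' = 2 / (\<alpha> * (\<alpha> + 1))"
  \<comment> \<open>The limit of h d^(1-\<alpha>), the share of the squared mean once d^(\<alpha>-1)
    is factored out of \<open>D d\<close>.\<close>
  define \<eta> where "\<eta> = (if \<alpha> = 1 then h else 0)"
  have a: "a = c * h" "a > 0" using h c by (auto simp: a_def)
  have c'': "c'' > 0" "c'' - \<eta> > 0"
  proof -
    show "c'' > 0" using \<alpha> by (simp add: c''_def)
    then show "c'' - \<eta> > 0" using h(3) by (auto simp: \<eta>_def c''_def)
  qed
  have \<eta>: "((\<lambda>d. h * d powr (1 - \<alpha>)) \<longlongrightarrow> \<eta>) (at_right 0)"
  proof (cases "\<alpha> = 1")
    case True
    have "eventually (\<lambda>d::real. h = h * d powr (1 - \<alpha>)) (at_right 0)"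
      using eventually_at_right_less[of "0::real"] by eventually_elim (simp add: True)
    then show ?thesis
      by (rule Lim_transform_eventually[rotated]) (simp add: \<eta>_def True)
  next
    case False
    have "((\<lambda>d::real. d powr (1 - \<alpha>)) \<longlongrightarrow> 0) (at_right 0)"
      using \<alpha> False by real_asymp
    then show ?thesis using False by (auto simp: \<eta>_def intro: tendsto_mult_right_zero)
  qed
  have Dfac: "D d = d powr (\<alpha> - 1) * (c'' - h * d powr (1 - \<alpha>))" if "d > 0" for d
  proof -
    have "d powr (\<alpha> - 1) * d powr (1 - \<alpha>) = 1" using that by (simp flip: powr_add)
    then show ?thesis unfolding D_def c''_def by (simp add: right_diff_distrib mult.left_commute mult.commute)
  qed
  have den: "((\<lambda>d. c'' - h * d powr (1 - \<alpha>)) \<longlongrightarrow> c'' - \<eta>) (at_right 0)"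
    by (intro tendsto_diff tendsto_const \<eta>)
  have evden: "eventually (\<lambda>d. c'' - h * d powr (1 - \<alpha>) > 0) (at_right 0)"
    using order_tendstoD(1)[OF den c''(2)] .
  show evD: "eventually (\<lambda>d. D d > 0) (at_right 0)"
    using evden eventually_at_right_less[of "0::real"] by eventually_elim (simp add: Dfac)
  define R where "R d = (\<integral>\<omega>. backward_incr X d s \<omega> ^ 2 \<partial>M) / incr_scale c \<alpha> a 1 (\<lambda>_. 2) d" for d
  have R: "(R \<longlongrightarrow> 1) (at_right 0)"
    unfolding R_def a_def using backward_incr_power_asymp[OF P c \<alpha> b s, of 2] by simp
  \<comment> \<open>\<open>R\<close> multiplies only the second moment, so the convergence of the
    quotient needs the limit \<open>c'' - \<eta>\<close> of the denominator to be nonzero.\<close>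
  have "((\<lambda>d. (c'' * R d - h * d powr (1 - \<alpha>)) / (c'' - h * d powr (1 - \<alpha>))) \<longlongrightarrow> (c'' * 1 - \<eta>) / (c'' - \<eta>)) (at_right 0)"
    using c'' by (intro tendsto_divide tendsto_diff tendsto_mult tendsto_const R \<eta>) auto
  then have lim: "((\<lambda>d. (c'' * R d - h * d powr (1 - \<alpha>)) / (c'' - h * d powr (1 - \<alpha>))) \<longlongrightarrow> 1) (at_right 0)"
    using c'' by simp
  have "eventually (\<lambda>d. (c'' * R d - h * d powr (1 - \<alpha>)) / (c'' - h * d powr (1 - \<alpha>)) =
      cov M (backward_incr X d s) (backward_incr X d s) / (a * c * d\<^sup>2 * D d)) (at_right 0)"
    using backward_incr_var[OF P c \<alpha> b s] evden eventually_at_right_less[of "0::real"]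
  proof eventually_elim
    case (elim d)
    define y where "y = d powr (\<alpha> - 1)"
    define E where "E = (\<integral>\<omega>. backward_incr X d s \<omega> ^ 2 \<partial>M)"
    have y: "y > 0" "y * d powr (1 - \<alpha>) = 1" using elim by (auto simp: y_def simp flip: powr_add)
    have pw: "d powr (\<alpha> + 1) = d\<^sup>2 * y"
    proof -
      have "d powr (\<alpha> + 1) = d powr (2 + (\<alpha> - 1))" by (simp add: add.commute)
      also have "\<dots> = d powr 2 * y" unfolding y_def by (rule powr_add)
      finally show ?thesis using elim by simp
    qed
    have "cell_const c \<alpha> 2 = c / (\<alpha> * (\<alpha> + 1))"
      using Gamma_real_pos[OF \<alpha>(1)] by (simp add: cell_const_def)
    then have sc: "incr_scale c \<alpha> a 1 (\<lambda>_. 2) d = a * c * d\<^sup>2 * (c'' * y)"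
      unfolding incr_scale_one by (simp add: pw c''_def)
    have "a * c * d\<^sup>2 * (c'' * y) \<noteq> 0" using a c c'' y elim h(2) by simp
    then have ER: "E = a * c * d\<^sup>2 * (c'' * y) * R d"
      unfolding R_def sc E_def by simp
    have "cov M (backward_incr X d s) (backward_incr X d s) = E - d\<^sup>2 * a\<^sup>2"
      using elim by (simp add: E_def a_def)
    also have "\<dots> = a * c * d\<^sup>2 * (y * (c'' * R d - h * d powr (1 - \<alpha>)))"
    proof -
      have 1: "y * (c'' * R d - h * d powr (1 - \<alpha>)) = c'' * y * R d - h"
        using y(2) by (simp add: right_diff_distrib mult.left_commute mult.commute)
      have 2: "d\<^sup>2 * a\<^sup>2 = a * c * d\<^sup>2 * h"
        using a(1) by (simp add: power2_eq_square)
      show ?thesis unfolding ER 1 2 by (simp only: right_diff_distrib mult.assoc)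
    qed
    finally have cov: "cov M (backward_incr X d s) (backward_incr X d s) =
        (a * c * d\<^sup>2 * y) * (c'' * R d - h * d powr (1 - \<alpha>))" by simp
    have D: "a * c * d\<^sup>2 * D d = (a * c * d\<^sup>2 * y) * (c'' - h * d powr (1 - \<alpha>))"
      using Dfac[of d] elim by (simp add: y_def)
    have "a * c * d\<^sup>2 * y \<noteq> 0" using a c y elim h(2) by simp
    then show ?case unfolding cov D by simp
  qed
  from Lim_transform_eventually[OF lim this]
  show "((\<lambda>d. cov M (backward_incr X d s) (backward_incr X d s) / (rate_const c \<alpha> lam b T * c * d\<^sup>2 * D d)) \<longlongrightarrow> 1) (at_right 0)"
    by (simp add: a_def)
qed

text \<open>The covariance and both variances share the factor a c d^2, which cancels in the
  correlation. Strictness of \<open>h < g\<close> keeps the limiting covariance away from 0.\<close>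

lemma backward_incr_corr_asymp:
  fixes h g :: real
  assumes P: "is_limit_process c \<alpha> lam b T M X"
    and c: "c > 0" and \<alpha>: "0 < \<alpha>" "\<alpha> \<le> 1" and b: "b > 0" and s: "0 < s" "0 < t" "s + t \<le> T"
    and h: "rate_const c \<alpha> lam b T = c * h" "h > 0" "\<alpha> = 1 \<Longrightarrow> h < 1"
    and g: "g = exp (- lam * t) * t powr (\<alpha> - 1)" "h < g"
  shows "((\<lambda>d. (\<integral>\<omega>. backward_incr X d s \<omega> * backward_incr X d (s + t) \<omega> \<partial>M) /
            (rate_const c \<alpha> lam b T * c * d\<^sup>2 * g)) \<longlongrightarrow> 1) (at_right 0)"
    and "((\<lambda>d. cov M (backward_incr X d s) (backward_incr X d (s + t)) /
            (rate_const c \<alpha> lam b T * c * d\<^sup>2 * (g - h))) \<longlongrightarrow> 1) (at_right 0)"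
    and "((\<lambda>d. corr M (backward_incr X d s) (backward_incr X d (s + t)) /
            ((g - h) / (2 / (\<alpha> * (\<alpha> + 1)) * d powr (\<alpha> - 1) - h))) \<longlongrightarrow> 1) (at_right 0)"
proof -
  define a where "a = rate_const c \<alpha> lam b T"
  have a: "a = c * h" "a > 0" using h c by (auto simp: a_def)
  define D where "D d = 2 / (\<alpha> * (\<alpha> + 1)) * d powr (\<alpha> - 1) - h" for d
  define E where "E d = (\<integral>\<omega>. backward_incr X d s \<omega> * backward_incr X d (s + t) \<omega> \<partial>M)" for d
  define V where "V d u = cov M (backward_incr X d u) (backward_incr X d u)" for d u
  define C where "C d = cov M (backward_incr X d s) (backward_incr X d (s + t))" for d
  have pair: "((\<lambda>d. E d / (a * d\<^sup>2)) \<longlongrightarrow> c * g) (at_right 0)"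
    using backward_incr_pair_asymp[OF P c \<alpha> b s] unfolding E_def a_def g(1) .
  have "g > 0" using g(2) h(2) by simp
  then have "((\<lambda>d. E d / (a * d\<^sup>2) / (c * g)) \<longlongrightarrow> c * g / (c * g)) (at_right 0)"
    using c by (intro tendsto_divide pair tendsto_const) auto
  then have "((\<lambda>d. E d / (a * c * d\<^sup>2 * g)) \<longlongrightarrow> 1) (at_right 0)"
    using c \<open>g > 0\<close> by (simp add: mult_ac)
  then show "((\<lambda>d. (\<integral>\<omega>. backward_incr X d s \<omega> * backward_incr X d (s + t) \<omega> \<partial>M) /
            (rate_const c \<alpha> lam b T * c * d\<^sup>2 * g)) \<longlongrightarrow> 1) (at_right 0)"
    unfolding E_def a_def .
  \<comment> \<open>Divided by a d^2, the product of the means becomes the constant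
    \<open>a = c * h\<close>, of the same order as the mixed moment; hence the difference
    \<open>g - h\<close>.\<close>
  have "((\<lambda>d. (E d / (a * d\<^sup>2) - a) / (c * (g - h))) \<longlongrightarrow> (c * g - a) / (c * (g - h))) (at_right 0)"
    using c g(2) by (intro tendsto_divide tendsto_diff pair tendsto_const) auto
  moreover have "(c * g - a) / (c * (g - h)) = 1"
    using c g(2) by (simp add: a(1) right_diff_distrib[symmetric])
  ultimately have lim: "((\<lambda>d. (E d / (a * d\<^sup>2) - a) / (c * (g - h))) \<longlongrightarrow> 1) (at_right 0)" by simp
  have "eventually (\<lambda>d. (E d / (a * d\<^sup>2) - a) / (c * (g - h)) = C d / (a * c * d\<^sup>2 * (g - h))) (at_right 0)"
    using backward_incr_cov[OF P c \<alpha> b s] eventually_at_right_less[of "0::real"]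
  proof eventually_elim
    case (elim d)
    then have "C d = (a * d\<^sup>2) * (E d / (a * d\<^sup>2) - a)"
      using a(2) unfolding C_def E_def a_def[symmetric] by (simp add: right_diff_distrib power2_eq_square)
    moreover have "a * d\<^sup>2 \<noteq> 0" using c h(2) a(1) elim by simp
    moreover have "y / u = (w * y) / (w * u)" if "w \<noteq> 0" for y u w :: real using that by simp
    ultimately have "(E d / (a * d\<^sup>2) - a) / (c * (g - h)) = C d / ((a * d\<^sup>2) * (c * (g - h)))"
      by metis
    then show ?case by (simp add: mult_ac)
  qed
  from Lim_transform_eventually[OF lim this]
  have C: "((\<lambda>d. C d / (a * c * d\<^sup>2 * (g - h))) \<longlongrightarrow> 1) (at_right 0)" .
  then show "((\<lambda>d. cov M (backward_incr X d s) (backward_incr X d (s + t)) /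
            (rate_const c \<alpha> lam b T * c * d\<^sup>2 * (g - h))) \<longlongrightarrow> 1) (at_right 0)"
    unfolding C_def a_def .
  have var: "((\<lambda>d. V d u / (a * c * d\<^sup>2 * D d)) \<longlongrightarrow> 1) (at_right 0)" if "0 < u" "u \<le> T" for u
    unfolding V_def D_def a_def by (rule backward_incr_var_asymp(2)[OF P c \<alpha> b that h])
  have posD: "eventually (\<lambda>d. D d > 0) (at_right 0)"
    unfolding D_def by (rule backward_incr_var_asymp(1)[OF P c \<alpha> b s(1) _ h]) (use s in auto)
  have "((\<lambda>d. sqrt (V d s / (a * c * d\<^sup>2 * D d) * (V d (s + t) / (a * c * d\<^sup>2 * D d)))) \<longlongrightarrow> sqrt (1 * 1)) (at_right 0)"
    using s by (intro tendsto_real_sqrt tendsto_mult var) auto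
  then have "((\<lambda>d. C d / (a * c * d\<^sup>2 * (g - h)) /
      sqrt (V d s / (a * c * d\<^sup>2 * D d) * (V d (s + t) / (a * c * d\<^sup>2 * D d)))) \<longlongrightarrow> 1 / sqrt (1 * 1)) (at_right 0)"
    by (intro tendsto_divide C) auto
  then have lim: "((\<lambda>d. C d / (a * c * d\<^sup>2 * (g - h)) /
      sqrt (V d s / (a * c * d\<^sup>2 * D d) * (V d (s + t) / (a * c * d\<^sup>2 * D d)))) \<longlongrightarrow> 1) (at_right 0)" by simp
  have "eventually (\<lambda>d. C d / (a * c * d\<^sup>2 * (g - h)) /
        sqrt (V d s / (a * c * d\<^sup>2 * D d) * (V d (s + t) / (a * c * d\<^sup>2 * D d))) =
      corr M (backward_incr X d s) (backward_incr X d (s + t)) / ((g - h) / D d)) (at_right 0)"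
    using posD eventually_at_right_less[of "0::real"]
  proof eventually_elim
    case (elim d)
    define w where "w = a * c * d\<^sup>2"
    have w: "w > 0" using a c elim by (simp add: w_def)
    have D: "D d > 0" using elim by simp
    have "sqrt (V d s / (w * D d) * (V d (s + t) / (w * D d))) = sqrt (V d s * V d (s + t) / (w * D d)\<^sup>2)"
      by (simp add: power2_eq_square)
    also have "\<dots> = sqrt (V d s * V d (s + t)) / (w * D d)"
      using w D by (simp add: real_sqrt_divide)
    finally have sq: "sqrt (V d s / (w * D d) * (V d (s + t) / (w * D d))) = sqrt (V d s * V d (s + t)) / (w * D d)" .
    have "x / (w * y) / (q / (w * z)) = x / q / (y / z)" for x y q z
      using w by (simp add: field_simps)
    from this[of "C d" "g - h" _ "D d"] show ?case
      unfolding w_def[symmetric] sq by (simp add: corr_def C_def V_def)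
  qed
  from Lim_transform_eventually[OF lim this]
  show "((\<lambda>d. corr M (backward_incr X d s) (backward_incr X d (s + t)) /
            ((g - h) / (2 / (\<alpha> * (\<alpha> + 1)) * d powr (\<alpha> - 1) - h))) \<longlongrightarrow> 1) (at_right 0)"
    unfolding D_def .
qed

text \<open>Factorials, cell constants and powers of \<open>d\<close> cancel. The product of the
  \<open>m\<close> single moments contains the rate \<open>m\<close> times, the joint moment once,
  and each of its \<open>m - 1\<close> links supplies a factor \<open>c\<close>; this is the origin
  of the power of c / a_T.\<close>

lemma backward_incr_joint_moment_ratio:
  assumes P: "is_limit_process c \<alpha> lam b T M X"
    and c: "c > 0" and \<alpha>: "0 < \<alpha>" "\<alpha> \<le> 1" and b: "b > 0"
    and m: "m \<ge> 1" and t: "0 < t 1" "\<And>i. i \<in> {2..m} \<Longrightarrow> t (i - 1) < t i" "t m \<le> T"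
    and k: "\<And>i. i \<in> {1..m} \<Longrightarrow> k i \<ge> 1"
  shows "((\<lambda>d. (\<integral>\<omega>. (\<Prod>i=1..m. backward_incr X d (t i) \<omega> ^ k i) \<partial>M) /
            (\<Prod>i=1..m. \<integral>\<omega>. backward_incr X d (t i) \<omega> ^ k i \<partial>M))
         \<longlongrightarrow> exp (- lam * (t m - t 1)) * (c / rate_const c \<alpha> lam b T) ^ (m - 1) *
             (\<Prod>i=2..m. (t i - t (i - 1)) powr (\<alpha> - 1))) (at_right 0)"
proof -
  define a where "a = rate_const c \<alpha> lam b T"
  have range: "0 < t i" "t i \<le> T" if "i \<in> {1..m}" for i
  proof -
    have grid: "t i \<le> t j" if "1 \<le> i" "i \<le> j" "j \<le> m" for i j
      using that(2,3)
    proof (induction j rule: dec_induct)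
      case (step n)
      then show ?case using t(2)[of "Suc n"] that(1) by auto
    qed simp
    show "0 < t i" "t i \<le> T" using grid[of 1 i] grid[of i m] that t by auto
  qed
  then have "T > 0" using m by fastforce
  then have a: "a > 0" using c b by (simp add: a_def rate_const_def)
  define E where "E d = (\<integral>\<omega>. (\<Prod>i=1..m. backward_incr X d (t i) \<omega> ^ k i) \<partial>M)" for d
  define e where "e d i = (\<integral>\<omega>. backward_incr X d (t i) \<omega> ^ k i \<partial>M)" for d i
  define n where "n d i = incr_scale c \<alpha> a 1 (\<lambda>_. k i) d" for d i
  have n: "n d i > 0" if "d > 0" for d i
    using that a cell_const_pos[OF c \<alpha>(1)] unfolding n_def incr_scale_one by simp
  have prod_n: "(\<Prod>i=1..m. n d i) = incr_scale c \<alpha> a m k d * a ^ (m - 1)" for d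
  proof -
    obtain m' where "m = Suc m'" using m by (cases m) auto
    then have "a ^ m = a * a ^ (m - 1)" by simp
    then show ?thesis
      unfolding n_def incr_scale_one incr_scale_def by (simp add: prod.distrib mult_ac)
  qed
  have joint: "((\<lambda>d. E d / incr_scale c \<alpha> a m k d) \<longlongrightarrow>
      exp (- lam * (t m - t 1)) * (\<Prod>i=2..m. c * (t i - t (i - 1)) powr (\<alpha> - 1))) (at_right 0)"
    unfolding E_def a_def using t m k by (intro backward_incr_moment_asymp[OF P c \<alpha> b])
  have "((\<lambda>d. \<Prod>i=1..m. e d i / n d i) \<longlongrightarrow> (\<Prod>i=1..m. 1)) (at_right 0)"
    unfolding e_def n_def a_def using range k by (intro tendsto_prod backward_incr_power_asymp[OF P c \<alpha> b])
  then have "((\<lambda>d. E d / incr_scale c \<alpha> a m k d / (\<Prod>i=1..m. e d i / n d i) / a ^ (m - 1)) \<longlongrightarrow>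
      exp (- lam * (t m - t 1)) * (\<Prod>i=2..m. c * (t i - t (i - 1)) powr (\<alpha> - 1)) / 1 / a ^ (m - 1)) (at_right 0)"
    using a by (intro tendsto_divide joint tendsto_const) auto
  moreover have "exp (- lam * (t m - t 1)) * (\<Prod>i=2..m. c * (t i - t (i - 1)) powr (\<alpha> - 1)) / 1 / a ^ (m - 1) =
      exp (- lam * (t m - t 1)) * (c / a) ^ (m - 1) * (\<Prod>i=2..m. (t i - t (i - 1)) powr (\<alpha> - 1))"
    by (simp add: prod.distrib power_divide)
  ultimately have lim: "((\<lambda>d. E d / incr_scale c \<alpha> a m k d / (\<Prod>i=1..m. e d i / n d i) / a ^ (m - 1)) \<longlongrightarrow>
      exp (- lam * (t m - t 1)) * (c / a) ^ (m - 1) * (\<Prod>i=2..m. (t i - t (i - 1)) powr (\<alpha> - 1))) (at_right 0)"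
    by simp
  have "eventually (\<lambda>d. E d / incr_scale c \<alpha> a m k d / (\<Prod>i=1..m. e d i / n d i) / a ^ (m - 1) =
      E d / (\<Prod>i=1..m. e d i)) (at_right 0)"
    using eventually_at_right_less[of "0::real"]
  proof eventually_elim
    case (elim d)
    have "(\<Prod>i=1..m. n d i) > 0" using n[OF elim] by (intro prod_pos) auto
    then have "incr_scale c \<alpha> a m k d \<noteq> 0" "a ^ (m - 1) \<noteq> 0" unfolding prod_n using a by auto
    then have "y / incr_scale c \<alpha> a m k d / (z / (incr_scale c \<alpha> a m k d * a ^ (m - 1))) / a ^ (m - 1) = y / z" for y z
      by simp
    then show ?case unfolding prod_dividef prod_n .
  qed
  from Lim_transform_eventually[OF lim this]
  show ?thesis unfolding E_def e_def a_def .
qed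

theorem corollary3p2:
  fixes T b \<alpha> lam c a\<^sub>T \<nu> :: real
    and M :: "'a measure" and X :: "real \<Rightarrow> 'a \<Rightarrow> real"
  assumes "T > 0" and "0 < b" and "b \<le> 1" and "0 < \<alpha>" and "\<alpha> \<le> 1"
    and "lam > (\<alpha> - 1) / T" and "0 < c" and "c < 2 powr (\<alpha> - 1)"
    and "a\<^sub>T = c * b * exp (- lam * T) * T powr (\<alpha> - 1)"
    and "\<nu> = c * Gamma \<alpha>"
    and "is_limit_process c \<alpha> lam b T M X"
  shows
    "(\<forall>t. 0 < t \<and> t \<le> T \<longrightarrow>
        (\<integral>\<omega>. X t \<omega> \<partial>M) = t * a\<^sub>T \<and>
        (\<forall>k::nat. k \<ge> 2 \<longrightarrow>
          (\<integral>\<omega>. X t \<omega> ^ k \<partial>M) =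
            t powr (\<alpha> * real (k - 1) + 1) *
            (a\<^sub>T * fact k * \<nu> ^ (k - 1) / Gamma (real (k - 1) * \<alpha>)) *
            (LBINT x:{0..1}. LBINT y:{0..x}.
               exp (- lam * t * y) * y powr (\<alpha> * real (k - 1) - 1)))) \<and>
     (\<forall>t s. 0 < t \<and> t < s \<and> s \<le> T \<longrightarrow>
        (let R = s powr (\<alpha> + 1) * c * a\<^sub>T *
                   (LBINT x\<^sub>2:{t/s..1}. LBINT x\<^sub>1:{0..t/s}.
                      (x\<^sub>2 - x\<^sub>1) powr (\<alpha> - 1) * exp (- lam * s * (x\<^sub>2 - x\<^sub>1))) +
                 t powr (\<alpha> + 1) * 2 * c * a\<^sub>T *
                   (LBINT x:{0..1}. LBINT y:{0..x}. exp (- lam * t * y) * y powr (\<alpha> - 1))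
         in (\<integral>\<omega>. X t \<omega> * X s \<omega> \<partial>M) = R \<and>
            cov M (X t) (X s) = R - t * s * a\<^sub>T\<^sup>2)) \<and>
     (\<forall>s t. 0 < s \<and> 0 < t \<and> s + t \<le> T \<longrightarrow>
        (let c' = a\<^sub>T * c; c'' = 2 / (\<alpha> * (\<alpha> + 1));
             g = exp (- lam * t) * t powr (\<alpha> - 1);
             h = b * exp (- lam * T) * T powr (\<alpha> - 1)
         in ((\<lambda>\<Delta>. (\<integral>\<omega>. backward_incr X \<Delta> s \<omega> * backward_incr X \<Delta> (s + t) \<omega> \<partial>M) /
                  (c' * \<Delta>\<^sup>2 * g)) \<longlongrightarrow> 1) (at_right 0) \<and>
            ((\<lambda>\<Delta>. cov M (backward_incr X \<Delta> s) (backward_incr X \<Delta> (s + t)) /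
                  (c' * \<Delta>\<^sup>2 * (g - h))) \<longlongrightarrow> 1) (at_right 0) \<and>
            ((\<lambda>\<Delta>. corr M (backward_incr X \<Delta> s) (backward_incr X \<Delta> (s + t)) /
                  ((g - h) / (c'' * \<Delta> powr (\<alpha> - 1) - h))) \<longlongrightarrow> 1) (at_right 0))) \<and>
     (\<forall>(m::nat) (t :: nat \<Rightarrow> real) (k :: nat \<Rightarrow> nat).
        m \<ge> 1 \<and> 0 < t 1 \<and> (\<forall>i \<in> {2..m}. t (i - 1) < t i) \<and> t m \<le> T \<and>
        (\<forall>i \<in> {1..m}. k i \<ge> 1) \<longrightarrow>
        ((\<lambda>d. (\<integral>\<omega>. (\<Prod>i=1..m. backward_incr X d (t i) \<omega> ^ k i) \<partial>M) /
              (\<Prod>i=1..m. \<integral>\<omega>. backward_incr X d (t i) \<omega> ^ k i \<partial>M))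
           \<longlongrightarrow> exp (- lam * (t m - t 1)) * (c / a\<^sub>T) ^ (m - 1) *
               (\<Prod>i=2..m. (t i - t (i - 1)) powr (\<alpha> - 1))) (at_right 0))"
proof -
  note P = assms(11)
  have a: "a\<^sub>T = rate_const c \<alpha> lam b T" using assms(9) by (simp add: rate_const_def)
  define h where "h = b * exp (- lam * T) * T powr (\<alpha> - 1)"
  have h: "rate_const c \<alpha> lam b T = c * h" "h > 0"
    using assms by (auto simp: rate_const_def h_def)
  \<comment> \<open>For \<open>\<alpha> = 1\<close> the hypothesis on \<open>lam\<close> says
    \<open>lam > 0\<close>, and the power of \<open>T\<close> is 1.\<close>
  have h1: "h < 1" if "\<alpha> = 1"
  proof -
    have "exp (- lam * T) < 1" using assms(1,6) that by simp
    then have "b * exp (- lam * T) < 1 * 1"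
      using assms(2,3) by (intro mult_le_less_imp_less) auto
    then show ?thesis using that assms(1) by (simp add: h_def)
  qed
  have part1: "(\<integral>\<omega>. X t \<omega> \<partial>M) = t * a\<^sub>T \<and>
      (\<forall>k::nat. k \<ge> 2 \<longrightarrow> (\<integral>\<omega>. X t \<omega> ^ k \<partial>M) =
        t powr (\<alpha> * real (k - 1) + 1) * (a\<^sub>T * fact k * \<nu> ^ (k - 1) / Gamma (real (k - 1) * \<alpha>)) *
        (LBINT x:{0..1}. LBINT y:{0..x}. exp (- lam * t * y) * y powr (\<alpha> * real (k - 1) - 1)))"
    if "0 < t \<and> t \<le> T" for t
    using first_moment(2)[OF P _ _ assms(7,4), of t] higher_moment[OF P _ _ assms(7,4), of t] that
    unfolding a assms(10) by auto
  have part2: "(let R = s powr (\<alpha> + 1) * c * a\<^sub>T *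
                   (LBINT x\<^sub>2:{t/s..1}. LBINT x\<^sub>1:{0..t/s}.
                      (x\<^sub>2 - x\<^sub>1) powr (\<alpha> - 1) * exp (- lam * s * (x\<^sub>2 - x\<^sub>1))) +
                 t powr (\<alpha> + 1) * 2 * c * a\<^sub>T *
                   (LBINT x:{0..1}. LBINT y:{0..x}. exp (- lam * t * y) * y powr (\<alpha> - 1))
         in (\<integral>\<omega>. X t \<omega> * X s \<omega> \<partial>M) = R \<and> cov M (X t) (X s) = R - t * s * a\<^sub>T\<^sup>2)"
    if "0 < t \<and> t < s \<and> s \<le> T" for t s
  proof -
    have ts: "0 < t" "t < s" "s \<le> T" using that by auto
    note R = product_moment[OF P ts assms(7,4,5)]
    have "cov M (X t) (X s) = (\<integral>\<omega>. X t \<omega> * X s \<omega> \<partial>M) - (t * a\<^sub>T) * (s * a\<^sub>T)"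
      using ts first_moment[OF P _ _ assms(7,4), of t] first_moment[OF P _ _ assms(7,4), of s]
      by (subst cov_eq[OF limit_process_basics(1)[OF P] _ _ R(1)]) (simp_all add: a)
    then show ?thesis unfolding Let_def a R(2) by (simp add: power2_eq_square mult_ac)
  qed
  have part3: "(let c' = a\<^sub>T * c; c'' = 2 / (\<alpha> * (\<alpha> + 1));
             g = exp (- lam * t) * t powr (\<alpha> - 1);
             h = b * exp (- lam * T) * T powr (\<alpha> - 1)
         in ((\<lambda>\<Delta>. (\<integral>\<omega>. backward_incr X \<Delta> s \<omega> * backward_incr X \<Delta> (s + t) \<omega> \<partial>M) /
                  (c' * \<Delta>\<^sup>2 * g)) \<longlongrightarrow> 1) (at_right 0) \<and>
            ((\<lambda>\<Delta>. cov M (backward_incr X \<Delta> s) (backward_incr X \<Delta> (s + t)) /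
                  (c' * \<Delta>\<^sup>2 * (g - h))) \<longlongrightarrow> 1) (at_right 0) \<and>
            ((\<lambda>\<Delta>. corr M (backward_incr X \<Delta> s) (backward_incr X \<Delta> (s + t)) /
                  ((g - h) / (c'' * \<Delta> powr (\<alpha> - 1) - h))) \<longlongrightarrow> 1) (at_right 0))"
    if "0 < s \<and> 0 < t \<and> s + t \<le> T" for s t
  proof -
    have st: "0 < s" "0 < t" "s + t \<le> T" using that by auto
    \<comment> \<open>\<open>b \<le> 1\<close> reduces the claim to the decay between
      \<open>t\<close> and \<open>T\<close>; here \<open>t < T\<close> because
      \<open>s > 0\<close>.\<close>
    have "h \<le> 1 * (exp (- lam * T) * T powr (\<alpha> - 1))"
      unfolding h_def mult.assoc using assms(2,3) by (intro mult_right_mono) auto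
    also have "\<dots> < exp (- lam * t) * t powr (\<alpha> - 1)"
      using decay_strict_antimono[of t T \<alpha> lam] st assms(5,6) by simp
    finally have g: "h < exp (- lam * t) * t powr (\<alpha> - 1)" .
    show ?thesis
      unfolding Let_def a h_def[symmetric]
      using backward_incr_corr_asymp[OF P assms(7,4,5,2) st h h1 refl g] by blast
  qed
  have part4: "((\<lambda>d. (\<integral>\<omega>. (\<Prod>i=1..m. backward_incr X d (t i) \<omega> ^ k i) \<partial>M) /
              (\<Prod>i=1..m. \<integral>\<omega>. backward_incr X d (t i) \<omega> ^ k i \<partial>M))
           \<longlongrightarrow> exp (- lam * (t m - t 1)) * (c / a\<^sub>T) ^ (m - 1) *
               (\<Prod>i=2..m. (t i - t (i - 1)) powr (\<alpha> - 1))) (at_right 0)"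
    if "m \<ge> 1 \<and> 0 < t 1 \<and> (\<forall>i \<in> {2..m}. t (i - 1) < t i) \<and> t m \<le> T \<and> (\<forall>i \<in> {1..m}. k i \<ge> 1)"
    for m :: nat and t :: "nat \<Rightarrow> real" and k :: "nat \<Rightarrow> nat"
    unfolding a by (rule backward_incr_joint_moment_ratio[OF P assms(7,4,5,2)]) (use that in blast)+
  show ?thesis using part1 part2 part3 part4 by blast
qed

end
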